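(* Let $0<p_0<p_1\le\infty$, $0<q\le\infty$, $0<r_1\le r_0\le\infty$ and $\beta_0,\beta_1\in\mathbb{R}$ satisfy $\beta_0-\beta_1=\frac{d}{p_0}-\frac{d}{p_1}$. Then there are the continuous embeddings $$\mathrm T^{p_0,q,r_0}_{\beta_0}\hookrightarrow\mathrm Z^{p_1,p_0,r_1}_{\beta_1}\qquad\text{and}\qquad \mathrm Z^{p_0,p_1,r_0}_{\beta_0}\hookrightarrow\mathrm T^{p_1,q,r_1}_{\beta_1}.$$
   Context: The symbol ⨍ denotes the mean-value integral and $B(x,t)$ the open ball in $\mathbb{R}^d$; $\mathbb{R}^{d+1}_+=(0,\infty)\times\mathbb{R}^d$. For $0<r\le\infty$, $\beta\in\mathbb{R}$ and measurable $f$ on $\mathbb{R}^{d+1}_+$ write $W_{r,\beta}f(t,x)=\big(⨍_{t/2}^t⨍_{B(x,t)}|s^{-\beta}f(s,y)|^r\,\mathrm{d}y\,\mathrm{d}s\big)^{1/r}$ (essential supremum of $|s^{-\beta}f(s,y)|$ over $(\frac t2,t]\times B(x,t)$ if $r=\infty$). For $0<p,q,r\le\infty$ the tent space $\mathrm T^{p,q,r}_\beta$ is the set of measurable $f$ with finite (quasi-)norm, where $$\|f\|_{\mathrm T^{p,q,r}_\beta}=\Big\|\Big(\int_0^\infty (W_{r,\beta}f(t,\cdot))^q\frac{\mathrm{d}t}{t}\Big)^{1/q}\Big\|_{L^p(\mathbb{R}^d)}\quad(p<\infty),$$ with $\operatorname{ess\,sup}_{t>0}$ in place of the $t$-integral if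 $q=\infty$; $$\|f\|_{\mathrm T^{\infty,q,r}_\beta}=\sup_{\tau>0}\sup_{y\in\mathbb{R}^d}\Big(\int_0^\tau⨍_{B(y,\tau)}(W_{r,\beta}f(t,x))^q\frac{\mathrm{d}x\,\mathrm{d}t}{t}\Big)^{1/q}\quad(q<\infty),\qquad \|f\|_{\mathrm T^{\infty,\infty,r}_\beta}=\sup_{t>0}\sup_{x\in\mathbb{R}^d}W_{r,\beta}f(t,x).$$ The space $\mathrm Z^{p,q,r}_\beta$ ($0<p,q,r\le\infty$) is the set of measurable $f$ on $\mathbb{R}^{d+1}_+$ with $$\|f\|_{\mathrm Z^{p,q,r}_\beta}=\Big(\int_0^\infty\|W_{r,\beta}f(t,\cdot)\|_{L^p(\mathbb{R}^d)}^q\frac{\mathrm{d}t}{t}\Big)^{1/q}<\infty,$$ with $\operatorname{ess\,sup}_{t>0}$ in place of the $t$-integral if $q=\infty$. *)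

theory Defs
  imports "HOL-Analysis.Analysis" "HOL-Probability.Essential_Supremum"
begin

text \<open>
  Exponents range over \<open>(0, \<infinity>]\<close> and are elements of type \<^typ>\<open>ennreal\<close>. All (quasi-)norms take values
  in \<^typ>\<open>ennreal\<close>, and \<open>\<real>\<^sup>d\<close> is an arbitrary Euclidean space \<open>'a\<close>, so \<open>d = DIM('a)\<close>.
\<close>

text \<open>\<open>x\<^sup>a\<close> on \<open>[0, \<infinity>]\<close>, intended for real exponents \<open>a > 0\<close> only.\<close>

definition ennreal_pow :: "ennreal \<Rightarrow> real \<Rightarrow> ennreal" where
  "ennreal_pow x a = (if x = \<infinity> then \<infinity> else ennreal (enn2real x powr a))"

definition Lp_norm :: "'b measure \<Rightarrow> ennreal \<Rightarrow> ('b \<Rightarrow> ennreal) \<Rightarrow> ennreal" where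
  "Lp_norm M p g =
    (if p = \<infinity> then esssup M g
     else ennreal_pow (\<integral>\<^sup>+x. ennreal_pow (g x) (enn2real p) \<partial>M) (1 / enn2real p))"

definition mean_value :: "'b::euclidean_space set \<Rightarrow> ('b \<Rightarrow> ennreal) \<Rightarrow> ennreal" where
  "mean_value A g = (\<integral>\<^sup>+x\<in>A. g x \<partial>lebesgue) / emeasure lebesgue A"

text \<open>The measure \<open>dt / t\<close> on \<open>(0, \<infinity>)\<close>.\<close>

definition dt_over_t :: "real measure" where
  "dt_over_t = density (lebesgue_on {0<..}) (\<lambda>t. ennreal (1 / t))"

definition upper_half_space :: "(real \<times> 'a::euclidean_space) set" where
  "upper_half_space = {0<..} \<times> UNIV"

definition whitney_avg ::
    "ennreal \<Rightarrow> real \<Rightarrow> (real \<times> 'a::euclidean_space \<Rightarrow> complex) \<Rightarrow> real \<Rightarrow> 'a \<Rightarrow> ennreal" where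
  "whitney_avg r \<beta> f t x =
    (if r = \<infinity>
     then esssup (lebesgue_on ({t/2<..t} \<times> ball x t))
            (\<lambda>(s, y). ennreal (norm (s powr (-\<beta>) *\<^sub>R f (s, y))))
     else ennreal_pow
            (mean_value {t/2<..t} (\<lambda>s. mean_value (ball x t)
              (\<lambda>y. ennreal_pow (ennreal (norm (s powr (-\<beta>) *\<^sub>R f (s, y)))) (enn2real r))))
            (1 / enn2real r))"

definition tent_norm ::
    "ennreal \<Rightarrow> ennreal \<Rightarrow> ennreal \<Rightarrow> real \<Rightarrow> (real \<times> 'a::euclidean_space \<Rightarrow> complex) \<Rightarrow> ennreal" where
  "tent_norm p q r \<beta> f =
    (if p < \<infinity> then
       Lp_norm lebesgue p (\<lambda>x. Lp_norm dt_over_t q (\<lambda>t. whitney_avg r \<beta> f t x))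
     else if q < \<infinity> then
       (SUP \<tau>\<in>{0<..}. SUP y. ennreal_pow
         (\<integral>\<^sup>+t\<in>{0<..<\<tau>}.
            mean_value (ball y \<tau>) (\<lambda>x. ennreal_pow (whitney_avg r \<beta> f t x) (enn2real q)) \<partial>dt_over_t)
         (1 / enn2real q))
     else (SUP t\<in>{0<..}. SUP x. whitney_avg r \<beta> f t x))"

definition Z_norm ::
    "ennreal \<Rightarrow> ennreal \<Rightarrow> ennreal \<Rightarrow> real \<Rightarrow> (real \<times> 'a::euclidean_space \<Rightarrow> complex) \<Rightarrow> ennreal" where
  "Z_norm p q r \<beta> f =
    Lp_norm dt_over_t q (\<lambda>t. Lp_norm lebesgue p (\<lambda>x. whitney_avg r \<beta> f t x))"

text \<open>
  Elements of the spaces are functions rather than classes modulo equality almost everywhere on the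
  half-space; both norms depend only on the class. Values outside the half-space are irrelevant.
\<close>

definition tent_space ::
    "ennreal \<Rightarrow> ennreal \<Rightarrow> ennreal \<Rightarrow> real \<Rightarrow> (real \<times> 'a::euclidean_space \<Rightarrow> complex) set" where
  "tent_space p q r \<beta> =
    {f \<in> borel_measurable (lebesgue_on upper_half_space). tent_norm p q r \<beta> f < \<infinity>}"

definition Z_space ::
    "ennreal \<Rightarrow> ennreal \<Rightarrow> ennreal \<Rightarrow> real \<Rightarrow> (real \<times> 'a::euclidean_space \<Rightarrow> complex) set" where
  "Z_space p q r \<beta> =
    {f \<in> borel_measurable (lebesgue_on upper_half_space). Z_norm p q r \<beta> f < \<infinity>}"

text \<open>Continuity of the inclusion between quasi-normed spaces, as a norm estimate.\<close>

definition continuously_embedded ::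
    "'f set \<Rightarrow> ('f \<Rightarrow> ennreal) \<Rightarrow> 'f set \<Rightarrow> ('f \<Rightarrow> ennreal) \<Rightarrow> bool" where
  "continuously_embedded X normX Y normY \<longleftrightarrow>
    X \<subseteq> Y \<and> (\<exists>C::real. \<forall>f\<in>X. normY f \<le> ennreal C * normX f)"

end

theory Submission
  imports Defs
begin

text \<open>
  Let \<open>w\<close> be the Whitney average of \<open>f\<close> for \<open>(r\<^sub>0, \<beta>\<^sub>0)\<close>. On a Whitney box the time variable is at most
  \<open>t\<close>, so the average for \<open>(r\<^sub>1, \<beta>\<^sub>1)\<close> is at most \<open>t\<^sup>\<gamma> w\<close> with \<open>\<gamma> = d/p\<^sub>0 - d/p\<^sub>1\<close>. Covering a box by finitely
  many small pieces shows that \<open>w(t, x)\<close> is dominated by a constant times \<open>w\<close> on a whole region of size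
  \<open>t\<close> near \<open>(t, x)\<close>; this replaces all changes of aperture, and every power \<open>w\<^sup>\<eta>\<close> is bounded by its own
  averages at scale \<open>t\<close>.

  For the first embedding, \<open>w\<^sup>\<eta>(t, \<cdot>)\<close> is bounded by the averages over balls of radius \<open>2t\<close> of
  \<open>g = A\<^sup>\<eta>\<close>, where \<open>A\<close> is the inner norm of the tent space and \<open>\<eta> < min(p\<^sub>0, q)\<close>. An average exceeding a
  level \<open>\<mu>\<close> already comes from the part of \<open>g\<close> above a multiple of \<open>\<mu>\<close>, which bounds both the measure
  of the superlevel set and the scales \<open>t\<close> at which it is nonempty. Summing over dyadic levels gives the
  mixed norm estimate.

  The second embedding with \<open>p\<^sub>1 < \<infinity>\<close> is the dual of this estimate for ball averages, applied to
  \<open>w\<^sup>\<eta>\<close>; for \<open>p\<^sub>1 = \<infinity>\<close> it follows from the pointwise bound \<open>t\<^sup>\<gamma> w \<le> C B\<close>, where \<open>B\<close> is the \<open>Z\<close>-norm,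
  and Hoelder's inequality.
\<close>

section \<open>Powers and integral inequalities on the extended half-line\<close>

text \<open>For Triebel-Lizorkin and Besov spaces, embeddings of this kind are those of Jawerth and
  Franke. The obstacle is the sharp time exponent, \<open>p\<^sub>0\<close> in the first inclusion
  and \<open>p\<^sub>1\<close> in the second: estimating each scale by itself only yields a supremum
  over t. The sum over scales is saved by an exact balance. For one level let e be a multiple of the
  truncated mass divided by the level. The measure of the superlevel set contributes e to the power
  \<theta> = \<open>p\<^sub>0\<close>/\<open>p\<^sub>1\<close>, and integrating the weight over the
  admissible scales contributes e to the power 1 - \<theta>. The product is linear in the truncated
  mass, so the sum over levels is a layer-cake formula.

  The exponent \<eta> has two tasks. Exponents below 1 admit neither strong bounds for averages nor
  duality, but \<open>p\<^sub>0\<close>/\<eta> and \<open>p\<^sub>1\<close>/\<eta> exceed 1.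
  Moreover q is only felt through the behaviour of w on one scale, where every exponent larger than
  \<eta> is as good as any other; this is why q is arbitrary in both inclusions.\<close>

lemma ennreal_pow_ennreal: "0 \<le> x \<Longrightarrow> ennreal_pow (ennreal x) a = ennreal (x powr a)"
  by (simp add: ennreal_pow_def)

lemma ennreal_pow_top [simp]: "ennreal_pow top a = top"
  by (simp add: ennreal_pow_def)

lemma ennreal_pow_zero [simp]: "ennreal_pow 0 a = 0"
  by (simp add: ennreal_pow_def)

lemma ennreal_pow_eq_top_iff [simp]: "ennreal_pow x a = top \<longleftrightarrow> x = top"
  by (simp add: ennreal_pow_def)

lemma ennreal_pow_less_top_iff [simp]: "ennreal_pow x a < top \<longleftrightarrow> x < top"
  by (metis ennreal_pow_eq_top_iff less_top)

lemma ennreal_pow_eq_0_iff [simp]: "ennreal_pow x a = 0 \<longleftrightarrow> x = 0"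
  by (cases x) (auto simp: ennreal_pow_ennreal)

lemma ennreal_pow_1 [simp]: "ennreal_pow x 1 = x"
  by (cases x) (auto simp: ennreal_pow_ennreal)

lemma ennreal_pow_one [simp]: "ennreal_pow 1 a = 1"
  using ennreal_pow_ennreal[of 1 a] by simp

lemma ennreal_pow_pow: "ennreal_pow (ennreal_pow x a) b = ennreal_pow x (a * b)"
  by (cases x) (auto simp: ennreal_pow_ennreal powr_powr)

lemma ennreal_pow_mult: "ennreal_pow (x * y) a = ennreal_pow x a * ennreal_pow y a"
proof (cases "x = top \<or> y = top")
  case True
  then show ?thesis
    by (cases "x = 0"; cases "y = 0") (auto simp: ennreal_mult_top ennreal_top_mult)
next
  case False
  then obtain u v where "x = ennreal u" "0 \<le> u" "y = ennreal v" "0 \<le> v"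
    by (cases x; cases y) auto
  then show ?thesis
    by (simp add: ennreal_pow_ennreal powr_mult flip: ennreal_mult)
qed

lemma ennreal_pow_add: "ennreal_pow x (a + b) = ennreal_pow x a * ennreal_pow x b"
  by (cases x) (auto simp: ennreal_pow_ennreal powr_add ennreal_mult)

lemma ennreal_pow_mono: "0 \<le> a \<Longrightarrow> x \<le> y \<Longrightarrow> ennreal_pow x a \<le> ennreal_pow y a"
  by (cases x; cases y) (auto simp: ennreal_pow_ennreal powr_mono2 top_unique)

lemma ennreal_pow_le_iff: "0 < a \<Longrightarrow> ennreal_pow x a \<le> ennreal_pow y a \<longleftrightarrow> x \<le> y"
  using ennreal_pow_mono[of a x y] ennreal_pow_mono[of "1/a" "ennreal_pow x a" "ennreal_pow y a"]
  by (auto simp: ennreal_pow_pow)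

lemma ennreal_pow_le_swap: "0 < a \<Longrightarrow> ennreal_pow x a \<le> y \<longleftrightarrow> x \<le> ennreal_pow y (1 / a)"
  using ennreal_pow_le_iff[of a x "ennreal_pow y (1 / a)"] by (simp add: ennreal_pow_pow)

lemma le_ennreal_pow_swap: "0 < a \<Longrightarrow> y \<le> ennreal_pow x a \<longleftrightarrow> ennreal_pow y (1 / a) \<le> x"
  using ennreal_pow_le_iff[of a "ennreal_pow y (1 / a)" x] by (simp add: ennreal_pow_pow)

lemma ennreal_pow_SUP_le: "0 < a \<Longrightarrow> (\<And>i. i \<in> I \<Longrightarrow> ennreal_pow (f i) a \<le> B) \<Longrightarrow>
    ennreal_pow (SUP i\<in>I. f i) a \<le> B"
  by (simp add: ennreal_pow_le_swap SUP_least)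

lemma measurable_ennreal_pow [measurable (raw)]:
  assumes [measurable]: "f \<in> borel_measurable M"
  shows "(\<lambda>x. ennreal_pow (f x) a) \<in> borel_measurable M"
  unfolding ennreal_pow_def by measurable

section \<open>Young's, Hoelder's and the power mean inequality for \<open>ennreal\<close>-valued
  functions\<close>

lemma ennreal_Young:
  assumes "1 < p" "1 < q" "1 / p + 1 / q = 1"
  shows "u * v \<le> ennreal (1 / p) * ennreal_pow u p + ennreal (1 / q) * ennreal_pow v q"
proof (cases "u = top \<or> v = top")
  case True
  then show ?thesis using assms by (auto simp: ennreal_mult_top)
next
  case False
  then obtain a b where *: "u = ennreal a" "0 \<le> a" "v = ennreal b" "0 \<le> b"
    by (cases u; cases v) auto
  have "a * b \<le> a powr p / p + b powr q / q"
    using assms * by (intro Youngs_inequality) auto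
  then show ?thesis
    using * assms by (simp add: ennreal_pow_ennreal flip: ennreal_mult ennreal_plus)
qed

lemma Holder_nn_integral:
  assumes pq: "1 < p" "1 < q" "1 / p + 1 / q = 1"
    and [measurable]: "f \<in> borel_measurable M" "g \<in> borel_measurable M"
  shows "(\<integral>\<^sup>+x. f x * g x \<partial>M)
    \<le> ennreal_pow (\<integral>\<^sup>+x. ennreal_pow (f x) p \<partial>M) (1 / p)
      * ennreal_pow (\<integral>\<^sup>+x. ennreal_pow (g x) q \<partial>M) (1 / q)"
    (is "_ \<le> ennreal_pow ?A _ * ennreal_pow ?B _")
proof -
  consider (zero) "?A = 0 \<or> ?B = 0" | (top) "?A \<noteq> 0" "?B \<noteq> 0" "?A = top \<or> ?B = top"
    | (fin) "0 < ?A" "?A < top" "0 < ?B" "?B < top"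
    by (metis less_top not_gr_zero)
  then show ?thesis
  proof cases
    case zero
    then have "(AE x in M. f x = 0) \<or> (AE x in M. g x = 0)"
      by (auto simp: nn_integral_0_iff_AE)
    then have "AE x in M. f x * g x = 0" by auto
    then have "(\<integral>\<^sup>+x. f x * g x \<partial>M) = 0" by (simp add: nn_integral_0_iff_AE)
    then show ?thesis by simp
  next
    case top
    then show ?thesis by (auto simp: ennreal_mult_top ennreal_top_mult)
  next
    case fin
    then obtain a b where a: "?A = ennreal a" "0 < a" and b: "?B = ennreal b" "0 < b"
      by (metis ennreal_cases ennreal_less_zero_iff less_top_ennreal top.not_eq_extremum)
    define \<alpha> \<beta> where "\<alpha> = a powr (1 / p)" and "\<beta> = b powr (1 / q)"
    have ab: "0 < \<alpha>" "0 < \<beta>" "\<alpha> powr p = a" "\<beta> powr q = b"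
      using a b pq by (auto simp: \<alpha>_def \<beta>_def powr_powr)
    have ab': "ennreal_pow (ennreal (1 / \<alpha>)) p = ennreal (1 / a)"
       "ennreal_pow (ennreal (1 / \<beta>)) q = ennreal (1 / b)"
      using ab by (auto simp: ennreal_pow_ennreal powr_divide)
    have "ennreal (1 / \<alpha>) * ennreal (1 / \<beta>) * (\<integral>\<^sup>+x. f x * g x \<partial>M)
        = (\<integral>\<^sup>+x. (ennreal (1 / \<alpha>) * f x) * (ennreal (1 / \<beta>) * g x) \<partial>M)"
      by (simp add: nn_integral_cmult[symmetric] mult_ac)
    also have "\<dots> \<le> (\<integral>\<^sup>+x. ennreal (1 / p) * ennreal_pow (ennreal (1 / \<alpha>) * f x) p
        + ennreal (1 / q) * ennreal_pow (ennreal (1 / \<beta>) * g x) q \<partial>M)"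
      by (intro nn_integral_mono ennreal_Young pq)
    also have "\<dots> = ennreal (1 / p) * (ennreal (1 / a) * ?A) + ennreal (1 / q) * (ennreal (1 / b) * ?B)"
      by (simp add: nn_integral_add nn_integral_cmult ennreal_pow_mult ab' del: ennreal_1)
    also have "\<dots> = 1"
      using a b pq by (simp add: ennreal_mult[symmetric] ennreal_plus[symmetric] del: ennreal_plus)
    finally have "ennreal (\<alpha> * \<beta>) * (ennreal (1 / \<alpha>) * ennreal (1 / \<beta>) * (\<integral>\<^sup>+x. f x * g x \<partial>M))
      \<le> ennreal (\<alpha> * \<beta>) * 1" by (rule mult_left_mono) simp
    then have "(\<integral>\<^sup>+x. f x * g x \<partial>M) \<le> ennreal (\<alpha> * \<beta>)"
      using ab by (simp add: mult.assoc[symmetric] ennreal_mult[symmetric])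
    also have "\<dots> = ennreal_pow ?A (1 / p) * ennreal_pow ?B (1 / q)"
      using a b ab by (simp add: ennreal_pow_ennreal \<alpha>_def \<beta>_def ennreal_mult)
    finally show ?thesis .
  qed
qed

text \<open>Hoelder's inequality with exponents b/a and b/(b-a) against the indicator of E. It is
  applied on time intervals, on balls and on Whitney boxes.\<close>

lemma power_mean_nn_integral:
  assumes ab: "0 < a" "a < b"
    and [measurable]: "h \<in> borel_measurable M" "E \<in> sets M"
  shows "(\<integral>\<^sup>+x\<in>E. ennreal_pow (h x) a \<partial>M)
    \<le> ennreal_pow (\<integral>\<^sup>+x\<in>E. ennreal_pow (h x) b \<partial>M) (a / b) * ennreal_pow (emeasure M E) (1 - a / b)"
proof -
  define p q where "p = b / a" and "q = b / (b - a)"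
  have pq: "1 < p" "1 < q" "1 / p + 1 / q = 1"
    using ab by (auto simp: p_def q_def divide_simps)
  have "(\<integral>\<^sup>+x\<in>E. ennreal_pow (h x) a \<partial>M)
      = (\<integral>\<^sup>+x. (ennreal_pow (h x) a * indicator E x) * indicator E x \<partial>M)"
    by (intro nn_integral_cong) (auto split: split_indicator)
  also have "\<dots> \<le> ennreal_pow (\<integral>\<^sup>+x. ennreal_pow (ennreal_pow (h x) a * indicator E x) p \<partial>M) (1 / p)
      * ennreal_pow (\<integral>\<^sup>+x. ennreal_pow (indicator E x) q \<partial>M) (1 / q)"
    by (intro Holder_nn_integral pq) measurable
  also have "(\<integral>\<^sup>+x. ennreal_pow (ennreal_pow (h x) a * indicator E x) p \<partial>M)
      = (\<integral>\<^sup>+x\<in>E. ennreal_pow (h x) b \<partial>M)"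
    using ab by (intro nn_integral_cong)
      (auto split: split_indicator simp: ennreal_pow_pow p_def)
  also have "(\<integral>\<^sup>+x. ennreal_pow (indicator E x) q \<partial>M) = (\<integral>\<^sup>+x. indicator E x \<partial>M)"
    by (intro nn_integral_cong) (auto split: split_indicator)
  also have "\<dots> = emeasure M E" by simp
  also have "1 / p = a / b" using ab by (simp add: p_def)
  also have "1 / q = 1 - a / b" using ab by (simp add: q_def field_simps)
  finally show ?thesis .
qed

text \<open>Each f k is the product of (f k)^\<alpha> and a power of (f k)^\<alpha>, and the second
  factor is at most the same power of the whole sum. With \<alpha> = \<theta> this lets a
  finite-exponent norm be summed over dyadic levels.\<close>

lemma ennreal_pow_nn_integral_count_space_le:
  assumes "0 < \<alpha>" "\<alpha> \<le> 1"
  shows "ennreal_pow (\<integral>\<^sup>+k. f k \<partial>count_space UNIV) \<alpha>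
    \<le> (\<integral>\<^sup>+k. ennreal_pow (f k) \<alpha> \<partial>count_space UNIV)" (is "_ \<le> ?T")
proof (cases "?T = top")
  case False
  have le: "ennreal_pow (f k) \<alpha> \<le> ?T" for k
    by (rule nn_integral_ge_point) simp
  have "f k \<le> ennreal_pow (f k) \<alpha> * ennreal_pow ?T ((1 - \<alpha>) / \<alpha>)" for k
  proof -
    have "f k = ennreal_pow (f k) \<alpha> * ennreal_pow (f k) (1 - \<alpha>)"
      by (simp flip: ennreal_pow_add)
    also have "ennreal_pow (f k) (1 - \<alpha>) = ennreal_pow (ennreal_pow (f k) \<alpha>) ((1 - \<alpha>) / \<alpha>)"
      using assms by (simp add: ennreal_pow_pow)
    also have "\<dots> \<le> ennreal_pow ?T ((1 - \<alpha>) / \<alpha>)"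
      using assms by (intro ennreal_pow_mono le) auto
    finally show ?thesis by (simp add: mult_left_mono)
  qed
  then have "(\<integral>\<^sup>+k. f k \<partial>count_space UNIV)
      \<le> (\<integral>\<^sup>+k. ennreal_pow (f k) \<alpha> * ennreal_pow ?T ((1 - \<alpha>) / \<alpha>) \<partial>count_space UNIV)"
    by (intro nn_integral_mono)
  also have "\<dots> = ennreal_pow ?T 1 * ennreal_pow ?T ((1 - \<alpha>) / \<alpha>)"
    by (simp add: nn_integral_multc)
  also have "\<dots> = ennreal_pow ?T (1 / \<alpha>)"
    using assms by (simp add: field_simps flip: ennreal_pow_add del: ennreal_pow_1)
  finally show ?thesis using assms by (simp add: ennreal_pow_le_swap)
qed auto

section \<open>Ball averages\<close>

text \<open>The Haar measure dt/t of the multiplicative group, kept on the Borel sets of the whole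
  line with density 0 on the nonpositive half. In this form Tonelli's theorem with
  \<open>lborel\<close> works in Borel product spaces; \<open>dt_over_t\<close> is compared with it
  only at the end.\<close>

definition haar :: "real measure" where
  "haar = density lborel (\<lambda>t. ennreal (if 0 < t then 1 / t else 0))"

lemma sets_haar [simp, measurable_cong]: "sets haar = sets borel"
  by (simp add: haar_def)

lemma space_haar [simp]: "space haar = UNIV"
  by (simp add: haar_def)

interpretation haar: sigma_finite_measure haar
  unfolding haar_def by (subst sigma_finite_measure.sigma_finite_iff_density_finite[OF sigma_finite_lborel]) auto

interpretation haar_lborel: pair_sigma_finite haar "lborel :: 'a::euclidean_space measure" ..
interpretation haar_haar: pair_sigma_finite haar haar ..

lemma nn_integral_haar:
  "f \<in> borel_measurable borel \<Longrightarrow>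
    (\<integral>\<^sup>+t. f t \<partial>haar) = (\<integral>\<^sup>+t. ennreal (if 0 < t then 1 / t else 0) * f t \<partial>lborel)"
  unfolding haar_def by (rule nn_integral_density) auto

lemma AE_haar_pos: "AE t in haar. 0 < t"
  unfolding haar_def by (subst AE_density) auto

lemma nn_integral_haar_mono:
  "(\<And>t. 0 < t \<Longrightarrow> f t \<le> g t) \<Longrightarrow> (\<integral>\<^sup>+t. f t \<partial>haar) \<le> (\<integral>\<^sup>+t. g t \<partial>haar)"
  by (rule nn_integral_mono_AE) (use AE_haar_pos in auto)

lemma nn_integral_haar_powr_le:
  assumes "0 < \<delta>" "0 \<le> R"
  shows "(\<integral>\<^sup>+t. ennreal (t powr \<delta>) * indicator {..R} t \<partial>haar) \<le> ennreal (R powr \<delta> / \<delta>)"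
proof -
  have "(\<integral>\<^sup>+t. ennreal (t powr \<delta>) * indicator {..R} t \<partial>haar)
      = (\<integral>\<^sup>+t. ennreal (if 0 < t then 1 / t else 0) * (ennreal (t powr \<delta>) * indicator {..R} t) \<partial>lborel)"
    by (rule nn_integral_haar) measurable
  also have "\<dots> \<le> (\<integral>\<^sup>+t. ennreal (t powr (\<delta> - 1)) * indicator {0..R} t \<partial>lborel)"
  proof (rule nn_integral_mono)
    fix t :: real
    show "ennreal (if 0 < t then 1 / t else 0) * (ennreal (t powr \<delta>) * indicator {..R} t)
      \<le> ennreal (t powr (\<delta> - 1)) * indicator {0..R} t"
    proof (cases "0 < t")
      case True
      then have "1 / t * t powr \<delta> = t powr (\<delta> - 1)" by (simp add: powr_diff)
      then show ?thesis using True
        by (auto simp: ennreal_mult[symmetric] mult.assoc[symmetric] split: split_indicator)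
    qed simp
  qed
  also have "\<dots> = ennreal (R powr (\<delta> - 1 + 1) / (\<delta> - 1 + 1))"
    using assms by (intro nn_integral_has_integral_lebesgue' has_integral_powr_from_0) auto
  finally show ?thesis by simp
qed

lemma measurable_indicator_ball [measurable (raw)]:
  fixes f h :: "'b \<Rightarrow> 'a::euclidean_space"
  assumes [measurable]: "f \<in> borel_measurable M" "h \<in> borel_measurable M" "r \<in> borel_measurable M"
  shows "(\<lambda>p. indicator (ball (f p) (r p)) (h p) :: ennreal) \<in> borel_measurable M"
  unfolding indicator_def ball_def mem_Collect_eq by measurable

text \<open>The normalisation is t^d, not the volume of the ball of radius c * t. A constant is
  therefore multiplied by V, the volume of the ball of radius c, and this V appears in all
  thresholds below.\<close>

definition ball_avg :: "real \<Rightarrow> ('a::euclidean_space \<Rightarrow> ennreal) \<Rightarrow> real \<Rightarrow> 'a \<Rightarrow> ennreal" where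
  "ball_avg c g t x = ennreal (t powr - real DIM('a)) * (\<integral>\<^sup>+y\<in>ball x (c * t). g y \<partial>lborel)"

lemma measurable_ball_avg [measurable (raw)]:
  fixes g :: "'a::euclidean_space \<Rightarrow> ennreal"
  assumes [measurable]: "g \<in> borel_measurable borel" "f \<in> borel_measurable M" "h \<in> borel_measurable M"
  shows "(\<lambda>p. ball_avg c g (f p) (h p)) \<in> borel_measurable M"
  unfolding ball_avg_def by measurable

lemma ball_avg_mono: "(\<And>y. g y \<le> h y) \<Longrightarrow> ball_avg c g t x \<le> ball_avg c h t x"
  unfolding ball_avg_def by (intro mult_left_mono nn_integral_mono mult_right_mono) auto

lemma ball_avg_cmult:
  "g \<in> borel_measurable borel \<Longrightarrow> ball_avg c (\<lambda>y. C * g y) t x = C * ball_avg c g t x"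
  unfolding ball_avg_def by (simp add: nn_integral_cmult mult_ac)

section \<open>Superlevel sets of ball averages at a fixed scale\<close>

context
  fixes c :: real and V :: real
  assumes c: "0 < c" and V_def: "V = unit_ball_vol (real DIM('a::euclidean_space)) * c ^ DIM('a)"
begin

lemma ball_volume_pos: "0 < V"
  using c by (simp add: V_def)

lemma emeasure_ball_scaled:
  "0 < t \<Longrightarrow> emeasure lborel (ball (x::'a) (c * t)) = ennreal (V * t powr real DIM('a))"
  using c by (simp add: emeasure_ball V_def powr_realpow power_mult_distrib mult_ac)

lemma ball_avg_const: "0 < t \<Longrightarrow> ball_avg c (\<lambda>y::'a. a) t x = ennreal V * a"
proof -
  assume t: "0 < t"
  have "ball_avg c (\<lambda>y::'a. a) t x
      = ennreal (t powr - real DIM('a)) * (a * ennreal (V * t powr real DIM('a)))"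
    using t by (simp add: ball_avg_def nn_integral_cmult_indicator emeasure_ball_scaled)
  also have "\<dots> = ennreal (t powr - real DIM('a) * (V * t powr real DIM('a))) * a"
    using ball_volume_pos by (simp add: ennreal_mult mult_ac)
  also have "t powr - real DIM('a) * (V * t powr real DIM('a)) = V"
    using t by (simp add: powr_minus)
  finally show ?thesis .
qed

lemma nn_integral_ball_avg:
  fixes g :: "'a \<Rightarrow> ennreal"
  assumes [measurable]: "g \<in> borel_measurable borel" and t: "0 < t"
  shows "(\<integral>\<^sup>+x. ball_avg c g t x \<partial>lborel) = ennreal V * (\<integral>\<^sup>+x. g x \<partial>lborel)"
proof -
  have "(\<integral>\<^sup>+x. ball_avg c g t x \<partial>lborel)
      = ennreal (t powr - real DIM('a)) * (\<integral>\<^sup>+x. \<integral>\<^sup>+y. g y * indicator (ball x (c * t)) y \<partial>lborel \<partial>lborel)"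
    unfolding ball_avg_def by (rule nn_integral_cmult) measurable
  also have "(\<integral>\<^sup>+x. \<integral>\<^sup>+y. g y * indicator (ball x (c * t)) y \<partial>lborel \<partial>lborel)
      = (\<integral>\<^sup>+y. \<integral>\<^sup>+x. g y * indicator (ball x (c * t)) y \<partial>lborel \<partial>lborel)"
    by (rule lborel_pair.Fubini') measurable
  also have "\<dots> = (\<integral>\<^sup>+y. \<integral>\<^sup>+x. g y * indicator (ball y (c * t)) x \<partial>lborel \<partial>lborel)"
    by (intro nn_integral_cong) (auto simp: dist_commute split: split_indicator)
  also have "\<dots> = (\<integral>\<^sup>+y. g y * ennreal (V * t powr real DIM('a)) \<partial>lborel)"
    using t by (simp add: nn_integral_cmult_indicator emeasure_ball_scaled)
  also have "\<dots> = ennreal (V * t powr real DIM('a)) * (\<integral>\<^sup>+y. g y \<partial>lborel)"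
    by (simp add: nn_integral_multc mult.commute)
  also have "ennreal (t powr - real DIM('a)) * \<dots>
      = ennreal (t powr - real DIM('a) * (V * t powr real DIM('a))) * (\<integral>\<^sup>+y. g y \<partial>lborel)"
    using ball_volume_pos by (simp add: ennreal_mult mult_ac)
  also have "t powr - real DIM('a) * (V * t powr real DIM('a)) = V"
    using t by (simp add: powr_minus)
  finally show ?thesis .
qed

lemma ball_avg_le_truncation:
  fixes g :: "'a \<Rightarrow> ennreal"
  assumes [measurable]: "g \<in> borel_measurable borel" and t: "0 < t"
  shows "ball_avg c g t x \<le> ennreal V * \<mu> + ball_avg c (\<lambda>y. g y * indicator {y. \<mu> < g y} y) t x"
proof -
  have "ball_avg c g t x \<le> ball_avg c (\<lambda>y. \<mu> + g y * indicator {y. \<mu> < g y} y) t x"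
    by (rule ball_avg_mono) (auto split: split_indicator)
  also have "\<dots> = ball_avg c (\<lambda>y. \<mu>) t x + ball_avg c (\<lambda>y. g y * indicator {y. \<mu> < g y} y) t x"
    unfolding ball_avg_def
    by (simp add: distrib_right nn_integral_add distrib_left del: nn_integral_indicator)
  finally show ?thesis by (simp add: ball_avg_const t)
qed

text \<open>Values of g up to \<mu>/2 account for at most half of the threshold V * \<mu>, so the
  other half comes from the values above \<mu>/2.\<close>

lemma ball_avg_truncation_ge:
  fixes g :: "'a \<Rightarrow> ennreal"
  assumes [measurable]: "g \<in> borel_measurable borel" and t: "0 < t" and \<mu>: "0 < \<mu>"
    and less: "ennreal (V * \<mu>) < ball_avg c g t x"
  shows "ennreal (V * (\<mu> / 2)) \<le>
    ball_avg c (\<lambda>y. g y * indicator {y. ennreal (\<mu> / 2) < g y} y) t x" (is "_ \<le> ?B")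
proof (rule ccontr)
  assume "\<not> ?thesis"
  then have "?B < ennreal (V * (\<mu> / 2))" by simp
  moreover have "ball_avg c g t x \<le> ennreal (V * (\<mu> / 2)) + ?B"
    using ball_avg_le_truncation[OF _ t, of g x "ennreal (\<mu> / 2)"] \<mu> ball_volume_pos
    by (subst ennreal_mult) auto
  moreover have "ennreal (V * (\<mu> / 2)) + ennreal (V * (\<mu> / 2)) = ennreal (V * \<mu>)"
    using \<mu> ball_volume_pos by (simp flip: ennreal_plus)
  ultimately have "ball_avg c g t x \<le> ennreal (V * \<mu>)"
    by (metis add_left_mono less_imp_le order_trans)
  then show False using less by simp
qed

text \<open>The integral over a ball is at most the total truncated mass i, whereas the
  normalisation divides by t^d. Large scales therefore cannot reach the level.\<close>

lemma ball_avg_superlevel_scale: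
  fixes g :: "'a \<Rightarrow> ennreal"
  assumes [measurable]: "g \<in> borel_measurable borel" and t: "0 < t" and \<mu>: "0 < \<mu>"
    and less: "ennreal (V * \<mu>) < ball_avg c g t x"
    and I: "(\<integral>\<^sup>+y. g y * indicator {y. ennreal (\<mu> / 2) < g y} y \<partial>lborel) = ennreal i" "0 \<le> i"
  shows "t powr real DIM('a) \<le> 2 / (V * \<mu>) * i"
proof -
  have "ennreal (V * (\<mu> / 2)) \<le> ball_avg c (\<lambda>y. g y * indicator {y. ennreal (\<mu> / 2) < g y} y) t x"
    by (rule ball_avg_truncation_ge[OF _ t \<mu> less]) simp
  also have "\<dots> \<le> ennreal (t powr - real DIM('a)) * ennreal i"
    unfolding ball_avg_def I(1)[symmetric]
    by (intro mult_left_mono nn_integral_mono) (auto split: split_indicator)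
  finally have "V * (\<mu> / 2) \<le> t powr - real DIM('a) * i"
    using I t by (simp flip: ennreal_mult)
  then show ?thesis
    using t \<mu> ball_volume_pos by (simp add: powr_minus field_simps)
qed

text \<open>Chebyshev's inequality for the average of the truncation, whose integral is V * i at
  every scale. The set is taken at one fixed t, so no maximal function enters.\<close>

lemma emeasure_ball_avg_superlevel:
  fixes g :: "'a \<Rightarrow> ennreal"
  assumes [measurable]: "g \<in> borel_measurable borel" and t: "0 < t" and \<mu>: "0 < \<mu>"
    and I: "(\<integral>\<^sup>+y. g y * indicator {y. ennreal (\<mu> / 2) < g y} y \<partial>lborel) = ennreal i" "0 \<le> i"
  shows "emeasure lborel {x. ennreal (V * \<mu>) < ball_avg c g t x} \<le> ennreal (2 / \<mu> * i)"
proof -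
  let ?h = "\<lambda>y. g y * indicator {y. ennreal (\<mu> / 2) < g y} y"
  let ?E = "{x. ennreal (V * \<mu>) < ball_avg c g t x}"
  have "ennreal (V * (\<mu> / 2)) * emeasure lborel ?E
      = (\<integral>\<^sup>+x. ennreal (V * (\<mu> / 2)) * indicator ?E x \<partial>lborel)"
    by (rule nn_integral_cmult_indicator[symmetric]) measurable
  also have "\<dots> \<le> (\<integral>\<^sup>+x. ball_avg c ?h t x \<partial>lborel)"
    using ball_avg_truncation_ge[OF assms(1) t \<mu>]
    by (intro nn_integral_mono) (simp split: split_indicator)
  also have "\<dots> = ennreal (V * i)"
    using ball_volume_pos I by (subst nn_integral_ball_avg) (auto simp: t ennreal_mult)
  finally have "ennreal (2 / (V * \<mu>)) * (ennreal (V * (\<mu> / 2)) * emeasure lborel ?E)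
      \<le> ennreal (2 / (V * \<mu>)) * ennreal (V * i)" by (rule mult_left_mono) simp
  then show ?thesis
    using ball_volume_pos \<mu> I(2) by (simp add: mult.assoc[symmetric] ennreal_mult[symmetric])
qed

end

section \<open>Decomposition into dyadic levels and summation over them\<close>

lemma ex_dyadic_level:
  assumes "0 < m" "0 < V"
  obtains k :: int where "V * 2 powr k < m" "m \<le> V * (2 * 2 powr k)"
proof
  \<comment> \<open>Ceiling minus one, and not the floor: log 2 (m / V) then lies in (k, k + 1],
    which gives the strict lower and the weak upper bound.\<close>
  define k where "k = \<lceil>log 2 (m / V)\<rceil> - 1"
  have m: "m / V = 2 powr log 2 (m / V)" using assms by simp
  have "real_of_int k < log 2 (m / V)" "log 2 (m / V) \<le> real_of_int k + 1"
    unfolding k_def by linarith+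
  then have "2 powr real_of_int k < m / V" "m / V \<le> 2 powr (real_of_int k + 1)"
    by (subst m; simp)+
  then show "V * 2 powr k < m" "m \<le> V * (2 * 2 powr k)"
    using assms by (simp_all add: powr_add field_simps)
qed

text \<open>The admissible indices are bounded above, so this is a geometric series controlled by
  its largest term, which is comparable to z^s.\<close>

lemma nn_integral_dyadic_geometric:
  assumes s: "0 < s"
  shows "(\<integral>\<^sup>+k. ennreal ((2 powr real_of_int k) powr s) * indicator {k. ennreal (2 powr real_of_int k / 2) < z} k
      \<partial>count_space UNIV) \<le> ennreal (4 powr s / (1 - 2 powr - s)) * ennreal_pow z s"
    (is "(\<integral>\<^sup>+k. ?f k \<partial>_) \<le> _")
proof -
  have pos: "0 < 1 - 2 powr - s"
    using s powr_less_mono[of "-s" 0 2] by simp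
  consider "z = 0" | "z = top" | u where "z = ennreal u" "0 < u"
    by (cases z) force+
  then show ?thesis
  proof cases
    case 1
    then show ?thesis by simp
  next
    case 2
    then show ?thesis using pos by (auto simp: ennreal_mult_top)
  next
    case (3 u)
    \<comment> \<open>K is the least integer with 2 * u \<le> 2^K. All admissible k lie below it,
      and 2^K \<le> 4 * u is the origin of the factor 4^s.\<close>
    define K where "K = \<lceil>log 2 (2 * u)\<rceil>"
    have u: "2 * u = 2 powr log 2 (2 * u)" using 3 by simp
    have "log 2 (2 * u) \<le> K" "K \<le> log 2 (2 * u) + 1" unfolding K_def by linarith+
    then have K: "2 * u \<le> 2 powr K" "2 powr K \<le> 2 powr (log 2 (2 * u) + 1)"
      by (subst u; simp)+
    then have K4: "2 powr K \<le> 4 * u"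
      using u by (simp add: powr_add)
    have kK: "k \<le> K" if "ennreal (2 powr real_of_int k / 2) < z" for k
    proof -
      have "2 powr real_of_int k / 2 < u"
        using that 3 by (simp add: ennreal_less_iff)
      then have "2 powr real_of_int k < 2 powr real_of_int K" using K by linarith
      then show ?thesis by (simp only: powr_less_cancel_iff)
    qed
    have bij: "bij_betw (\<lambda>n. K - int n) UNIV {..K}"
      by (rule bij_betw_byWitness[where f' = "\<lambda>k. nat (K - k)"]) auto
    have "(\<integral>\<^sup>+k. ?f k \<partial>count_space UNIV) = (\<integral>\<^sup>+k. ?f k \<partial>count_space {..K})"
      by (rule nn_integral_count_space_eq) (use kK in \<open>auto split: split_indicator\<close>)
    also have "\<dots> = (\<integral>\<^sup>+n. ?f (K - int n) \<partial>count_space UNIV)"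
      by (rule nn_integral_bij_count_space[OF bij, symmetric])
    also have "\<dots> \<le> (\<integral>\<^sup>+n. ennreal ((2 powr K) powr s * (2 powr - s) ^ n) \<partial>count_space UNIV)"
    proof (rule nn_integral_mono)
      fix n :: nat
      have "(2 powr real_of_int (K - int n)) powr s = (2 powr K) powr s * (2 powr - s) ^ n"
        by (simp add: powr_powr powr_realpow[symmetric] algebra_simps flip: powr_add)
      then show "?f (K - int n) \<le> ennreal ((2 powr K) powr s * (2 powr - s) ^ n)"
        by (auto split: split_indicator)
    qed
    also have "\<dots> = (\<Sum>n. ennreal ((2 powr K) powr s * (2 powr - s) ^ n))"
      by (rule nn_integral_count_space_nat)
    also have "\<dots> = ennreal (\<Sum>n. (2 powr K) powr s * (2 powr - s) ^ n)"
      using pos by (intro suminf_ennreal2 summable_mult summable_geometric) auto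
    also have "(\<Sum>n. (2 powr K) powr s * (2 powr - s) ^ n) = (2 powr K) powr s / (1 - 2 powr - s)"
      using pos by (subst suminf_mult) (auto simp: suminf_geometric intro!: summable_geometric)
    also have "\<dots> \<le> (4 * u) powr s / (1 - 2 powr - s)"
      using pos s K4 by (intro divide_right_mono powr_mono2) auto
    also have "ennreal \<dots> = ennreal (4 powr s / (1 - 2 powr - s)) * ennreal_pow z s"
      using 3 pos by (simp add: ennreal_pow_ennreal powr_mult flip: ennreal_mult)
    finally show ?thesis by (simp add: ennreal_leI)
  qed
qed

text \<open>Above the level one has 1 \<le> (g/\<mu>)^(a-1), so g is dominated there by a multiple
  of g^a. The truncated masses are thus real numbers even if g is not integrable.\<close>

lemma truncation_finite:
  assumes [measurable]: "g \<in> borel_measurable M" and a: "1 < a" and \<mu>: "0 < \<mu>"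
    and fin: "(\<integral>\<^sup>+x. ennreal_pow (g x) a \<partial>M) < top"
  shows "(\<integral>\<^sup>+x. g x * indicator {x. ennreal \<mu> < g x} x \<partial>M) < top"
proof -
  have "g x * indicator {x. ennreal \<mu> < g x} x
      \<le> ennreal_pow (ennreal (1 / \<mu>)) (a - 1) * ennreal_pow (g x) a" for x
  proof (cases "ennreal \<mu> < g x")
    case True
    have "1 = ennreal_pow (ennreal (1 / \<mu>) * ennreal \<mu>) (a - 1)"
      using \<mu> by (simp flip: ennreal_mult)
    also have "\<dots> \<le> ennreal_pow (ennreal (1 / \<mu>) * g x) (a - 1)"
      using a True by (intro ennreal_pow_mono mult_left_mono) auto
    also have "\<dots> = ennreal_pow (ennreal (1 / \<mu>)) (a - 1) * ennreal_pow (g x) (a - 1)"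
      by (rule ennreal_pow_mult)
    finally have "g x * 1 \<le> g x * \<dots>" by (rule mult_left_mono) simp
    also have "\<dots> = ennreal_pow (ennreal (1 / \<mu>)) (a - 1) * (ennreal_pow (g x) 1 * ennreal_pow (g x) (a - 1))"
      by (simp add: mult_ac)
    also have "\<dots> = ennreal_pow (ennreal (1 / \<mu>)) (a - 1) * ennreal_pow (g x) a"
      by (simp only: ennreal_pow_add[symmetric]) simp
    finally show ?thesis using True by simp
  qed simp
  then have "(\<integral>\<^sup>+x. g x * indicator {x. ennreal \<mu> < g x} x \<partial>M)
      \<le> (\<integral>\<^sup>+x. ennreal_pow (ennreal (1 / \<mu>)) (a - 1) * ennreal_pow (g x) a \<partial>M)"
    by (intro nn_integral_mono)
  also have "\<dots> = ennreal_pow (ennreal (1 / \<mu>)) (a - 1) * (\<integral>\<^sup>+x. ennreal_pow (g x) a \<partial>M)"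
    by (rule nn_integral_cmult) measurable
  also have "\<dots> < top" using fin by (simp add: ennreal_mult_less_top)
  finally show ?thesis .
qed

lemma nn_integral_haar_powr_powr_le:
  assumes "0 < \<delta>" "0 < d" "0 \<le> e"
  shows "(\<integral>\<^sup>+t. ennreal (t powr \<delta>) * indicator {..e} (t powr d) \<partial>haar)
    \<le> ennreal (e powr (\<delta> / d) / \<delta>)"
proof -
  have "(\<integral>\<^sup>+t. ennreal (t powr \<delta>) * indicator {..e} (t powr d) \<partial>haar)
      \<le> (\<integral>\<^sup>+t. ennreal (t powr \<delta>) * indicator {..e powr (1 / d)} t \<partial>haar)"
  proof (rule nn_integral_haar_mono)
    fix t :: real assume t: "0 < t"
    have "t \<le> e powr (1 / d)" if "t powr d \<le> e"
    proof -
      have "t = (t powr d) powr (1 / d)" using t assms by (simp add: powr_powr)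
      also have "\<dots> \<le> e powr (1 / d)" using that assms by (intro powr_mono2) auto
      finally show ?thesis .
    qed
    then show "ennreal (t powr \<delta>) * indicator {..e} (t powr d)
      \<le> ennreal (t powr \<delta>) * indicator {..e powr (1 / d)} t"
      by (auto split: split_indicator)
  qed
  also have "\<dots> \<le> ennreal ((e powr (1 / d)) powr \<delta> / \<delta>)"
    using assms by (intro nn_integral_haar_powr_le) auto
  finally show ?thesis by (simp add: powr_powr)
qed

text \<open>This is \<open>\<parallel>h\<parallel>\<^sub>b\<^sup>a\<close> with \<open>b = a/\<theta>\<close>, where \<open>\<theta> = 0\<close> encodes the supremum norm.\<close>

abbreviation Lp_pow :: "real \<Rightarrow> real \<Rightarrow> ('a::euclidean_space \<Rightarrow> ennreal) \<Rightarrow> ennreal" where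
  "Lp_pow \<theta> a h \<equiv> (if \<theta> = 0 then ennreal_pow (SUP x. h x) a
    else ennreal_pow (\<integral>\<^sup>+x. ennreal_pow (h x) (a / \<theta>) \<partial>lborel) \<theta>)"

text \<open>
  The weighted quantity in the last line is \<open>(t\<^bsup>d(1/a - 1/b)\<^esup> \<parallel>ball_avg c g t\<parallel>\<^sub>b)\<^sup>a\<close>. The majorant \<open>H\<close>
  avoids asking for measurability in \<open>t\<close> of a supremum over \<open>x\<close>.
\<close>

proposition ball_avg_mixed_norm_le:
  fixes a \<theta> c :: real
  assumes a: "1 < a" and \<theta>: "0 \<le> \<theta>" "\<theta> < 1" and c: "0 < c"
  shows "\<exists>C. 0 < C \<and> C < top \<and> (\<forall>g \<in> borel_measurable (borel :: 'a::euclidean_space measure).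
    \<exists>H \<in> borel_measurable borel.
      (\<integral>\<^sup>+t. H t \<partial>haar) \<le> C * (\<integral>\<^sup>+x. ennreal_pow (g x) a \<partial>lborel) \<and>
      (\<forall>t>0. ennreal (t powr (real DIM('a) * (1 - \<theta>))) *
        Lp_pow \<theta> a (\<lambda>x. ball_avg c g t x) \<le> H t))"
proof -
  define D where "D = real DIM('a)"
  have D: "0 < D" by (simp add: D_def)
  define V where "V = unit_ball_vol (real DIM('a)) * c ^ DIM('a)"
  note V = ball_volume_pos[OF c V_def]
  define \<delta> where "\<delta> = D * (1 - \<theta>)"
  have \<delta>: "0 < \<delta>" using D \<theta> by (simp add: \<delta>_def)
  define \<Lambda> where "\<Lambda> = (\<lambda>k::int. 2 powr real_of_int k)"
  have \<Lambda>: "0 < \<Lambda> k" for k by (simp add: \<Lambda>_def)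
  \<comment> \<open>The factors come from the upper end 2 * V * \<Lambda> k of a level, the measure
    V * e k of its superlevel set, the integral of t^\<delta> against dt/t, and the definition of e
    k.\<close>
  define K where "K = (2 * V) powr a * V powr \<theta> / \<delta> * (2 / V)"
  have K: "0 < K" using V \<delta> by (simp add: K_def)
  define C\<^sub>a where "C\<^sub>a = 4 powr (a - 1) / (1 - 2 powr - (a - 1))"
  have "2 powr - (a - 1) < 2 powr (0::real)" using a by (intro powr_less_mono) auto
  then have C\<^sub>a: "0 < C\<^sub>a" by (simp add: C\<^sub>a_def)
  define C where "C = ennreal (K * C\<^sub>a)"
  have C: "0 < C" "C < top" using K C\<^sub>a by (simp_all add: C_def ennreal_zero_less_mult_iff)
  have "\<exists>H \<in> borel_measurable borel.
      (\<integral>\<^sup>+t. H t \<partial>haar) \<le> C * (\<integral>\<^sup>+x. ennreal_pow (g x) a \<partial>lborel) \<and>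
      (\<forall>t>0. ennreal (t powr \<delta>) *
        Lp_pow \<theta> a (\<lambda>x. ball_avg c g t x) \<le> H t)"
    if g[measurable]: "g \<in> borel_measurable (borel :: 'a measure)" for g
  proof (cases "(\<integral>\<^sup>+x. ennreal_pow (g x) a \<partial>lborel) = top")
    case True
    then have "C * (\<integral>\<^sup>+x. ennreal_pow (g x) a \<partial>lborel) = top"
      using C by (simp add: ennreal_mult_top)
    then show ?thesis by (intro bexI[of _ "\<lambda>_. top"]) auto
  next
    case False
    define I where "I = (\<lambda>k. \<integral>\<^sup>+y. g y * indicator {y. ennreal (\<Lambda> k / 2) < g y} y \<partial>lborel)"
    have "I k < top" for k
      unfolding I_def using False \<Lambda>[of k] by (intro truncation_finite[OF _ a]) (auto simp: less_top)
    then have "\<exists>i. I k = ennreal i \<and> 0 \<le> i" for k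
      by (metis ennreal_cases less_top)
    then obtain i where I: "I k = ennreal (i k)" and i: "0 \<le> i k" for k by metis
    note I' = I[unfolded I_def]
    \<comment> \<open>This one number bounds t^d for every scale at which level k is attained and,
      after multiplication by V, the measure of the superlevel set.\<close>
    define e where "e k = 2 / (V * \<Lambda> k) * i k" for k
    have e: "0 \<le> e k" for k using V \<Lambda>[of k] i[of k] by (simp add: e_def)
    note scale = ball_avg_superlevel_scale[OF c V_def g _ \<Lambda> _ I' i, folded e_def D_def]
    have vol: "emeasure lborel {x. ennreal (V * \<Lambda> k) < ball_avg c g t x} \<le> ennreal (V * e k)"
      if "0 < t" for k t
      using emeasure_ball_avg_superlevel[OF c V_def g that \<Lambda> I' i] V by (simp add: e_def)
    have dyadic: "\<exists>k. ennreal (V * \<Lambda> k) < ball_avg c g t x \<and> ball_avg c g t x \<le> ennreal (2 * V * \<Lambda> k)"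
      if t: "0 < t" and pos: "ball_avg c g t x \<noteq> 0" for t x
    proof -
      \<comment> \<open>Splitting at one fixed level shows that the average is finite, since the
        mass above that level is the real number i 0. A nonzero average then has a dyadic
        level.\<close>
      have "ball_avg c g t x \<le> ennreal V * ennreal (\<Lambda> 0 / 2)
          + ball_avg c (\<lambda>y. g y * indicator {y. ennreal (\<Lambda> 0 / 2) < g y} y) t x"
        by (rule ball_avg_le_truncation[OF c V_def g t])
      also have "\<dots> \<le> ennreal V * ennreal (\<Lambda> 0 / 2) + ennreal (t powr - real DIM('a)) * ennreal (i 0)"
        unfolding ball_avg_def I'[symmetric]
        by (intro add_left_mono mult_left_mono nn_integral_mono) (auto split: split_indicator)
      also have "\<dots> < top" by (simp add: ennreal_mult_less_top)
      finally obtain m where m: "ball_avg c g t x = ennreal m" "0 < m"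
        using pos by (cases "ball_avg c g t x") (auto simp: less_le)
      obtain k :: int where "V * 2 powr k < m" "m \<le> V * (2 * 2 powr k)"
        using ex_dyadic_level[OF m(2) V] .
      then show ?thesis
        using m V by (intro exI[of _ k]) (auto simp: \<Lambda>_def ennreal_less_iff mult_ac ennreal_leI)
    qed
    \<comment> \<open>Contribution of level k: values at most 2 * V * \<Lambda> k on a set of
      measure at most V * e k, present only while t^D \<le> e k. The exponents are those of the a-th
      power of a norm with exponent a/\<theta>.\<close>
    define h where "h k t = ennreal ((2 * V * \<Lambda> k) powr a * (V * e k) powr \<theta>) *
      (ennreal (t powr \<delta>) * indicator {..e k} (t powr D))" for k t
    have h_meas[measurable]: "h k \<in> borel_measurable borel" for k
      unfolding h_def by measurable
    define H where "H t = (\<integral>\<^sup>+k. h k t \<partial>count_space UNIV)" for t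
    have [measurable]: "H \<in> borel_measurable borel"
    proof -
      have "H = (\<lambda>t. \<Sum>n. h (int_decode n) t)"
        unfolding H_def
        by (simp add: nn_integral_bij_count_space[OF bij_int_decode, symmetric] nn_integral_count_space_nat)
      then show ?thesis by simp
    qed
    have "(\<integral>\<^sup>+t. H t \<partial>haar) = (\<integral>\<^sup>+k. \<integral>\<^sup>+t. h k t \<partial>haar \<partial>count_space UNIV)"
      unfolding H_def by (rule nn_integral_count_space_nn_integral) auto
    also have "\<dots> \<le> (\<integral>\<^sup>+k. ennreal K * (ennreal (\<Lambda> k powr (a - 1)) * I k) \<partial>count_space UNIV)"
    proof (rule nn_integral_mono)
      fix k
      have "(\<integral>\<^sup>+t. h k t \<partial>haar) = ennreal ((2 * V * \<Lambda> k) powr a * (V * e k) powr \<theta>) *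
          (\<integral>\<^sup>+t. ennreal (t powr \<delta>) * indicator {..e k} (t powr D) \<partial>haar)"
        unfolding h_def by (rule nn_integral_cmult) measurable
      also have "\<dots> \<le> ennreal ((2 * V * \<Lambda> k) powr a * (V * e k) powr \<theta>) * ennreal (e k powr (\<delta> / D) / \<delta>)"
        by (intro mult_left_mono nn_integral_haar_powr_powr_le \<delta> D e) simp
      also have "\<dots> = ennreal ((2 * V * \<Lambda> k) powr a * (V * e k) powr \<theta> * (e k powr (\<delta> / D) / \<delta>))"
        by (rule ennreal_mult[symmetric]) (use \<delta> in auto)
      also have "(2 * V * \<Lambda> k) powr a * (V * e k) powr \<theta> * (e k powr (\<delta> / D) / \<delta>)
          = (2 * V) powr a * V powr \<theta> / \<delta> * (\<Lambda> k powr a * (e k powr \<theta> * e k powr (1 - \<theta>)))"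
        using D V e[of k] \<Lambda>[of k] by (simp add: \<delta>_def powr_mult)
      \<comment> \<open>The balance of exponents: the power \<theta> is due to the measure of the
        set and 1 - \<theta> = \<delta> / D to the range of scales. The result is linear in e k and
        hence in the truncated mass I k.\<close>
      also have "e k powr \<theta> * e k powr (1 - \<theta>) = e k"
        using e[of k] by (simp flip: powr_add)
      also have "\<Lambda> k powr a * e k = 2 / V * (\<Lambda> k powr (a - 1) * i k)"
        using \<Lambda>[of k] V by (simp add: e_def powr_diff)
      also have "(2 * V) powr a * V powr \<theta> / \<delta> * \<dots> = K * (\<Lambda> k powr (a - 1) * i k)"
        by (simp add: K_def)
      also have "ennreal \<dots> = ennreal K * (ennreal (\<Lambda> k powr (a - 1)) * I k)"
        using K i[of k] by (simp add: I ennreal_mult)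
      finally show "(\<integral>\<^sup>+t. h k t \<partial>haar) \<le> \<dots>" .
    qed
    also have "\<dots> = ennreal K * (\<integral>\<^sup>+k. ennreal (\<Lambda> k powr (a - 1)) * I k \<partial>count_space UNIV)"
      by (rule nn_integral_cmult) simp
    also have "(\<integral>\<^sup>+k. ennreal (\<Lambda> k powr (a - 1)) * I k \<partial>count_space UNIV)
        = (\<integral>\<^sup>+k. \<integral>\<^sup>+y. ennreal (\<Lambda> k powr (a - 1)) * (g y * indicator {y. ennreal (\<Lambda> k / 2) < g y} y) \<partial>lborel \<partial>count_space UNIV)"
      unfolding I_def by (intro nn_integral_cong nn_integral_cmult[symmetric]) measurable
    also have "\<dots> = (\<integral>\<^sup>+y. \<integral>\<^sup>+k. ennreal (\<Lambda> k powr (a - 1)) * (g y * indicator {y. ennreal (\<Lambda> k / 2) < g y} y) \<partial>count_space UNIV \<partial>lborel)"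
      by (rule nn_integral_count_space_nn_integral[symmetric]) auto
    also have "\<dots> = (\<integral>\<^sup>+y. g y * (\<integral>\<^sup>+k. ennreal (\<Lambda> k powr (a - 1)) * indicator {k. ennreal (\<Lambda> k / 2) < g y} k \<partial>count_space UNIV) \<partial>lborel)"
      by (subst nn_integral_cmult[symmetric])
        (auto intro!: nn_integral_cong simp: mult_ac split: split_indicator)
    \<comment> \<open>Layer-cake formula: at fixed y the levels below 2 * g y contribute a geometric
      sum with positive exponent a - 1, comparable to (g y)^(a-1).\<close>
    also have "\<dots> \<le> (\<integral>\<^sup>+y. g y * (ennreal C\<^sub>a * ennreal_pow (g y) (a - 1)) \<partial>lborel)"
      unfolding \<Lambda>_def C\<^sub>a_def
      using a by (intro nn_integral_mono mult_left_mono nn_integral_dyadic_geometric) auto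
    also have "\<dots> = (\<integral>\<^sup>+y. ennreal C\<^sub>a * ennreal_pow (g y) a \<partial>lborel)"
    proof (rule nn_integral_cong)
      fix y
      have "ennreal_pow (g y) a = ennreal_pow (g y) 1 * ennreal_pow (g y) (a - 1)"
        by (simp only: ennreal_pow_add[symmetric]) simp
      then show "g y * (ennreal C\<^sub>a * ennreal_pow (g y) (a - 1)) = ennreal C\<^sub>a * ennreal_pow (g y) a"
        by (simp add: mult_ac)
    qed
    also have "\<dots> = ennreal C\<^sub>a * (\<integral>\<^sup>+y. ennreal_pow (g y) a \<partial>lborel)"
      by (rule nn_integral_cmult) measurable
    also have "ennreal K * \<dots> = C * (\<integral>\<^sup>+y. ennreal_pow (g y) a \<partial>lborel)"
      using K C\<^sub>a by (simp add: C_def ennreal_mult mult_ac)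
    finally have H_le: "(\<integral>\<^sup>+t. H t \<partial>haar) \<le> C * (\<integral>\<^sup>+y. ennreal_pow (g y) a \<partial>lborel)"
      by (simp add: mult_left_mono)
    have "ennreal (t powr \<delta>) * Lp_pow \<theta> a (\<lambda>x. ball_avg c g t x) \<le> H t"
      if t: "0 < t" for t
    proof -
      define w where "w k = ennreal ((2 * V * \<Lambda> k) powr a * (V * e k) powr \<theta>) * indicator {..e k} (t powr D)" for k
      have Hw: "H t = ennreal (t powr \<delta>) * (\<integral>\<^sup>+k. w k \<partial>count_space UNIV)"
        unfolding H_def h_def w_def
        by (subst nn_integral_cmult[symmetric]) (auto simp: mult_ac)
      have "Lp_pow \<theta> a (\<lambda>x. ball_avg c g t x)
         \<le> (\<integral>\<^sup>+k. w k \<partial>count_space UNIV)"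
      proof (cases "\<theta> = 0")
        case True
        have "ennreal_pow (ball_avg c g t x) a \<le> (\<integral>\<^sup>+k. w k \<partial>count_space UNIV)" for x
        proof (cases "ball_avg c g t x = 0")
          case False
          obtain k where k: "ennreal (V * \<Lambda> k) < ball_avg c g t x"
            "ball_avg c g t x \<le> ennreal (2 * V * \<Lambda> k)"
            using dyadic[OF t False] by blast
          have tk: "t powr D \<le> e k" using scale[OF t k(1)] .
          \<comment> \<open>Since \<open>0 powr 0 = 0\<close>, the factor
            \<open>(V * e k) powr \<theta>\<close> equals 1 for \<theta> = 0 only because V * e k is
            positive.\<close>
          have "0 < t powr D" using t by simp
          then have "0 < V * e k" using tk by (intro mult_pos_pos V) linarith
          have "ennreal_pow (ball_avg c g t x) a \<le> ennreal_pow (ennreal (2 * V * \<Lambda> k)) a"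
            using a by (intro ennreal_pow_mono k) auto
          also have "\<dots> = w k"
            using True \<open>0 < V * e k\<close> tk V \<Lambda>[of k] by (auto simp: w_def ennreal_pow_ennreal)
          also have "\<dots> \<le> (\<integral>\<^sup>+k. w k \<partial>count_space UNIV)"
            by (rule nn_integral_ge_point) simp
          finally show ?thesis .
        qed simp
        then show ?thesis
          using True a by (auto intro!: ennreal_pow_SUP_le)
      next
        case False
        then have \<theta>': "0 < \<theta>" using \<theta> by simp
        let ?E = "\<lambda>k. {x. ennreal (V * \<Lambda> k) < ball_avg c g t x}"
        define b where "b = a / \<theta>"
        have b: "0 < b" "b * \<theta> = a" using a \<theta>' by (auto simp: b_def)
        have "ennreal_pow (ball_avg c g t x) b
          \<le> (\<integral>\<^sup>+k. ennreal ((2 * V * \<Lambda> k) powr b) * indicator (?E k) x \<partial>count_space UNIV)" for x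
        proof (cases "ball_avg c g t x = 0")
          case False
          obtain k where k: "ennreal (V * \<Lambda> k) < ball_avg c g t x"
            "ball_avg c g t x \<le> ennreal (2 * V * \<Lambda> k)"
            using dyadic[OF t False] by blast
          have "ennreal_pow (ball_avg c g t x) b \<le> ennreal_pow (ennreal (2 * V * \<Lambda> k)) b"
            using b by (intro ennreal_pow_mono k) auto
          also have "\<dots> = ennreal ((2 * V * \<Lambda> k) powr b) * indicator (?E k) x"
            using k V \<Lambda>[of k] by (simp add: ennreal_pow_ennreal)
          also have "\<dots> \<le> (\<integral>\<^sup>+k. ennreal ((2 * V * \<Lambda> k) powr b) * indicator (?E k) x \<partial>count_space UNIV)"
            by (rule nn_integral_ge_point) simp
          finally show ?thesis .
        qed simp
        then have "(\<integral>\<^sup>+x. ennreal_pow (ball_avg c g t x) b \<partial>lborel)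
          \<le> (\<integral>\<^sup>+x. \<integral>\<^sup>+k. ennreal ((2 * V * \<Lambda> k) powr b) * indicator (?E k) x \<partial>count_space UNIV \<partial>lborel)"
          by (intro nn_integral_mono)
        also have "\<dots> = (\<integral>\<^sup>+k. \<integral>\<^sup>+x. ennreal ((2 * V * \<Lambda> k) powr b) * indicator (?E k) x \<partial>lborel \<partial>count_space UNIV)"
          by (rule nn_integral_count_space_nn_integral) auto
        also have "\<dots> = (\<integral>\<^sup>+k. ennreal ((2 * V * \<Lambda> k) powr b) * emeasure lborel (?E k) \<partial>count_space UNIV)"
          by (intro nn_integral_cong nn_integral_cmult_indicator) measurable
        also have "\<dots> \<le> (\<integral>\<^sup>+k. ennreal ((2 * V * \<Lambda> k) powr b) * (ennreal (V * e k) * indicator {..e k} (t powr D)) \<partial>count_space UNIV)"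
        proof (intro nn_integral_mono mult_left_mono)
          fix k
          show "emeasure lborel (?E k) \<le> ennreal (V * e k) * indicator {..e k} (t powr D)"
          \<comment> \<open>The indicator may be inserted because a single point of the superlevel
            set at scale t already forces t^D \<le> e k.\<close>
          proof (cases "?E k = {}")
            case False
            then obtain x where "ennreal (V * \<Lambda> k) < ball_avg c g t x" by auto
            from scale[OF t this] show ?thesis using vol[OF t, of k] by simp
          qed (simp only: emeasure_empty zero_le)
        qed simp
        finally have "ennreal_pow (\<integral>\<^sup>+x. ennreal_pow (ball_avg c g t x) b \<partial>lborel) \<theta>
          \<le> ennreal_pow (\<integral>\<^sup>+k. ennreal ((2 * V * \<Lambda> k) powr b) * (ennreal (V * e k) * indicator {..e k} (t powr D)) \<partial>count_space UNIV) \<theta>"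
          using \<theta>' by (intro ennreal_pow_mono) auto
        also have "\<dots> \<le> (\<integral>\<^sup>+k. ennreal_pow (ennreal ((2 * V * \<Lambda> k) powr b) * (ennreal (V * e k) * indicator {..e k} (t powr D))) \<theta> \<partial>count_space UNIV)"
          using \<theta>' \<theta> by (intro ennreal_pow_nn_integral_count_space_le) auto
        also have "\<dots> = (\<integral>\<^sup>+k. w k \<partial>count_space UNIV)"
          using V e b powr_mult[of V]
          by (intro nn_integral_cong)
            (auto simp: w_def ennreal_pow_mult ennreal_pow_ennreal powr_powr ennreal_mult split: split_indicator)
        finally show ?thesis using False by (simp add: b_def)
      qed
      then show ?thesis unfolding Hw by (intro mult_left_mono) auto
    qed
    then show ?thesis using H_le by (intro bexI[of _ H]) auto
  qed
  then show ?thesis using C unfolding \<delta>_def D_def by (intro exI[of _ C]) auto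
qed

section \<open>Local domination and vertical norms\<close>

lemma esssup_le_iff:
  fixes f :: "'b \<Rightarrow> ennreal"
  assumes "f \<in> borel_measurable M"
  shows "esssup M f \<le> c \<longleftrightarrow> (AE x in M. f x \<le> c)"
  using esssup_AE[of f M] esssup_I[OF assms, of c] by (auto elim: eventually_mono)

text \<open>The essential supremum is at most c exactly when the section of the set where h exceeds
  c is null, and the measure of a section is a measurable function by Tonelli's theorem.\<close>

lemma (in sigma_finite_measure) measurable_esssup [measurable (raw)]:
  fixes h :: "'b \<Rightarrow> 'a \<Rightarrow> ennreal"
  assumes [measurable]: "case_prod h \<in> borel_measurable (N \<Otimes>\<^sub>M M)"
  shows "(\<lambda>x. esssup M (h x)) \<in> borel_measurable N"
proof (rule borel_measurableI_le)
  fix c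
  have [measurable]: "(\<lambda>p. indicator {p. c < h (fst p) (snd p)} p :: ennreal) \<in> borel_measurable (N \<Otimes>\<^sub>M M)"
  proof -
    have "(\<lambda>p. if c < case_prod h p then 1 else 0 :: ennreal) \<in> borel_measurable (N \<Otimes>\<^sub>M M)"
      by measurable
    then show ?thesis by (simp add: indicator_def case_prod_beta')
  qed
  have "esssup M (h x) \<le> c \<longleftrightarrow> (\<integral>\<^sup>+y. indicator {p. c < h (fst p) (snd p)} (x, y) \<partial>M) = 0"
    if x: "x \<in> space N" for x
  proof -
    have [measurable]: "h x \<in> borel_measurable M"
      using measurable_compose[OF measurable_Pair1'[OF x] assms] by simp
    have "(\<integral>\<^sup>+y. indicator {p. c < h (fst p) (snd p)} (x, y) \<partial>M) = 0 \<longleftrightarrow>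
        (AE y in M. indicator {p. c < h (fst p) (snd p)} (x, y) = (0::ennreal))"
      by (rule nn_integral_0_iff_AE) (use x in measurable)
    also have "\<dots> \<longleftrightarrow> (AE y in M. h x y \<le> c)"
      by (intro AE_cong) (auto split: split_indicator simp: not_less)
    also have "\<dots> \<longleftrightarrow> esssup M (h x) \<le> c" by (rule esssup_le_iff[symmetric]) simp
    finally show ?thesis by simp
  qed
  then have "{x \<in> space N. esssup M (h x) \<le> c}
      = {x \<in> space N. (\<integral>\<^sup>+y. indicator {p. c < h (fst p) (snd p)} (x, y) \<partial>M) = 0}" by auto
  also have "\<dots> \<in> sets N" by measurable
  finally show "{x \<in> space N. esssup M (h x) \<le> c} \<in> sets N" .
qed

lemma (in sigma_finite_measure) measurable_Lp_norm [measurable (raw)]: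
  fixes h :: "'b \<Rightarrow> 'a \<Rightarrow> ennreal"
  assumes [measurable]: "case_prod h \<in> borel_measurable (N \<Otimes>\<^sub>M M)"
  shows "(\<lambda>x. Lp_norm M p (h x)) \<in> borel_measurable N"
  unfolding Lp_norm_def by measurable

text \<open>The exact value is the natural logarithm of 4. Bounding the density by 2/t on an
  interval of length 3t/2 gives 3 without logarithms.\<close>

lemma emeasure_haar_le: "0 < t \<Longrightarrow> emeasure haar {t / 2<..<2 * t} \<le> 3"
proof -
  assume t: "0 < t"
  have "emeasure haar {t / 2<..<2 * t} = (\<integral>\<^sup>+s. indicator {t / 2<..<2 * t} s \<partial>haar)" by simp
  also have "\<dots> = (\<integral>\<^sup>+s. ennreal (if 0 < s then 1 / s else 0) * indicator {t / 2<..<2 * t} s \<partial>lborel)"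
    by (rule nn_integral_haar) measurable
  also have "\<dots> \<le> (\<integral>\<^sup>+s. ennreal (2 / t) * indicator {t / 2<..<2 * t} s \<partial>lborel)"
    using t by (intro nn_integral_mono) (auto split: split_indicator simp: field_simps)
  also have "\<dots> = ennreal (2 / t) * ennreal (2 * t - t / 2)"
    using t by (subst nn_integral_cmult_indicator) auto
  also have "\<dots> = ennreal (2 / t * (2 * t - t / 2))" using t by (intro ennreal_mult[symmetric]) auto
  also have "2 / t * (2 * t - t / 2) = 3" using t by (simp add: field_simps)
  finally show ?thesis by simp
qed

text \<open>The interval has length t/4 and ends at 5t/4 at the latest, so the density is at least
  4/(5t) on it.\<close>

lemma emeasure_haar_ge:
  assumes t: "0 < t" and a: "0 < a" "a \<le> t"
  shows "ennreal (1 / 5) \<le> emeasure haar {a..a + t / 4}"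
proof -
  have "ennreal (1 / 5) = ennreal (4 / (5 * t) * (t / 4))" using t by simp
  also have "\<dots> = ennreal (4 / (5 * t)) * ennreal (t / 4)" using t by (intro ennreal_mult) auto
  also have "\<dots> = (\<integral>\<^sup>+s. ennreal (4 / (5 * t)) * indicator {a..a + t / 4} s \<partial>lborel)"
    using t by (subst nn_integral_cmult_indicator) auto
  also have "\<dots> \<le> (\<integral>\<^sup>+s. ennreal (if 0 < s then 1 / s else 0) * indicator {a..a + t / 4} s \<partial>lborel)"
    using t a by (intro nn_integral_mono) (auto split: split_indicator simp: field_simps)
  also have "\<dots> = (\<integral>\<^sup>+s. indicator {a..a + t / 4} s \<partial>haar)"
    by (rule nn_integral_haar[symmetric]) measurable
  finally show ?thesis by simp
qed

text \<open>The only property of Whitney averages, apart from measurability, on which the norm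
  estimates below rely. The region is existentially quantified because the dominant part of a box
  depends on the function. The two starting times are the upper ends of the two halves of the
  interval (t/2, t], and z stands for the centre of a small ball in the box.\<close>

definition locally_dominated :: "ennreal \<Rightarrow> (real \<times> 'a::euclidean_space \<Rightarrow> ennreal) \<Rightarrow> bool" where
  "locally_dominated C w \<longleftrightarrow> (\<forall>t>0. \<forall>x. \<exists>a\<in>{3 * t / 4, t}. \<exists>z\<in>cball x t.
    \<forall>s\<in>{a..a + t / 4}. \<forall>y\<in>ball z (t / 4). w (t, x) \<le> C * w (s, y))"

text \<open>The dominating region lies inside (t/2, 2t) times the ball of radius 2t about x, and its
  measure for ds/s times t^-d dy is at least V/5, where V is the volume of a ball of radius 1/4.
  Hence the pointwise bound can be averaged, for any positive power.\<close>

lemma locally_dominated_average: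
  fixes C :: ennreal
  assumes "0 < \<eta>" "C < top"
  shows "\<exists>K<top. \<forall>w \<in> borel_measurable borel. locally_dominated C w \<longrightarrow>
    (\<forall>t>0. \<forall>x::'a::euclidean_space. ennreal_pow (w (t, x)) \<eta>
      \<le> K * (\<integral>\<^sup>+s\<in>{t / 2<..<2 * t}. ball_avg 2 (\<lambda>y. ennreal_pow (w (s, y)) \<eta>) t x \<partial>haar))"
proof -
  define V where "V = unit_ball_vol (real DIM('a)) * (1 / 4) ^ DIM('a)"
  have V: "0 < V" by (simp add: V_def)
  define K where "K = ennreal (5 / V) * ennreal_pow C \<eta>"
  have K: "K < top" using assms by (simp add: K_def ennreal_mult_less_top)
  have "ennreal_pow (w (t, x)) \<eta>
      \<le> K * (\<integral>\<^sup>+s\<in>{t / 2<..<2 * t}. ball_avg 2 (\<lambda>y. ennreal_pow (w (s, y)) \<eta>) t x \<partial>haar)"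
    if [measurable]: "w \<in> borel_measurable borel" and dom: "locally_dominated C w" and t: "0 < t"
    for w t and x :: 'a
  proof -
    obtain a z where a: "a \<in> {3 * t / 4, t}" and z': "z \<in> cball x t"
      and le': "\<forall>s\<in>{a..a + t / 4}. \<forall>y\<in>ball z (t / 4). w (t, x) \<le> C * w (s, y)"
      using dom[unfolded locally_dominated_def, rule_format, OF t, of x] by blast
    have z: "dist x z \<le> t" using z' by simp
    note le = le'[rule_format]
    define m where "m = ennreal_pow (w (t, x)) \<eta>"
    have at: "0 < a" "a \<le> t" "t / 2 < a" using a t by auto
    have "ball z (t / 4) \<subseteq> ball x (2 * t)"
    proof
      fix y assume "y \<in> ball z (t / 4)"
      then show "y \<in> ball x (2 * t)" using z t dist_triangle[of x y z] by simp
    qed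
    then have sub: "y \<in> ball z (t / 4) \<Longrightarrow> y \<in> ball x (2 * t)" for y by auto
    have inner: "ennreal V * m \<le> ennreal_pow C \<eta> * ball_avg 2 (\<lambda>y. ennreal_pow (w (s, y)) \<eta>) t x"
      if s: "s \<in> {a..a + t / 4}" for s
    proof -
      have "ennreal V * m = ball_avg (1 / 4) (\<lambda>y. m) t z"
        using t by (intro ball_avg_const[symmetric] V_def) auto
      also have "\<dots> \<le> ball_avg 2 (\<lambda>y. ennreal_pow C \<eta> * ennreal_pow (w (s, y)) \<eta>) t x"
        unfolding ball_avg_def
      proof (intro mult_left_mono nn_integral_mono)
        fix y
        show "m * indicator (ball z (1 / 4 * t)) y
          \<le> ennreal_pow C \<eta> * ennreal_pow (w (s, y)) \<eta> * indicator (ball x (2 * t)) y"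
        proof (cases "y \<in> ball z (t / 4)")
          case True
          then have "m \<le> ennreal_pow (C * w (s, y)) \<eta>"
            unfolding m_def using assms by (intro ennreal_pow_mono le s) auto
          then show ?thesis using True sub[OF True] by (simp add: ennreal_pow_mult)
        qed simp
      qed simp
      finally show ?thesis by (subst (asm) ball_avg_cmult) simp_all
    qed
    have "ennreal (V / 5) * m = ennreal V * m * ennreal (1 / 5)"
    proof -
      have "ennreal (V / 5) = ennreal V * ennreal (1 / 5)"
        using V ennreal_mult[of V "1 / 5"] by simp
      then show ?thesis by (simp only: mult_ac)
    qed
    also have "\<dots> \<le> ennreal V * m * emeasure haar {a..a + t / 4}"
      by (intro mult_left_mono emeasure_haar_ge t at) simp
    also have "\<dots> = (\<integral>\<^sup>+s. (ennreal V * m) * indicator {a..a + t / 4} s \<partial>haar)"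
      by (simp add: nn_integral_cmult_indicator)
    also have "\<dots> \<le> (\<integral>\<^sup>+s. ennreal_pow C \<eta> *
        (ball_avg 2 (\<lambda>y. ennreal_pow (w (s, y)) \<eta>) t x * indicator {t / 2<..<2 * t} s) \<partial>haar)"
      using inner at t by (intro nn_integral_mono) (auto split: split_indicator)
    also have "\<dots> = ennreal_pow C \<eta> *
        (\<integral>\<^sup>+s\<in>{t / 2<..<2 * t}. ball_avg 2 (\<lambda>y. ennreal_pow (w (s, y)) \<eta>) t x \<partial>haar)"
      unfolding ball_avg_def by (intro nn_integral_cmult) measurable
    finally have "ennreal (5 / V) * (ennreal (V / 5) * m) \<le> ennreal (5 / V) * \<dots>"
      by (rule mult_left_mono) simp
    then show ?thesis
      using V by (simp add: K_def mult.assoc[symmetric] ennreal_mult[symmetric] m_def)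
  qed
  then show ?thesis using K by blast
qed

lemma ex_small_exponent:
  fixes q :: ennreal
  assumes "0 < p" "0 < q"
  obtains \<eta> where "0 < \<eta>" "\<eta> < p" "ennreal \<eta> < q"
proof (cases q)
  case (real r)
  then show thesis using assms that[of "min p r / 2"]
    by (auto simp: ennreal_less_iff min_def)
qed (use assms that[of "p / 2"] in auto)

text \<open>Power mean inequality on a set of bounded measure. Because B is at least 1, the factor
  (measure of E)^(1 - \<eta>/r) can be replaced by B itself, so the constant is independent of
  q.\<close>

lemma nn_integral_pow_le_Lp_norm:
  assumes [measurable]: "f \<in> borel_measurable M" "E \<in> sets M"
    and \<eta>: "0 < \<eta>" "ennreal \<eta> < q" and E: "emeasure M E \<le> B" "1 \<le> B"
  shows "(\<integral>\<^sup>+x\<in>E. ennreal_pow (f x) \<eta> \<partial>M) \<le> B * ennreal_pow (Lp_norm M q f) \<eta>"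
proof (cases q)
  case (real r)
  then have r: "\<eta> < r" "q \<noteq> top" "enn2real q = r" "0 < r" using \<eta> by (auto simp: ennreal_less_iff)
  have "(\<integral>\<^sup>+x\<in>E. ennreal_pow (f x) \<eta> \<partial>M)
      \<le> ennreal_pow (\<integral>\<^sup>+x\<in>E. ennreal_pow (f x) r \<partial>M) (\<eta> / r) * ennreal_pow (emeasure M E) (1 - \<eta> / r)"
    by (rule power_mean_nn_integral) (use \<eta> r in auto)
  also have "\<dots> \<le> ennreal_pow (\<integral>\<^sup>+x. ennreal_pow (f x) r \<partial>M) (\<eta> / r) * B"
  proof (intro mult_mono)
    show "ennreal_pow (\<integral>\<^sup>+x\<in>E. ennreal_pow (f x) r \<partial>M) (\<eta> / r)
        \<le> ennreal_pow (\<integral>\<^sup>+x. ennreal_pow (f x) r \<partial>M) (\<eta> / r)"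
      using \<eta> r by (intro ennreal_pow_mono nn_integral_mono) (auto split: split_indicator)
    have "ennreal_pow (emeasure M E) (1 - \<eta> / r) \<le> ennreal_pow B (1 - \<eta> / r)"
      using \<eta> r E by (intro ennreal_pow_mono) auto
    also have "\<dots> = ennreal_pow B (1 - \<eta> / r) * ennreal_pow 1 (\<eta> / r)" by simp
    also have "\<dots> \<le> ennreal_pow B (1 - \<eta> / r) * ennreal_pow B (\<eta> / r)"
      using \<eta> r E by (intro mult_left_mono ennreal_pow_mono) auto
    also have "\<dots> = ennreal_pow B (1 - \<eta> / r + \<eta> / r)" by (rule ennreal_pow_add[symmetric])
    finally show "ennreal_pow (emeasure M E) (1 - \<eta> / r) \<le> B" by simp
  qed auto
  also have "ennreal_pow (\<integral>\<^sup>+x. ennreal_pow (f x) r \<partial>M) (\<eta> / r) = ennreal_pow (Lp_norm M q f) \<eta>"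
    using r by (simp add: Lp_norm_def ennreal_pow_pow)
  finally show ?thesis by (simp add: mult.commute)
next
  case top
  have "AE x in M. ennreal_pow (f x) \<eta> * indicator E x \<le> ennreal_pow (Lp_norm M q f) \<eta> * indicator E x"
    using esssup_AE[of f M]
  proof eventually_elim
    case (elim x)
    then show ?case using \<eta> top
      by (auto simp: Lp_norm_def intro!: mult_right_mono ennreal_pow_mono)
  qed
  then have "(\<integral>\<^sup>+x\<in>E. ennreal_pow (f x) \<eta> \<partial>M) \<le> (\<integral>\<^sup>+x. ennreal_pow (Lp_norm M q f) \<eta> * indicator E x \<partial>M)"
    by (rule nn_integral_mono_AE)
  also have "\<dots> = ennreal_pow (Lp_norm M q f) \<eta> * emeasure M E" by (simp add: nn_integral_cmult_indicator)
  also have "\<dots> \<le> ennreal_pow (Lp_norm M q f) \<eta> * B" using E by (intro mult_left_mono) auto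
  finally show ?thesis by (simp add: mult.commute)
qed

text \<open>With g the \<eta>-th power of the inner norm, \<eta> < q bounds the integral of w^\<eta>
  over (t/2, 2t) by 3 * g, and Tonelli's theorem places the ball average outside. The condition
  \<eta> < p makes a = p/\<eta> larger than 1, as the estimate for ball averages requires, while g^a
  is again the p-th power of the inner norm.\<close>

proposition mixed_norm_le_vertical_norm:
  fixes p \<theta> :: real and q C :: ennreal
  assumes p: "0 < p" and \<theta>: "0 \<le> \<theta>" "\<theta> < 1" and q: "0 < q" and C: "C < top"
  shows "\<exists>K<top. \<forall>w \<in> borel_measurable (borel :: (real \<times> 'a::euclidean_space) measure).
    locally_dominated C w \<longrightarrow>
    (\<exists>H \<in> borel_measurable borel.
      (\<integral>\<^sup>+t. H t \<partial>haar) \<le> K * (\<integral>\<^sup>+x. ennreal_pow (Lp_norm haar q (\<lambda>t. w (t, x))) p \<partial>lborel) \<and>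
      (\<forall>t>0. ennreal (t powr (real DIM('a) * (1 - \<theta>))) *
        Lp_pow \<theta> p (\<lambda>x. w (t, x)) \<le> H t))"
proof -
  obtain \<eta> where \<eta>: "0 < \<eta>" "\<eta> < p" "ennreal \<eta> < q"
    using ex_small_exponent[OF p q] .
  define a where "a = p / \<eta>"
  have a: "1 < a" "\<eta> * a = p" using \<eta> by (auto simp: a_def)
  obtain C1 where C1: "C1 < top"
    and avg: "\<And>w t x. w \<in> borel_measurable borel \<Longrightarrow> locally_dominated C w \<Longrightarrow> 0 < t \<Longrightarrow>
      ennreal_pow (w (t, x::'a)) \<eta>
      \<le> C1 * (\<integral>\<^sup>+s\<in>{t / 2<..<2 * t}. ball_avg 2 (\<lambda>y. ennreal_pow (w (s, y)) \<eta>) t x \<partial>haar)"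
    using locally_dominated_average[OF \<eta>(1) C] by blast
  obtain C2 where C2: "C2 < top"
    and embed: "\<And>g. g \<in> borel_measurable (borel :: 'a measure) \<Longrightarrow> \<exists>H \<in> borel_measurable borel.
      (\<integral>\<^sup>+t. H t \<partial>haar) \<le> C2 * (\<integral>\<^sup>+x. ennreal_pow (g x) a \<partial>lborel) \<and>
      (\<forall>t>0. ennreal (t powr (real DIM('a) * (1 - \<theta>))) *
        Lp_pow \<theta> a (\<lambda>x. ball_avg 2 g t x) \<le> H t)"
    using ball_avg_mixed_norm_le[OF a(1) \<theta>, of 2, where 'a = 'a] by (auto simp del: split_paired_All)
  define L where "L = C1 * 3"
  have L: "L < top" using C1 by (simp add: L_def ennreal_mult_less_top)
  define K where "K = ennreal_pow L a * C2"
  have K: "K < top" using L C2 by (simp add: K_def ennreal_mult_less_top)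
  have "\<exists>H \<in> borel_measurable borel.
      (\<integral>\<^sup>+t. H t \<partial>haar) \<le> K * (\<integral>\<^sup>+x. ennreal_pow (Lp_norm haar q (\<lambda>t. w (t, x))) p \<partial>lborel) \<and>
      (\<forall>t>0. ennreal (t powr (real DIM('a) * (1 - \<theta>))) *
        Lp_pow \<theta> p (\<lambda>x. w (t, x)) \<le> H t)"
    if w[measurable]: "w \<in> borel_measurable (borel :: (real \<times> 'a) measure)" and dom: "locally_dominated C w"
    for w
  proof -
    have [measurable]: "w \<in> borel_measurable (borel \<Otimes>\<^sub>M borel)" using w by (simp add: borel_prod)
    define g where "g x = ennreal_pow (Lp_norm haar q (\<lambda>t. w (t, x))) \<eta>" for x
    have [measurable]: "g \<in> borel_measurable borel"
      unfolding g_def by measurable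
    have ga: "ennreal_pow (g x) a = ennreal_pow (Lp_norm haar q (\<lambda>t. w (t, x))) p" for x
      using a by (simp add: g_def ennreal_pow_pow)
    have w_le: "ennreal_pow (w (t, x)) \<eta> \<le> L * ball_avg 2 g t x" if t: "0 < t" for t x
    proof -
      have "(\<integral>\<^sup>+s\<in>{t / 2<..<2 * t}. ball_avg 2 (\<lambda>y. ennreal_pow (w (s, y)) \<eta>) t x \<partial>haar)
        = ennreal (t powr - real DIM('a)) * (\<integral>\<^sup>+s. \<integral>\<^sup>+y. ennreal_pow (w (s, y)) \<eta>
            * indicator (ball x (2 * t)) y * indicator {t / 2<..<2 * t} s \<partial>lborel \<partial>haar)"
      proof (subst nn_integral_cmult[symmetric])
        show "(\<integral>\<^sup>+s\<in>{t / 2<..<2 * t}. ball_avg 2 (\<lambda>y. ennreal_pow (w (s, y)) \<eta>) t x \<partial>haar)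
          = (\<integral>\<^sup>+s. ennreal (t powr - real DIM('a)) * (\<integral>\<^sup>+y. ennreal_pow (w (s, y)) \<eta>
            * indicator (ball x (2 * t)) y * indicator {t / 2<..<2 * t} s \<partial>lborel) \<partial>haar)"
          by (intro nn_integral_cong) (subst nn_integral_multc; simp add: ball_avg_def mult.assoc)
      qed measurable
      also have "(\<integral>\<^sup>+s. \<integral>\<^sup>+y. ennreal_pow (w (s, y)) \<eta>
            * indicator (ball x (2 * t)) y * indicator {t / 2<..<2 * t} s \<partial>lborel \<partial>haar)
        = (\<integral>\<^sup>+y. \<integral>\<^sup>+s. ennreal_pow (w (s, y)) \<eta>
            * indicator (ball x (2 * t)) y * indicator {t / 2<..<2 * t} s \<partial>haar \<partial>lborel)"
        by (rule haar_lborel.Fubini'[symmetric]) measurable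
      also have "\<dots> \<le> (\<integral>\<^sup>+y\<in>ball x (2 * t). 3 * g y \<partial>lborel)"
      proof (rule nn_integral_mono)
        fix y
        have "(\<integral>\<^sup>+s. ennreal_pow (w (s, y)) \<eta>
            * indicator (ball x (2 * t)) y * indicator {t / 2<..<2 * t} s \<partial>haar)
          = (\<integral>\<^sup>+s\<in>{t / 2<..<2 * t}. ennreal_pow (w (s, y)) \<eta> \<partial>haar) * indicator (ball x (2 * t)) y"
          by (subst nn_integral_multc[symmetric]) (auto simp: mult_ac)
        also have "\<dots> \<le> 3 * g y * indicator (ball x (2 * t)) y"
          unfolding g_def
          by (intro mult_right_mono nn_integral_pow_le_Lp_norm emeasure_haar_le t \<eta>) auto
        finally show "(\<integral>\<^sup>+s. ennreal_pow (w (s, y)) \<eta>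
            * indicator (ball x (2 * t)) y * indicator {t / 2<..<2 * t} s \<partial>haar) \<le> \<dots>" .
      qed
      also have "ennreal (t powr - real DIM('a)) * (\<integral>\<^sup>+y\<in>ball x (2 * t). 3 * g y \<partial>lborel)
        = ball_avg 2 (\<lambda>y. 3 * g y) t x" by (simp only: ball_avg_def)
      also have "\<dots> = 3 * ball_avg 2 g t x" by (rule ball_avg_cmult) measurable
      finally have "C1 * (\<integral>\<^sup>+s\<in>{t / 2<..<2 * t}. ball_avg 2 (\<lambda>y. ennreal_pow (w (s, y)) \<eta>) t x \<partial>haar)
        \<le> C1 * (3 * ball_avg 2 g t x)" by (simp add: mult_left_mono)
      from order_trans[OF avg[OF w dom t, of x] this] show ?thesis by (simp only: L_def mult.assoc)
    qed
    obtain H where [measurable]: "H \<in> borel_measurable borel"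
      and H: "(\<integral>\<^sup>+t. H t \<partial>haar) \<le> C2 * (\<integral>\<^sup>+x. ennreal_pow (g x) a \<partial>lborel)"
      and le: "\<And>t. 0 < t \<Longrightarrow> ennreal (t powr (real DIM('a) * (1 - \<theta>))) *
        Lp_pow \<theta> a (\<lambda>x. ball_avg 2 g t x) \<le> H t"
      using embed[of g] by auto
    have "(\<integral>\<^sup>+t. ennreal_pow L a * H t \<partial>haar) = ennreal_pow L a * (\<integral>\<^sup>+t. H t \<partial>haar)"
      by (rule nn_integral_cmult) measurable
    also have "\<dots> \<le> K * (\<integral>\<^sup>+x. ennreal_pow (Lp_norm haar q (\<lambda>t. w (t, x))) p \<partial>lborel)"
      using H unfolding ga K_def by (simp add: mult_left_mono mult.assoc)
    finally have 1: "(\<integral>\<^sup>+t. ennreal_pow L a * H t \<partial>haar)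
      \<le> K * (\<integral>\<^sup>+x. ennreal_pow (Lp_norm haar q (\<lambda>t. w (t, x))) p \<partial>lborel)" .
    have 2: "ennreal (t powr (real DIM('a) * (1 - \<theta>))) *
        Lp_pow \<theta> p (\<lambda>x. w (t, x)) \<le> ennreal_pow L a * H t"
      if t: "0 < t" for t
    proof -
      have "Lp_pow \<theta> p (\<lambda>x. w (t, x))
        \<le> ennreal_pow L a * Lp_pow \<theta> a (\<lambda>x. ball_avg 2 g t x)"
      proof (cases "\<theta> = 0")
        case True
        have "ennreal_pow (w (t, x)) p \<le> ennreal_pow L a * ennreal_pow (SUP x. ball_avg 2 g t x) a" for x
        proof -
          have "ennreal_pow (w (t, x)) p = ennreal_pow (ennreal_pow (w (t, x)) \<eta>) a"
            using a by (simp add: ennreal_pow_pow)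
          also have "\<dots> \<le> ennreal_pow (L * (SUP x. ball_avg 2 g t x)) a"
            using a by (intro ennreal_pow_mono order_trans[OF w_le[OF t]] mult_left_mono SUP_upper) auto
          finally show ?thesis by (simp add: ennreal_pow_mult)
        qed
        then show ?thesis using True p by (auto intro!: ennreal_pow_SUP_le)
      next
        case False
        then have \<theta>': "0 < \<theta>" using \<theta> by simp
        have "(\<integral>\<^sup>+x. ennreal_pow (w (t, x)) (p / \<theta>) \<partial>lborel)
          \<le> (\<integral>\<^sup>+x. ennreal_pow L (a / \<theta>) * ennreal_pow (ball_avg 2 g t x) (a / \<theta>) \<partial>lborel)"
        proof (rule nn_integral_mono)
          fix x
          have "ennreal_pow (w (t, x)) (p / \<theta>) = ennreal_pow (ennreal_pow (w (t, x)) \<eta>) (a / \<theta>)"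
            using a by (simp add: ennreal_pow_pow)
          also have "\<dots> \<le> ennreal_pow (L * ball_avg 2 g t x) (a / \<theta>)"
            using a \<theta>' by (intro ennreal_pow_mono w_le t) auto
          finally show "ennreal_pow (w (t, x)) (p / \<theta>) \<le> ennreal_pow L (a / \<theta>) * ennreal_pow (ball_avg 2 g t x) (a / \<theta>)"
            by (simp add: ennreal_pow_mult)
        qed
        also have "\<dots> = ennreal_pow L (a / \<theta>) * (\<integral>\<^sup>+x. ennreal_pow (ball_avg 2 g t x) (a / \<theta>) \<partial>lborel)"
          by (rule nn_integral_cmult) measurable
        finally have "ennreal_pow (\<integral>\<^sup>+x. ennreal_pow (w (t, x)) (p / \<theta>) \<partial>lborel) \<theta> \<le> ennreal_pow \<dots> \<theta>"
          using \<theta>' by (intro ennreal_pow_mono) auto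
        then show ?thesis using \<theta>' by (simp add: ennreal_pow_mult ennreal_pow_pow)
      qed
      then have "ennreal (t powr (real DIM('a) * (1 - \<theta>))) * Lp_pow \<theta> p (\<lambda>x. w (t, x))
        \<le> ennreal (t powr (real DIM('a) * (1 - \<theta>))) * (ennreal_pow L a * Lp_pow \<theta> a (\<lambda>x. ball_avg 2 g t x))"
        by (rule mult_left_mono) simp
      also have "\<dots> = ennreal_pow L a * (ennreal (t powr (real DIM('a) * (1 - \<theta>))) * Lp_pow \<theta> a (\<lambda>x. ball_avg 2 g t x))"
        by (rule mult.left_commute)
      also have "\<dots> \<le> ennreal_pow L a * H t"
        by (intro mult_left_mono le t) simp
      finally show ?thesis .
    qed
    show ?thesis using 1 2 by (intro bexI[of _ "\<lambda>t. ennreal_pow L a * H t"]) auto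
  qed
  then show ?thesis using K by blast
qed

section \<open>Duality\<close>

text \<open>Interpolation between a supremum and an integral of the same power: f^r = f^(r-\<eta>) *
  f^\<eta>, with the first factor bounded by a power of A. Two bounds at the exponent \<eta> thus
  settle every q above \<eta> at once.\<close>

lemma Lp_norm_pow_le:
  assumes [measurable]: "f \<in> borel_measurable M" and \<eta>: "0 < \<eta>" "ennreal \<eta> < q"
    and sup: "AE x in M. ennreal_pow (f x) \<eta> \<le> A" and int: "(\<integral>\<^sup>+x. ennreal_pow (f x) \<eta> \<partial>M) \<le> A"
  shows "ennreal_pow (Lp_norm M q f) \<eta> \<le> A"
proof (cases q)
  case (real r)
  then have r: "\<eta> < r" "q \<noteq> top" "enn2real q = r" "0 < r" using \<eta> by (auto simp: ennreal_less_iff)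
  have "(\<integral>\<^sup>+x. ennreal_pow (f x) r \<partial>M) \<le> (\<integral>\<^sup>+x. ennreal_pow A ((r - \<eta>) / \<eta>) * ennreal_pow (f x) \<eta> \<partial>M)"
  proof (rule nn_integral_mono_AE, use sup in eventually_elim)
    fix x assume "ennreal_pow (f x) \<eta> \<le> A"
    then have "ennreal_pow (ennreal_pow (f x) \<eta>) ((r - \<eta>) / \<eta>) \<le> ennreal_pow A ((r - \<eta>) / \<eta>)"
      using r \<eta> by (intro ennreal_pow_mono) auto
    moreover have "ennreal_pow (f x) r = ennreal_pow (f x) (r - \<eta>) * ennreal_pow (f x) \<eta>"
      by (simp flip: ennreal_pow_add)
    ultimately show "ennreal_pow (f x) r \<le> ennreal_pow A ((r - \<eta>) / \<eta>) * ennreal_pow (f x) \<eta>"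
      using \<eta> by (simp add: ennreal_pow_pow mult_right_mono)
  qed
  also have "\<dots> = ennreal_pow A ((r - \<eta>) / \<eta>) * (\<integral>\<^sup>+x. ennreal_pow (f x) \<eta> \<partial>M)"
    by (rule nn_integral_cmult) measurable
  also have "\<dots> \<le> ennreal_pow A ((r - \<eta>) / \<eta>) * ennreal_pow A 1"
    using int by (simp add: mult_left_mono)
  also have "\<dots> = ennreal_pow A (r / \<eta>)"
    using \<eta> by (simp add: field_simps flip: ennreal_pow_add del: ennreal_pow_1)
  finally have "ennreal_pow (\<integral>\<^sup>+x. ennreal_pow (f x) r \<partial>M) (\<eta> / r) \<le> ennreal_pow (ennreal_pow A (r / \<eta>)) (\<eta> / r)"
    using \<eta> r by (intro ennreal_pow_mono) auto
  then show ?thesis using r \<eta> by (simp add: Lp_norm_def ennreal_pow_pow)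
next
  case top
  have "esssup M f \<le> ennreal_pow A (1 / \<eta>)"
    using sup \<eta> by (intro esssup_I) (auto simp: ennreal_pow_le_swap)
  then show ?thesis using top \<eta> by (simp add: Lp_norm_def ennreal_pow_le_swap)
qed

text \<open>The extremal test function is U^(\<sigma>-1), but its norm might be infinite. Truncating
  U in height and in support gives h n with a finite norm that can be divided out; monotone
  convergence then recovers U.\<close>

lemma nn_integral_pow_le_of_dual:
  fixes U :: "'a::euclidean_space \<Rightarrow> ennreal"
  assumes [measurable]: "U \<in> borel_measurable borel"
    and \<sigma>: "1 < \<sigma>" "1 / \<sigma> + 1 / \<sigma>' = 1"
    and dual: "\<And>g. g \<in> borel_measurable borel \<Longrightarrow>
      (\<integral>\<^sup>+x. U x * g x \<partial>lborel) \<le> M * ennreal_pow (\<integral>\<^sup>+x. ennreal_pow (g x) \<sigma>' \<partial>lborel) (1 / \<sigma>')"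
  shows "(\<integral>\<^sup>+x. ennreal_pow (U x) \<sigma> \<partial>lborel) \<le> ennreal_pow M \<sigma>"
proof -
  have \<sigma>': "(\<sigma> - 1) * \<sigma>' = \<sigma>" "0 < \<sigma>'"
  proof -
    have "\<sigma>' \<noteq> 0" using \<sigma> by auto
    then have "\<sigma>' = \<sigma> / (\<sigma> - 1)" using \<sigma> by (simp add: field_simps)
    then show "(\<sigma> - 1) * \<sigma>' = \<sigma>" "0 < \<sigma>'" using \<sigma> by auto
  qed
  define h where "h n x = min (U x) (of_nat n) * indicator (ball 0 (real n)) x" for n x
  have [measurable]: "h n \<in> borel_measurable borel" for n
    unfolding h_def by measurable
  have bound: "(\<integral>\<^sup>+x. ennreal_pow (h n x) \<sigma> \<partial>lborel) \<le> ennreal_pow M \<sigma>" for n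
  proof (cases "(\<integral>\<^sup>+x. ennreal_pow (h n x) \<sigma> \<partial>lborel) = 0")
    case False
    define X where "X = (\<integral>\<^sup>+x. ennreal_pow (h n x) \<sigma> \<partial>lborel)"
    have "X \<le> (\<integral>\<^sup>+x. ennreal_pow (of_nat n) \<sigma> * indicator (ball (0::'a) (real n)) x \<partial>lborel)"
      unfolding X_def using \<sigma>
      by (intro nn_integral_mono) (auto simp: h_def split: split_indicator intro!: ennreal_pow_mono)
    also have "\<dots> = ennreal_pow (of_nat n) \<sigma> * emeasure lborel (ball (0::'a) (real n))"
      by (simp add: nn_integral_cmult_indicator)
    also have "\<dots> < top"
      using emeasure_lborel_ball_finite[of "0::'a" "real n"]
      by (simp add: ennreal_mult_less_top of_nat_less_top)
    finally have X: "X \<noteq> 0" "X \<noteq> top" using False by (auto simp: X_def)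
    have "X \<le> (\<integral>\<^sup>+x. U x * ennreal_pow (h n x) (\<sigma> - 1) \<partial>lborel)"
      unfolding X_def
    proof (rule nn_integral_mono)
      fix x
      have "ennreal_pow (h n x) \<sigma> = ennreal_pow (h n x) 1 * ennreal_pow (h n x) (\<sigma> - 1)"
        by (simp flip: ennreal_pow_add del: ennreal_pow_1)
      also have "\<dots> \<le> U x * ennreal_pow (h n x) (\<sigma> - 1)"
        by (intro mult_right_mono) (auto simp: h_def split: split_indicator)
      finally show "ennreal_pow (h n x) \<sigma> \<le> U x * ennreal_pow (h n x) (\<sigma> - 1)" .
    qed
    also have "\<dots> \<le> M * ennreal_pow (\<integral>\<^sup>+x. ennreal_pow (ennreal_pow (h n x) (\<sigma> - 1)) \<sigma>' \<partial>lborel) (1 / \<sigma>')"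
      by (rule dual) measurable
    also have "\<dots> = M * ennreal_pow X (1 / \<sigma>')"
      by (simp add: ennreal_pow_pow \<sigma>' X_def)
    \<comment> \<open>A negative exponent lies outside the intended range of
      \<open>ennreal_pow\<close>, but X is neither 0 nor infinite, so this is division by
      X^(1/\<sigma>').\<close>
    finally have "X * ennreal_pow X (- (1 / \<sigma>')) \<le> M * ennreal_pow X (1 / \<sigma>') * ennreal_pow X (- (1 / \<sigma>'))"
      by (rule mult_right_mono) simp
    also have "\<dots> = M * ennreal_pow X (1 / \<sigma>' + - (1 / \<sigma>'))"
      by (simp only: ennreal_pow_add mult.assoc)
    also have "\<dots> = M" using X by (simp add: ennreal_pow_def enn2real_eq_0_iff)
    also have "X * ennreal_pow X (- (1 / \<sigma>')) = ennreal_pow X (1 + - (1 / \<sigma>'))"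
      by (simp only: ennreal_pow_add ennreal_pow_1)
    also have "1 + - (1 / \<sigma>') = 1 / \<sigma>" using \<sigma> by simp
    finally show ?thesis
      using \<sigma> by (simp add: le_ennreal_pow_swap X_def)
  qed simp
  have "ennreal_pow (U x) \<sigma> = (SUP n. ennreal_pow (h n x) \<sigma>)" (is "_ = ?S") for x
  proof (rule antisym)
    show "?S \<le> ennreal_pow (U x) \<sigma>"
      using \<sigma> by (intro SUP_least ennreal_pow_mono) (auto simp: h_def split: split_indicator)
    have "U x \<le> ennreal_pow ?S (1 / \<sigma>)" (is "_ \<le> ?z")
    proof (cases "?z = top")
      case False
      \<comment> \<open>For n beyond both norm x and ?z the point lies in the support, and the
        minimum of U x and n can only be at most ?z if it is U x.\<close>
      obtain n where n: "norm x < real n" "?z < of_nat n"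
      proof -
        obtain k where "?z < of_nat k"
          using False ennreal_Ex_less_of_nat less_top by blast
        moreover obtain m where "norm x < real m" using reals_Archimedean2 by blast
        ultimately show thesis
          using that[of "max k m"] by (metis (no_types, lifting) less_le_trans max.cobounded1 max.cobounded2 of_nat_mono)
      qed
      have "ennreal_pow (h n x) \<sigma> \<le> ?S" by (rule SUP_upper) simp
      then have "h n x \<le> ?z" using \<sigma> by (simp add: ennreal_pow_le_swap)
      then show ?thesis using n by (auto simp: h_def min_def split: if_splits)
    qed (simp only: top_greatest)
    then show "ennreal_pow (U x) \<sigma> \<le> ?S" using \<sigma> by (simp add: ennreal_pow_le_swap)
  qed
  then have "(\<integral>\<^sup>+x. ennreal_pow (U x) \<sigma> \<partial>lborel) = (\<integral>\<^sup>+x. (SUP n. ennreal_pow (h n x) \<sigma>) \<partial>lborel)"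
    by simp
  also have "\<dots> = (SUP n. \<integral>\<^sup>+x. ennreal_pow (h n x) \<sigma> \<partial>lborel)"
  proof (rule nn_integral_monotone_convergence_SUP)
    show "incseq (\<lambda>n x. ennreal_pow (h n x) \<sigma>)"
    proof (intro incseq_SucI le_funI ennreal_pow_mono)
      fix n x
      have "min (U x) (of_nat n) \<le> min (U x) (of_nat (Suc n))" by (rule min.mono) (auto intro: of_nat_mono)
      moreover have "indicator (ball 0 (real n)) x \<le> (indicator (ball 0 (real (Suc n))) x :: ennreal)"
        by (auto split: split_indicator)
      ultimately show "h n x \<le> h (Suc n) x" unfolding h_def by (rule mult_mono) auto
    qed (use \<sigma> in simp)
  qed measurable
  also have "\<dots> \<le> ennreal_pow M \<sigma>" by (intro SUP_least bound)
  finally show ?thesis .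
qed

text \<open>Tonelli's theorem and the symmetry of the relation dist x y < c * t. In the duality
  argument this moves the average from w^\<eta> to the test function.\<close>

lemma ball_avg_adjoint:
  fixes g h :: "'a::euclidean_space \<Rightarrow> ennreal"
  assumes [measurable]: "g \<in> borel_measurable borel" "h \<in> borel_measurable borel"
  shows "(\<integral>\<^sup>+x. ball_avg c h t x * g x \<partial>lborel) = (\<integral>\<^sup>+y. h y * ball_avg c g t y \<partial>lborel)"
proof -
  let ?c = "ennreal (t powr - real DIM('a))"
  have "(\<integral>\<^sup>+x. ball_avg c h t x * g x \<partial>lborel)
      = (\<integral>\<^sup>+x. \<integral>\<^sup>+y. ?c * (h y * indicator (ball x (c * t)) y) * g x \<partial>lborel \<partial>lborel)"
    by (intro nn_integral_cong) (simp add: ball_avg_def nn_integral_cmult nn_integral_multc)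
  also have "\<dots> = (\<integral>\<^sup>+y. \<integral>\<^sup>+x. ?c * (h y * indicator (ball x (c * t)) y) * g x \<partial>lborel \<partial>lborel)"
    by (rule lborel_pair.Fubini') measurable
  also have "\<dots> = (\<integral>\<^sup>+y. h y * ball_avg c g t y \<partial>lborel)"
  proof (rule nn_integral_cong)
    fix y
    have "(\<integral>\<^sup>+x. ?c * (h y * indicator (ball x (c * t)) y) * g x \<partial>lborel)
        = (\<integral>\<^sup>+x. h y * (?c * (g x * indicator (ball y (c * t)) x)) \<partial>lborel)"
      by (intro nn_integral_cong) (auto simp: mult_ac dist_commute split: split_indicator)
    also have "\<dots> = h y * ball_avg c g t y"
      by (simp add: ball_avg_def nn_integral_cmult)
    finally show "(\<integral>\<^sup>+x. ?c * (h y * indicator (ball x (c * t)) y) * g x \<partial>lborel) = h y * ball_avg c g t y" .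
  qed
  finally show ?thesis .
qed

text \<open>This plays the role of the \<open>\<eta>\<close>-th power of the inner tent norm, with averages in \<open>x\<close> built in.\<close>

definition scale_avg :: "real \<Rightarrow> real \<Rightarrow> (real \<times> 'a::euclidean_space \<Rightarrow> ennreal) \<Rightarrow> 'a \<Rightarrow> ennreal" where
  "scale_avg \<gamma> \<eta> w x =
    (\<integral>\<^sup>+s. ennreal (s powr (\<gamma> * \<eta>)) * ball_avg 4 (\<lambda>y. ennreal_pow (w (s, y)) \<eta>) s x \<partial>haar)"

lemma measurable_scale_avg:
  assumes "w \<in> borel_measurable borel"
  shows "scale_avg \<gamma> \<eta> w \<in> borel_measurable borel"
proof -
  have [measurable]: "w \<in> borel_measurable (borel \<Otimes>\<^sub>M borel)" using assms by (simp add: borel_prod)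
  show ?thesis unfolding scale_avg_def ball_avg_def by measurable
qed

text \<open>From t < 2s the ball of radius 2t lies in that of radius 4s, and s < 2t compares the
  factors t^-d and s^-d. This explains the aperture 4 in \<open>scale_avg\<close>.\<close>

lemma ball_avg_change_scale:
  assumes "t / 2 < s" "s < 2 * t"
  shows "ball_avg 2 g t (x::'a::euclidean_space) \<le> ennreal (2 powr real DIM('a)) * ball_avg 4 g s x"
proof -
  have pos: "0 < t" "0 < s" using assms by linarith+
  have "t powr - real DIM('a) \<le> (s / 2) powr - real DIM('a)"
    using assms pos by (intro powr_mono2') auto
  also have "\<dots> = 2 powr real DIM('a) * s powr - real DIM('a)"
    using pos by (simp add: powr_divide powr_minus field_simps)
  finally have 1: "ennreal (t powr - real DIM('a)) \<le> ennreal (2 powr real DIM('a)) * ennreal (s powr - real DIM('a))"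
    by (simp flip: ennreal_mult)
  have 2: "(\<integral>\<^sup>+y\<in>ball x (2 * t). g y \<partial>lborel) \<le> (\<integral>\<^sup>+y\<in>ball x (4 * s). g y \<partial>lborel)"
    using assms by (intro nn_integral_mono) (auto split: split_indicator)
  show ?thesis
    using mult_mono[OF 1 2] by (simp add: ball_avg_def mult.assoc)
qed

text \<open>The local average at t sees only s in (t/2, 2t), where t^\<gamma> and s^\<gamma> are
  comparable. Enlarging the range to all s gives the pointwise bound; integrating in t first gives
  the integral bound. Together they are the two bounds required by
  \<open>Lp_norm_pow_le\<close>.\<close>

lemma locally_dominated_scale_avg:
  fixes C :: ennreal
  assumes \<eta>: "0 < \<eta>" and C: "C < top" and \<gamma>: "0 \<le> \<gamma>"
  shows "\<exists>K<top. \<forall>w \<in> borel_measurable (borel :: (real \<times> 'a::euclidean_space) measure).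
    locally_dominated C w \<longrightarrow>
    (\<forall>x. (\<forall>t>0. ennreal_pow (ennreal (t powr \<gamma>) * w (t, x)) \<eta> \<le> K * scale_avg \<gamma> \<eta> w x) \<and>
      (\<integral>\<^sup>+t. ennreal_pow (ennreal (t powr \<gamma>) * w (t, x)) \<eta> \<partial>haar) \<le> K * scale_avg \<gamma> \<eta> w x)"
proof -
  obtain C1 where C1: "C1 < top"
    and avg: "\<And>w t x. w \<in> borel_measurable borel \<Longrightarrow> locally_dominated C w \<Longrightarrow> 0 < t \<Longrightarrow>
      ennreal_pow (w (t, x::'a)) \<eta>
      \<le> C1 * (\<integral>\<^sup>+s\<in>{t / 2<..<2 * t}. ball_avg 2 (\<lambda>y. ennreal_pow (w (s, y)) \<eta>) t x \<partial>haar)"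
    using locally_dominated_average[OF \<eta> C] by blast
  define L where "L = C1 * ennreal (2 powr (\<gamma> * \<eta>) * 2 powr real DIM('a))"
  have L: "L < top" using C1 by (simp add: L_def ennreal_mult_less_top)
  define K where "K = L * 3"
  have K: "K < top" using L by (simp add: K_def ennreal_mult_less_top)
  have "L * 1 \<le> K" unfolding K_def by (intro mult_left_mono) auto
  then have LK: "L \<le> K" by simp
  have "(\<forall>t>0. ennreal_pow (ennreal (t powr \<gamma>) * w (t, x)) \<eta> \<le> K * scale_avg \<gamma> \<eta> w x) \<and>
      (\<integral>\<^sup>+t. ennreal_pow (ennreal (t powr \<gamma>) * w (t, x)) \<eta> \<partial>haar) \<le> K * scale_avg \<gamma> \<eta> w x"
    if w: "w \<in> borel_measurable borel" and dom: "locally_dominated C w" for w and x :: 'a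
  proof -
    have [measurable]: "w \<in> borel_measurable (borel \<Otimes>\<^sub>M borel)" using w by (simp add: borel_prod)
    define F where "F s = ennreal (s powr (\<gamma> * \<eta>)) * ball_avg 4 (\<lambda>y. ennreal_pow (w (s, y)) \<eta>) s x" for s
    have [measurable]: "F \<in> borel_measurable borel"
      unfolding F_def ball_avg_def by measurable
    have U: "scale_avg \<gamma> \<eta> w x = (\<integral>\<^sup>+s. F s \<partial>haar)" by (simp add: scale_avg_def F_def)
    have key: "ennreal_pow (ennreal (t powr \<gamma>) * w (t, x)) \<eta> \<le> L * (\<integral>\<^sup>+s\<in>{t / 2<..<2 * t}. F s \<partial>haar)"
      if t: "0 < t" for t
    proof -
      have "ennreal_pow (ennreal (t powr \<gamma>) * w (t, x)) \<eta> = ennreal (t powr (\<gamma> * \<eta>)) * ennreal_pow (w (t, x)) \<eta>"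
        by (simp add: ennreal_pow_mult ennreal_pow_ennreal powr_powr)
      also have "\<dots> \<le> ennreal (t powr (\<gamma> * \<eta>)) *
          (C1 * (\<integral>\<^sup>+s\<in>{t / 2<..<2 * t}. ball_avg 2 (\<lambda>y. ennreal_pow (w (s, y)) \<eta>) t x \<partial>haar))"
        by (intro mult_left_mono avg w dom t) simp
      also have "\<dots> = C1 * (ennreal (t powr (\<gamma> * \<eta>)) *
          (\<integral>\<^sup>+s\<in>{t / 2<..<2 * t}. ball_avg 2 (\<lambda>y. ennreal_pow (w (s, y)) \<eta>) t x \<partial>haar))"
        by (rule mult.left_commute)
      also have "ennreal (t powr (\<gamma> * \<eta>)) *
          (\<integral>\<^sup>+s\<in>{t / 2<..<2 * t}. ball_avg 2 (\<lambda>y. ennreal_pow (w (s, y)) \<eta>) t x \<partial>haar)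
        = (\<integral>\<^sup>+s. ennreal (t powr (\<gamma> * \<eta>)) *
          (ball_avg 2 (\<lambda>y. ennreal_pow (w (s, y)) \<eta>) t x * indicator {t / 2<..<2 * t} s) \<partial>haar)"
        unfolding ball_avg_def by (rule nn_integral_cmult[symmetric]) measurable
      also have "\<dots> \<le> (\<integral>\<^sup>+s. ennreal (2 powr (\<gamma> * \<eta>) * 2 powr real DIM('a)) * (F s * indicator {t / 2<..<2 * t} s) \<partial>haar)"
      proof (rule nn_integral_mono)
        fix s
        show "ennreal (t powr (\<gamma> * \<eta>)) * (ball_avg 2 (\<lambda>y. ennreal_pow (w (s, y)) \<eta>) t x * indicator {t / 2<..<2 * t} s)
          \<le> ennreal (2 powr (\<gamma> * \<eta>) * 2 powr real DIM('a)) * (F s * indicator {t / 2<..<2 * t} s)"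
        proof (cases "s \<in> {t / 2<..<2 * t}")
          case True
          then have s: "t / 2 < s" "s < 2 * t" "0 < s" using t by auto
          have "t powr (\<gamma> * \<eta>) \<le> (2 * s) powr (\<gamma> * \<eta>)"
            using s t \<gamma> \<eta> by (intro powr_mono2) auto
          then have "ennreal (t powr (\<gamma> * \<eta>)) \<le> ennreal (2 powr (\<gamma> * \<eta>)) * ennreal (s powr (\<gamma> * \<eta>))"
            using s by (simp add: powr_mult flip: ennreal_mult)
          from mult_mono[OF this ball_avg_change_scale[OF s(1,2), of "\<lambda>y. ennreal_pow (w (s, y)) \<eta>" x]]
          show ?thesis using True by (simp add: F_def ennreal_mult mult_ac)
        qed simp
      qed
      also have "\<dots> = ennreal (2 powr (\<gamma> * \<eta>) * 2 powr real DIM('a)) * (\<integral>\<^sup>+s\<in>{t / 2<..<2 * t}. F s \<partial>haar)"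
        by (rule nn_integral_cmult) measurable
      finally show ?thesis by (simp add: L_def mult_left_mono mult.assoc)
    qed
    have "ennreal_pow (ennreal (t powr \<gamma>) * w (t, x)) \<eta> \<le> K * scale_avg \<gamma> \<eta> w x" if t: "0 < t" for t
    proof -
      have "(\<integral>\<^sup>+s\<in>{t / 2<..<2 * t}. F s \<partial>haar) \<le> scale_avg \<gamma> \<eta> w x"
        unfolding U by (intro nn_integral_mono) (auto split: split_indicator)
      then show ?thesis using key[OF t] mult_mono[OF LK] by (meson order_trans zero_le)
    qed
    moreover have "(\<integral>\<^sup>+t. ennreal_pow (ennreal (t powr \<gamma>) * w (t, x)) \<eta> \<partial>haar) \<le> K * scale_avg \<gamma> \<eta> w x"
    proof -
      have [measurable]: "(\<lambda>p::real \<times> real. indicator {snd p / 2<..<2 * snd p} (fst p) :: ennreal)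
          \<in> borel_measurable (borel \<Otimes>\<^sub>M borel)"
      proof -
        have "(\<lambda>p::real \<times> real. if snd p / 2 < fst p \<and> fst p < 2 * snd p then 1 else 0 :: ennreal)
          \<in> borel_measurable (borel \<Otimes>\<^sub>M borel)" by measurable
        then show ?thesis unfolding indicator_def by simp
      qed
      have "(\<integral>\<^sup>+t. ennreal_pow (ennreal (t powr \<gamma>) * w (t, x)) \<eta> \<partial>haar)
        \<le> (\<integral>\<^sup>+t. L * (\<integral>\<^sup>+s\<in>{t / 2<..<2 * t}. F s \<partial>haar) \<partial>haar)"
        by (intro nn_integral_haar_mono key)
      \<comment> \<open>The relation t/2 < s < 2t is symmetric in s and t, so after the exchange of
        integrals t runs through (s/2, 2s), of measure at most 3.\<close>
      also have "\<dots> = (\<integral>\<^sup>+t. \<integral>\<^sup>+s. L * (F s * indicator {s / 2<..<2 * s} t) \<partial>haar \<partial>haar)"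
      proof (rule nn_integral_cong)
        fix t
        have "L * (\<integral>\<^sup>+s\<in>{t / 2<..<2 * t}. F s \<partial>haar)
          = (\<integral>\<^sup>+s. L * (F s * indicator {t / 2<..<2 * t} s) \<partial>haar)"
          by (rule nn_integral_cmult[symmetric]) measurable
        also have "\<dots> = (\<integral>\<^sup>+s. L * (F s * indicator {s / 2<..<2 * s} t) \<partial>haar)"
          by (auto intro!: nn_integral_cong split: split_indicator)
        finally show "L * (\<integral>\<^sup>+s\<in>{t / 2<..<2 * t}. F s \<partial>haar)
          = (\<integral>\<^sup>+s. L * (F s * indicator {s / 2<..<2 * s} t) \<partial>haar)" .
      qed
      also have "\<dots> = (\<integral>\<^sup>+s. \<integral>\<^sup>+t. L * (F s * indicator {s / 2<..<2 * s} t) \<partial>haar \<partial>haar)"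
      proof (rule haar_haar.Fubini'[symmetric])
        show "(\<lambda>(t, s). L * (F s * indicator {s / 2<..<2 * s} t)) \<in> borel_measurable (haar \<Otimes>\<^sub>M haar)"
          by (simp add: case_prod_beta')
      qed
      also have "\<dots> = (\<integral>\<^sup>+s. L * F s * emeasure haar {s / 2<..<2 * s} \<partial>haar)"
        by (simp add: nn_integral_cmult_indicator flip: mult.assoc)
      also have "\<dots> \<le> (\<integral>\<^sup>+s. L * F s * 3 \<partial>haar)"
        by (intro nn_integral_haar_mono mult_left_mono emeasure_haar_le) auto
      also have "\<dots> = K * scale_avg \<gamma> \<eta> w x"
        by (simp add: U K_def nn_integral_cmult nn_integral_multc mult_ac)
      finally show ?thesis .
    qed
    ultimately show ?thesis by simp
  qed
  then show ?thesis using K by blast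
qed

lemma conjugate_exponents:
  assumes "1 < p"
  shows "1 < p / (p - 1)" "1 / p + 1 / (p / (p - 1)) = (1::real)"
  using assms by (simp_all add: field_simps)

text \<open>Pair with a test function g, move the ball averages onto g, and apply Hoelder's
  inequality in space with exponent P and then in time with exponent \<sigma>. What remains of g is
  the mixed norm from \<open>ball_avg_mixed_norm_le\<close> at the conjugate exponents, whose order
  is reversed: \<sigma>' < P'.\<close>

proposition scale_avg_norm_le:
  fixes p\<^sub>0 p\<^sub>1 \<eta> :: real
  assumes \<eta>: "0 < \<eta>" "\<eta> < p\<^sub>0" and p: "p\<^sub>0 < p\<^sub>1"
    and \<gamma>: "\<gamma> = real DIM('a::euclidean_space) * (1 / p\<^sub>0 - 1 / p\<^sub>1)"
  shows "\<exists>K<top. \<forall>w \<in> borel_measurable (borel :: (real \<times> 'a) measure).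
    (\<integral>\<^sup>+x. ennreal_pow (scale_avg \<gamma> \<eta> w x) (p\<^sub>1 / \<eta>) \<partial>lborel)
    \<le> K * (\<integral>\<^sup>+t. ennreal_pow (\<integral>\<^sup>+x. ennreal_pow (w (t, x)) p\<^sub>0 \<partial>lborel) (p\<^sub>1 / p\<^sub>0) \<partial>haar)"
proof -
  define P where "P = p\<^sub>0 / \<eta>"
  define \<sigma> where "\<sigma> = p\<^sub>1 / \<eta>"
  define P' where "P' = P / (P - 1)"
  define \<sigma>' where "\<sigma>' = \<sigma> / (\<sigma> - 1)"
  have P: "1 < P" and \<sigma>: "1 < \<sigma>" and P\<sigma>: "P < \<sigma>" using \<eta> p by (auto simp: P_def \<sigma>_def field_simps)
  have P': "1 < P'" "1 / P + 1 / P' = 1" and \<sigma>': "1 < \<sigma>'" "1 / \<sigma> + 1 / \<sigma>' = 1"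
    using conjugate_exponents[OF P] conjugate_exponents[OF \<sigma>] by (auto simp: P'_def \<sigma>'_def)
  have "1 / \<sigma> < 1 / P" using P P\<sigma> by (simp add: field_simps)
  then have inv: "1 / P' < 1 / \<sigma>'" using P' \<sigma>' by linarith
  \<comment> \<open>In the estimate for ball averages a = \<sigma>' and a/\<theta> has to be P'. The
    inequality P < \<sigma> is what makes this ratio less than 1.\<close>
  define \<theta> where "\<theta> = \<sigma>' / P'"
  have \<theta>: "0 < \<theta>" "\<theta> < 1" using P' \<sigma>' inv by (auto simp: \<theta>_def field_simps)
  have a: "\<sigma>' / \<theta> = P'" using P' \<sigma>' by (simp add: \<theta>_def)
  \<comment> \<open>The weights agree because 1/P - 1/\<sigma> = 1/\<sigma>' - 1/P': the difference
    of reciprocals survives passing to conjugate exponents.\<close>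
  have exp: "\<gamma> * \<eta> * \<sigma>' = real DIM('a) * (1 - \<theta>)"
  proof -
    have "\<gamma> * \<eta> = real DIM('a) * (1 / P - 1 / \<sigma>)"
      using \<eta> p by (simp add: \<gamma> P_def \<sigma>_def field_simps)
    also have "1 / P - 1 / \<sigma> = 1 / \<sigma>' - 1 / P'" using P' \<sigma>' by linarith
    finally show ?thesis using \<sigma>' by (simp add: \<theta>_def field_simps)
  qed
  obtain C where C: "C < top"
    and embed: "\<And>g. g \<in> borel_measurable (borel :: 'a measure) \<Longrightarrow> \<exists>H \<in> borel_measurable borel.
      (\<integral>\<^sup>+t. H t \<partial>haar) \<le> C * (\<integral>\<^sup>+x. ennreal_pow (g x) \<sigma>' \<partial>lborel) \<and>
      (\<forall>t>0. ennreal (t powr (real DIM('a) * (1 - \<theta>))) *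
         ennreal_pow (\<integral>\<^sup>+x. ennreal_pow (ball_avg 4 g t x) P' \<partial>lborel) \<theta> \<le> H t)"
    using ball_avg_mixed_norm_le[OF \<sigma>'(1) less_imp_le[OF \<theta>(1)] \<theta>(2), of 4, where 'a = 'a] \<theta> unfolding a
    by auto
  define K where "K = ennreal_pow (ennreal_pow C (1 / \<sigma>')) \<sigma>"
  have K: "K < top" using C by (simp add: K_def)
  have "(\<integral>\<^sup>+x. ennreal_pow (scale_avg \<gamma> \<eta> w x) \<sigma> \<partial>lborel)
    \<le> K * (\<integral>\<^sup>+t. ennreal_pow (\<integral>\<^sup>+x. ennreal_pow (w (t, x)) p\<^sub>0 \<partial>lborel) (p\<^sub>1 / p\<^sub>0) \<partial>haar)"
    if w: "w \<in> borel_measurable (borel :: (real \<times> 'a) measure)" for w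
  proof -
    have w'[measurable]: "w \<in> borel_measurable (borel \<Otimes>\<^sub>M borel)" using w by (simp add: borel_prod)
    define N where "N = (\<integral>\<^sup>+t. ennreal_pow (\<integral>\<^sup>+x. ennreal_pow (w (t, x)) p\<^sub>0 \<partial>lborel) (p\<^sub>1 / p\<^sub>0) \<partial>haar)"
    define X where "X s = ennreal_pow (\<integral>\<^sup>+y. ennreal_pow (w (s, y)) p\<^sub>0 \<partial>lborel) (1 / P)" for s
    have [measurable]: "X \<in> borel_measurable borel" unfolding X_def by measurable
    have X\<sigma>: "(\<integral>\<^sup>+s. ennreal_pow (X s) \<sigma> \<partial>haar) = N"
      using \<eta> by (simp add: X_def N_def ennreal_pow_pow P_def \<sigma>_def)
    have "(\<integral>\<^sup>+x. scale_avg \<gamma> \<eta> w x * g x \<partial>lborel)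
      \<le> ennreal_pow N (1 / \<sigma>) * ennreal_pow C (1 / \<sigma>') * ennreal_pow (\<integral>\<^sup>+x. ennreal_pow (g x) \<sigma>' \<partial>lborel) (1 / \<sigma>')"
      if g[measurable]: "g \<in> borel_measurable (borel :: 'a measure)" for g
    proof -
      define Y where "Y s = ennreal (s powr (\<gamma> * \<eta>)) *
        ennreal_pow (\<integral>\<^sup>+x. ennreal_pow (ball_avg 4 g s x) P' \<partial>lborel) (1 / P')" for s
      have [measurable]: "Y \<in> borel_measurable borel" unfolding Y_def by measurable
      obtain H where [measurable]: "H \<in> borel_measurable borel"
        and H: "(\<integral>\<^sup>+t. H t \<partial>haar) \<le> C * (\<integral>\<^sup>+x. ennreal_pow (g x) \<sigma>' \<partial>lborel)"
        and le: "\<And>t. 0 < t \<Longrightarrow> ennreal (t powr (real DIM('a) * (1 - \<theta>))) *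
         ennreal_pow (\<integral>\<^sup>+x. ennreal_pow (ball_avg 4 g t x) P' \<partial>lborel) \<theta> \<le> H t"
        using embed[OF g] by auto
      have [measurable]: "(\<lambda>p. ball_avg 4 (\<lambda>y. ennreal_pow (w (fst p, y)) \<eta>) (fst p) (snd p))
        \<in> borel_measurable (borel \<Otimes>\<^sub>M borel)"
        unfolding ball_avg_def by measurable
      have "(\<integral>\<^sup>+x. scale_avg \<gamma> \<eta> w x * g x \<partial>lborel)
        = (\<integral>\<^sup>+x. \<integral>\<^sup>+s. ennreal (s powr (\<gamma> * \<eta>)) * ball_avg 4 (\<lambda>y. ennreal_pow (w (s, y)) \<eta>) s x * g x \<partial>haar \<partial>lborel)"
        unfolding scale_avg_def
        by (intro nn_integral_cong nn_integral_multc[symmetric]) (simp add: ball_avg_def)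
      also have "\<dots> = (\<integral>\<^sup>+s. \<integral>\<^sup>+x. ennreal (s powr (\<gamma> * \<eta>)) * ball_avg 4 (\<lambda>y. ennreal_pow (w (s, y)) \<eta>) s x * g x \<partial>lborel \<partial>haar)"
      proof (rule haar_lborel.Fubini')
        show "(\<lambda>(s, x). ennreal (s powr (\<gamma> * \<eta>)) * ball_avg 4 (\<lambda>y. ennreal_pow (w (s, y)) \<eta>) s x * g x)
            \<in> borel_measurable (haar \<Otimes>\<^sub>M lborel)"
          unfolding case_prod_beta' by measurable
      qed
      also have "\<dots> \<le> (\<integral>\<^sup>+s. X s * Y s \<partial>haar)"
      proof (rule nn_integral_mono)
        fix s
        have "(\<integral>\<^sup>+x. ennreal (s powr (\<gamma> * \<eta>)) * ball_avg 4 (\<lambda>y. ennreal_pow (w (s, y)) \<eta>) s x * g x \<partial>lborel)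
          = ennreal (s powr (\<gamma> * \<eta>)) * (\<integral>\<^sup>+x. ball_avg 4 (\<lambda>y. ennreal_pow (w (s, y)) \<eta>) s x * g x \<partial>lborel)"
          unfolding mult.assoc by (rule nn_integral_cmult) measurable
        also have "(\<integral>\<^sup>+x. ball_avg 4 (\<lambda>y. ennreal_pow (w (s, y)) \<eta>) s x * g x \<partial>lborel)
          = (\<integral>\<^sup>+y. ennreal_pow (w (s, y)) \<eta> * ball_avg 4 g s y \<partial>lborel)"
          by (rule ball_avg_adjoint) measurable
        also have "\<dots> \<le> ennreal_pow (\<integral>\<^sup>+y. ennreal_pow (ennreal_pow (w (s, y)) \<eta>) P \<partial>lborel) (1 / P)
          * ennreal_pow (\<integral>\<^sup>+y. ennreal_pow (ball_avg 4 g s y) P' \<partial>lborel) (1 / P')"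
          by (rule Holder_nn_integral[OF P P']) measurable
        also have "ennreal (s powr (\<gamma> * \<eta>)) * \<dots> = X s * Y s"
          using \<eta> by (simp add: X_def Y_def ennreal_pow_pow P_def mult_ac)
        finally show "(\<integral>\<^sup>+x. ennreal (s powr (\<gamma> * \<eta>)) * ball_avg 4 (\<lambda>y. ennreal_pow (w (s, y)) \<eta>) s x * g x \<partial>lborel)
          \<le> X s * Y s" by (simp add: mult_left_mono)
      qed
      also have "\<dots> \<le> ennreal_pow (\<integral>\<^sup>+s. ennreal_pow (X s) \<sigma> \<partial>haar) (1 / \<sigma>)
          * ennreal_pow (\<integral>\<^sup>+s. ennreal_pow (Y s) \<sigma>' \<partial>haar) (1 / \<sigma>')"
        by (rule Holder_nn_integral[OF \<sigma> \<sigma>']) measurable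
      also have "\<dots> \<le> ennreal_pow N (1 / \<sigma>) * ennreal_pow (C * (\<integral>\<^sup>+x. ennreal_pow (g x) \<sigma>' \<partial>lborel)) (1 / \<sigma>')"
        unfolding X\<sigma>
      proof (intro mult_left_mono ennreal_pow_mono order_trans[OF nn_integral_haar_mono H])
        fix s :: real assume "0 < s"
        have "ennreal_pow (Y s) \<sigma>' = ennreal (s powr (real DIM('a) * (1 - \<theta>))) *
           ennreal_pow (\<integral>\<^sup>+x. ennreal_pow (ball_avg 4 g s x) P' \<partial>lborel) \<theta>"
          by (simp add: Y_def ennreal_pow_mult ennreal_pow_pow ennreal_pow_ennreal powr_powr exp \<theta>_def)
        also have "\<dots> \<le> H s" by (rule le) fact
        finally show "ennreal_pow (Y s) \<sigma>' \<le> H s" .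
      qed (use \<sigma>' in auto)
      finally show ?thesis by (simp add: ennreal_pow_mult mult.assoc)
    qed
    then have "(\<integral>\<^sup>+x. ennreal_pow (scale_avg \<gamma> \<eta> w x) \<sigma> \<partial>lborel)
      \<le> ennreal_pow (ennreal_pow N (1 / \<sigma>) * ennreal_pow C (1 / \<sigma>')) \<sigma>"
      by (intro nn_integral_pow_le_of_dual[OF _ \<sigma> \<sigma>'(2)] measurable_scale_avg w)
    also have "\<dots> = K * N"
      using \<sigma> by (simp add: K_def ennreal_pow_mult ennreal_pow_pow mult.commute)
    finally show ?thesis unfolding N_def .
  qed
  then show ?thesis using K unfolding \<sigma>_def by blast
qed

text \<open>Here \<eta> < q serves to bound the inner norm by \<open>scale_avg\<close>, after which
  q has disappeared, and \<eta> < \<open>p\<^sub>0\<close> serves the duality argument.\<close>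

proposition vertical_norm_le_mixed_norm:
  fixes p\<^sub>0 p\<^sub>1 :: real and q C :: ennreal
  assumes p: "0 < p\<^sub>0" "p\<^sub>0 < p\<^sub>1" and q: "0 < q" and C: "C < top"
    and \<gamma>: "\<gamma> = real DIM('a::euclidean_space) * (1 / p\<^sub>0 - 1 / p\<^sub>1)"
  shows "\<exists>K<top. \<forall>w \<in> borel_measurable (borel :: (real \<times> 'a) measure). locally_dominated C w \<longrightarrow>
    (\<integral>\<^sup>+x. ennreal_pow (Lp_norm haar q (\<lambda>t. ennreal (t powr \<gamma>) * w (t, x))) p\<^sub>1 \<partial>lborel)
    \<le> K * (\<integral>\<^sup>+t. ennreal_pow (\<integral>\<^sup>+x. ennreal_pow (w (t, x)) p\<^sub>0 \<partial>lborel) (p\<^sub>1 / p\<^sub>0) \<partial>haar)"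
proof -
  obtain \<eta> where \<eta>: "0 < \<eta>" "\<eta> < p\<^sub>0" "ennreal \<eta> < q" using ex_small_exponent[OF p(1) q] .
  have "1 / p\<^sub>1 < 1 / p\<^sub>0" using p by (simp add: field_simps)
  then have \<gamma>0: "0 \<le> \<gamma>" by (simp add: \<gamma>)
  obtain K1 where K1: "K1 < top"
    and sup: "\<And>w t x. w \<in> borel_measurable borel \<Longrightarrow> locally_dominated C w \<Longrightarrow> 0 < t \<Longrightarrow>
      ennreal_pow (ennreal (t powr \<gamma>) * w (t, x::'a)) \<eta> \<le> K1 * scale_avg \<gamma> \<eta> w x"
    and int: "\<And>w x. w \<in> borel_measurable borel \<Longrightarrow> locally_dominated C w \<Longrightarrow>
      (\<integral>\<^sup>+t. ennreal_pow (ennreal (t powr \<gamma>) * w (t, x::'a)) \<eta> \<partial>haar) \<le> K1 * scale_avg \<gamma> \<eta> w x"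
    using locally_dominated_scale_avg[OF \<eta>(1) C \<gamma>0] by blast
  obtain K2 where K2: "K2 < top"
    and norm: "\<And>w. w \<in> borel_measurable (borel :: (real \<times> 'a) measure) \<Longrightarrow>
    (\<integral>\<^sup>+x. ennreal_pow (scale_avg \<gamma> \<eta> w x) (p\<^sub>1 / \<eta>) \<partial>lborel)
    \<le> K2 * (\<integral>\<^sup>+t. ennreal_pow (\<integral>\<^sup>+x. ennreal_pow (w (t, x)) p\<^sub>0 \<partial>lborel) (p\<^sub>1 / p\<^sub>0) \<partial>haar)"
    using scale_avg_norm_le[OF \<eta>(1,2) p(2) \<gamma>] by blast
  define K where "K = ennreal_pow K1 (p\<^sub>1 / \<eta>) * K2"
  have K: "K < top" using K1 K2 by (simp add: K_def ennreal_mult_less_top)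
  have "(\<integral>\<^sup>+x. ennreal_pow (Lp_norm haar q (\<lambda>t. ennreal (t powr \<gamma>) * w (t, x))) p\<^sub>1 \<partial>lborel)
    \<le> K * (\<integral>\<^sup>+t. ennreal_pow (\<integral>\<^sup>+x. ennreal_pow (w (t, x)) p\<^sub>0 \<partial>lborel) (p\<^sub>1 / p\<^sub>0) \<partial>haar)"
    if w: "w \<in> borel_measurable (borel :: (real \<times> 'a) measure)" and dom: "locally_dominated C w" for w
  proof -
    have [measurable]: "w \<in> borel_measurable (borel \<Otimes>\<^sub>M borel)" using w by (simp add: borel_prod)
    have [measurable]: "scale_avg \<gamma> \<eta> w \<in> borel_measurable borel" by (rule measurable_scale_avg[OF w])
    have "(\<integral>\<^sup>+x. ennreal_pow (Lp_norm haar q (\<lambda>t. ennreal (t powr \<gamma>) * w (t, x))) p\<^sub>1 \<partial>lborel)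
      \<le> (\<integral>\<^sup>+x. ennreal_pow K1 (p\<^sub>1 / \<eta>) * ennreal_pow (scale_avg \<gamma> \<eta> w x) (p\<^sub>1 / \<eta>) \<partial>lborel)"
    proof (rule nn_integral_mono)
      fix x
      have "ennreal_pow (Lp_norm haar q (\<lambda>t. ennreal (t powr \<gamma>) * w (t, x))) \<eta> \<le> K1 * scale_avg \<gamma> \<eta> w x"
        by (rule Lp_norm_pow_le)
          (use AE_haar_pos sup[OF w dom] in \<open>auto intro!: \<eta> int w dom elim: eventually_mono\<close>)
      then have "ennreal_pow (ennreal_pow (Lp_norm haar q (\<lambda>t. ennreal (t powr \<gamma>) * w (t, x))) \<eta>) (p\<^sub>1 / \<eta>)
        \<le> ennreal_pow (K1 * scale_avg \<gamma> \<eta> w x) (p\<^sub>1 / \<eta>)"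
        using \<eta> p by (intro ennreal_pow_mono) auto
      then show "ennreal_pow (Lp_norm haar q (\<lambda>t. ennreal (t powr \<gamma>) * w (t, x))) p\<^sub>1
        \<le> ennreal_pow K1 (p\<^sub>1 / \<eta>) * ennreal_pow (scale_avg \<gamma> \<eta> w x) (p\<^sub>1 / \<eta>)"
        using \<eta> by (simp add: ennreal_pow_pow ennreal_pow_mult)
    qed
    also have "\<dots> = ennreal_pow K1 (p\<^sub>1 / \<eta>) * (\<integral>\<^sup>+x. ennreal_pow (scale_avg \<gamma> \<eta> w x) (p\<^sub>1 / \<eta>) \<partial>lborel)"
      by (rule nn_integral_cmult) measurable
    also have "\<dots> \<le> K * (\<integral>\<^sup>+t. ennreal_pow (\<integral>\<^sup>+x. ennreal_pow (w (t, x)) p\<^sub>0 \<partial>lborel) (p\<^sub>1 / p\<^sub>0) \<partial>haar)"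
      unfolding K_def mult.assoc by (intro mult_left_mono norm w) simp
    finally show ?thesis .
  qed
  then show ?thesis using K by blast
qed

section \<open>Supremum and Carleson bounds for an infinite target exponent\<close>

lemma weighted_sup_le:
  fixes C :: ennreal
  assumes p: "0 < p" and C: "C < top"
  shows "\<exists>K<top. \<forall>w \<in> borel_measurable (borel :: (real \<times> 'a::euclidean_space) measure).
    locally_dominated C w \<longrightarrow> (\<forall>B. (AE t in haar. (\<integral>\<^sup>+x. ennreal_pow (w (t, x)) p \<partial>lborel) \<le> ennreal_pow B p) \<longrightarrow>
      (\<forall>t>0. \<forall>x. ennreal (t powr (real DIM('a) / p)) * w (t, x) \<le> K * B))"
proof -
  \<comment> \<open>The average is taken with the exponent p itself: its integral over a ball is
    then bounded by the full integral in space, and the remaining t^-d is compensated by the p-th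
    power of the weight t^(d/p).\<close>
  obtain C1 where C1: "C1 < top"
    and avg: "\<And>w t x. w \<in> borel_measurable borel \<Longrightarrow> locally_dominated C w \<Longrightarrow> 0 < t \<Longrightarrow>
      ennreal_pow (w (t, x::'a)) p
      \<le> C1 * (\<integral>\<^sup>+s\<in>{t / 2<..<2 * t}. ball_avg 2 (\<lambda>y. ennreal_pow (w (s, y)) p) t x \<partial>haar)"
    using locally_dominated_average[OF p C] by blast
  define K where "K = ennreal_pow (C1 * 3) (1 / p)"
  have K: "K < top" using C1 by (simp add: K_def ennreal_mult_less_top)
  have "ennreal (t powr (real DIM('a) / p)) * w (t, x) \<le> K * B"
    if w: "w \<in> borel_measurable (borel :: (real \<times> 'a) measure)" and dom: "locally_dominated C w"
      and B: "AE t in haar. (\<integral>\<^sup>+x. ennreal_pow (w (t, x)) p \<partial>lborel) \<le> ennreal_pow B p" and t: "0 < t"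
    for w B t x
  proof -
    have "(\<integral>\<^sup>+s\<in>{t / 2<..<2 * t}. ball_avg 2 (\<lambda>y. ennreal_pow (w (s, y)) p) t x \<partial>haar)
      \<le> (\<integral>\<^sup>+s. ennreal (t powr - real DIM('a)) * ennreal_pow B p * indicator {t / 2<..<2 * t} s \<partial>haar)"
    \<comment> \<open>The hypothesis on B holds for almost every s only. This suffices under the
      integral in s, and so the conclusion is reached for every t.\<close>
    proof (rule nn_integral_mono_AE, use B in eventually_elim)
      fix s assume "(\<integral>\<^sup>+x. ennreal_pow (w (s, x)) p \<partial>lborel) \<le> ennreal_pow B p"
      moreover have "(\<integral>\<^sup>+y\<in>ball x (2 * t). ennreal_pow (w (s, y)) p \<partial>lborel) \<le> (\<integral>\<^sup>+x. ennreal_pow (w (s, x)) p \<partial>lborel)"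
        by (intro nn_integral_mono) (auto split: split_indicator)
      ultimately show "ball_avg 2 (\<lambda>y. ennreal_pow (w (s, y)) p) t x * indicator {t / 2<..<2 * t} s
        \<le> ennreal (t powr - real DIM('a)) * ennreal_pow B p * indicator {t / 2<..<2 * t} s"
        unfolding ball_avg_def by (intro mult_right_mono mult_left_mono) auto
    qed
    also have "\<dots> = ennreal (t powr - real DIM('a)) * ennreal_pow B p * emeasure haar {t / 2<..<2 * t}"
      by (simp add: nn_integral_cmult_indicator)
    also have "\<dots> \<le> ennreal (t powr - real DIM('a)) * ennreal_pow B p * 3"
      by (intro mult_left_mono emeasure_haar_le t) simp
    finally have "ennreal (t powr real DIM('a)) * ennreal_pow (w (t, x)) p
      \<le> ennreal (t powr real DIM('a)) * (C1 * (ennreal (t powr - real DIM('a)) * ennreal_pow B p * 3))"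
      by (intro mult_left_mono order_trans[OF avg[OF w dom t]]) auto
    also have "\<dots> = ennreal (t powr real DIM('a)) * ennreal (t powr - real DIM('a)) * (C1 * 3 * ennreal_pow B p)"
      by (simp only: mult_ac)
    also have "ennreal (t powr real DIM('a)) * ennreal (t powr - real DIM('a)) = 1"
      using t by (simp flip: ennreal_mult powr_add)
    finally have "ennreal_pow (ennreal (t powr (real DIM('a) / p)) * w (t, x)) p \<le> C1 * 3 * ennreal_pow B p"
      using p by (simp add: ennreal_pow_mult ennreal_pow_ennreal powr_powr)
    then show ?thesis
      using p by (simp add: ennreal_pow_le_swap ennreal_pow_mult[of _ "ennreal_pow B p"] ennreal_pow_pow K_def)
  qed
  then show ?thesis using K by blast
qed

lemma nn_integral_haar_powr_lessThan_le:
  assumes "0 < \<delta>" "0 \<le> R"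
  shows "(\<integral>\<^sup>+t\<in>{0<..<R}. ennreal (t powr \<delta>) \<partial>haar) \<le> ennreal (R powr \<delta> / \<delta>)"
  by (rule order_trans[OF nn_integral_mono nn_integral_haar_powr_le[OF assms]])
    (auto split: split_indicator)

text \<open>Power mean inequality on the ball, followed by enlarging the integral of the p-th power
  to the whole space. The gain for the Carleson bound is the negative power of the volume.\<close>

lemma mean_value_pow_le:
  fixes f :: "'a::euclidean_space \<Rightarrow> ennreal"
  assumes [measurable]: "f \<in> borel_measurable borel" and m: "0 < m" "m < p" and \<tau>: "0 < \<tau>"
    and V: "V = unit_ball_vol (real DIM('a))"
  shows "mean_value (ball y \<tau>) (\<lambda>x. ennreal_pow (f x) m) \<le>
    ennreal ((V * \<tau> powr real DIM('a)) powr - (m / p)) * ennreal_pow (\<integral>\<^sup>+x. ennreal_pow (f x) p \<partial>lborel) (m / p)"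
proof -
  define v where "v = V * \<tau> powr real DIM('a)"
  have v: "0 < v" using \<tau> by (simp add: v_def V)
  have vol: "emeasure lborel (ball y \<tau>) = ennreal v"
    using \<tau> by (simp add: emeasure_ball v_def V powr_realpow)
  have "(\<integral>\<^sup>+x\<in>ball y \<tau>. ennreal_pow (f x) m \<partial>lborel)
    \<le> ennreal_pow (\<integral>\<^sup>+x\<in>ball y \<tau>. ennreal_pow (f x) p \<partial>lborel) (m / p) * ennreal_pow (emeasure lborel (ball y \<tau>)) (1 - m / p)"
    by (rule power_mean_nn_integral) (use m in auto)
  also have "\<dots> \<le> ennreal_pow (\<integral>\<^sup>+x. ennreal_pow (f x) p \<partial>lborel) (m / p) * ennreal_pow (emeasure lborel (ball y \<tau>)) (1 - m / p)"
    using m by (intro mult_right_mono ennreal_pow_mono nn_integral_mono) (auto split: split_indicator)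
  also have "ennreal_pow (emeasure lborel (ball y \<tau>)) (1 - m / p) = ennreal (v powr (1 - m / p))"
    using v by (simp add: vol ennreal_pow_ennreal)
  finally have "(\<integral>\<^sup>+x\<in>ball y \<tau>. ennreal_pow (f x) m \<partial>lborel) / ennreal v
    \<le> ennreal_pow (\<integral>\<^sup>+x. ennreal_pow (f x) p \<partial>lborel) (m / p) * ennreal (v powr (1 - m / p)) / ennreal v"
    by (rule divide_right_mono_ennreal)
  also have "\<dots> = ennreal_pow (\<integral>\<^sup>+x. ennreal_pow (f x) p \<partial>lborel) (m / p) * ennreal (v powr (1 - m / p) / v)"
    using v by (simp add: ennreal_times_divide[symmetric] divide_ennreal)
  also have "v powr (1 - m / p) / v = v powr - (m / p)"
    using v by (simp add: powr_diff powr_minus field_simps)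
  finally show ?thesis
    by (simp add: mean_value_def nn_integral_completion vol v_def mult.commute)
qed

text \<open>Using the supremum bound for the full power q would leave the divergent integral of dt/t
  near 0. It is used only for the power q - m; the power m < p is averaged over the ball and yields
  \<tau>^(-d * m / p). The weight t^(\<gamma> * m) that is left makes the time integral converge to
  a multiple of \<tau>^(\<gamma> * m), and since \<gamma> = d/p the powers of \<tau> cancel.\<close>

proposition carleson_norm_le:
  fixes p q :: real and C :: ennreal
  assumes p: "0 < p" and q: "0 < q" and C: "C < top"
  shows "\<exists>K<top. \<forall>w \<in> borel_measurable (borel :: (real \<times> 'a::euclidean_space) measure).
    locally_dominated C w \<longrightarrow> (\<forall>B. (AE t in haar. (\<integral>\<^sup>+x. ennreal_pow (w (t, x)) p \<partial>lborel) \<le> ennreal_pow B p) \<longrightarrow>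
      (\<forall>\<tau>>0. \<forall>y. (\<integral>\<^sup>+t\<in>{0<..<\<tau>}. mean_value (ball y \<tau>)
        (\<lambda>x. ennreal_pow (ennreal (t powr (real DIM('a) / p)) * w (t, x)) q) \<partial>haar) \<le> K * ennreal_pow B q))"
proof -
  define D where "D = real DIM('a)"
  have D: "0 < D" by (simp add: D_def)
  define \<gamma> where "\<gamma> = D / p"
  define m where "m = min p q / 2"
  have m: "0 < m" "m < p" "m < q" using p q by (auto simp: m_def)
  define V where "V = unit_ball_vol (real DIM('a))"
  have V: "0 < V" by (simp add: V_def)
  have \<gamma>m: "0 < \<gamma> * m" using D m p by (simp add: \<gamma>_def)
  obtain K1 where K1: "K1 < top"
    and sup: "\<And>w B t x. w \<in> borel_measurable (borel :: (real \<times> 'a) measure) \<Longrightarrow> locally_dominated C w \<Longrightarrow>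
      (AE t in haar. (\<integral>\<^sup>+x. ennreal_pow (w (t, x)) p \<partial>lborel) \<le> ennreal_pow B p) \<Longrightarrow> 0 < t \<Longrightarrow>
      ennreal (t powr \<gamma>) * w (t, x) \<le> K1 * B"
    using weighted_sup_le[OF p C, where 'a = 'a] unfolding \<gamma>_def D_def by blast
  define K where "K = ennreal_pow K1 (q - m) * ennreal (V powr - (m / p) / (\<gamma> * m))"
  have K: "K < top" using K1 by (simp add: K_def ennreal_mult_less_top)
  have "(\<integral>\<^sup>+t\<in>{0<..<\<tau>}. mean_value (ball y \<tau>)
        (\<lambda>x. ennreal_pow (ennreal (t powr \<gamma>) * w (t, x)) q) \<partial>haar) \<le> K * ennreal_pow B q"
    if w: "w \<in> borel_measurable (borel :: (real \<times> 'a) measure)" and dom: "locally_dominated C w"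
      and B: "AE t in haar. (\<integral>\<^sup>+x. ennreal_pow (w (t, x)) p \<partial>lborel) \<le> ennreal_pow B p" and \<tau>: "0 < \<tau>"
    for w B \<tau> and y :: 'a
  proof -
    have [measurable]: "w \<in> borel_measurable (borel \<Otimes>\<^sub>M borel)" using w by (simp add: borel_prod)
    define v where "v = V * \<tau> powr D"
    define A where "A = ennreal_pow (K1 * B) (q - m) * (ennreal (v powr - (m / p)) * ennreal_pow B m)"
    have le: "AE t in haar. mean_value (ball y \<tau>) (\<lambda>x. ennreal_pow (ennreal (t powr \<gamma>) * w (t, x)) q)
      \<le> A * ennreal (t powr (\<gamma> * m))"
      using B AE_haar_pos
    proof eventually_elim
      case (elim t)
      have "mean_value (ball y \<tau>) (\<lambda>x. ennreal_pow (ennreal (t powr \<gamma>) * w (t, x)) q)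
        \<le> mean_value (ball y \<tau>) (\<lambda>x. (ennreal_pow (K1 * B) (q - m) * ennreal (t powr (\<gamma> * m))) * ennreal_pow (w (t, x)) m)"
        unfolding mean_value_def
      proof (intro divide_right_mono_ennreal nn_integral_mono mult_right_mono)
        fix x
        have "ennreal_pow (ennreal (t powr \<gamma>) * w (t, x)) q
          = ennreal_pow (ennreal (t powr \<gamma>) * w (t, x)) (q - m) * ennreal_pow (ennreal (t powr \<gamma>) * w (t, x)) m"
          by (simp flip: ennreal_pow_add)
        also have "\<dots> \<le> ennreal_pow (K1 * B) (q - m) * ennreal_pow (ennreal (t powr \<gamma>) * w (t, x)) m"
          using m elim by (intro mult_right_mono ennreal_pow_mono sup w dom B) auto
        finally show "ennreal_pow (ennreal (t powr \<gamma>) * w (t, x)) q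
          \<le> (ennreal_pow (K1 * B) (q - m) * ennreal (t powr (\<gamma> * m))) * ennreal_pow (w (t, x)) m"
          by (simp add: ennreal_pow_mult ennreal_pow_ennreal powr_powr mult_ac)
      qed simp
      also have "\<dots> = (ennreal_pow (K1 * B) (q - m) * ennreal (t powr (\<gamma> * m))) * mean_value (ball y \<tau>) (\<lambda>x. ennreal_pow (w (t, x)) m)"
        unfolding mean_value_def nn_integral_completion
        by (subst ennreal_times_divide, subst nn_integral_cmult[symmetric]) (auto simp: mult.assoc)
      also have "\<dots> \<le> (ennreal_pow (K1 * B) (q - m) * ennreal (t powr (\<gamma> * m))) * (ennreal (v powr - (m / p)) * ennreal_pow B m)"
      proof (rule mult_left_mono)
        have "mean_value (ball y \<tau>) (\<lambda>x. ennreal_pow (w (t, x)) m)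
          \<le> ennreal (v powr - (m / p)) * ennreal_pow (\<integral>\<^sup>+x. ennreal_pow (w (t, x)) p \<partial>lborel) (m / p)"
          unfolding v_def D_def by (rule mean_value_pow_le[OF _ m(1,2) \<tau> V_def]) measurable
        also have "\<dots> \<le> ennreal (v powr - (m / p)) * ennreal_pow (ennreal_pow B p) (m / p)"
          using m elim by (intro mult_left_mono ennreal_pow_mono) auto
        finally show "mean_value (ball y \<tau>) (\<lambda>x. ennreal_pow (w (t, x)) m) \<le> ennreal (v powr - (m / p)) * ennreal_pow B m"
          using p by (simp add: ennreal_pow_pow)
      qed simp
      finally show ?case by (simp add: A_def mult_ac)
    qed
    have "(\<integral>\<^sup>+t\<in>{0<..<\<tau>}. mean_value (ball y \<tau>) (\<lambda>x. ennreal_pow (ennreal (t powr \<gamma>) * w (t, x)) q) \<partial>haar)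
      \<le> (\<integral>\<^sup>+t. A * (ennreal (t powr (\<gamma> * m)) * indicator {0<..<\<tau>} t) \<partial>haar)"
      by (rule nn_integral_mono_AE, use le in eventually_elim) (auto split: split_indicator)
    also have "\<dots> = A * (\<integral>\<^sup>+t\<in>{0<..<\<tau>}. ennreal (t powr (\<gamma> * m)) \<partial>haar)"
      by (rule nn_integral_cmult) measurable
    also have "\<dots> \<le> A * ennreal (\<tau> powr (\<gamma> * m) / (\<gamma> * m))"
      using \<gamma>m \<tau> by (intro mult_left_mono nn_integral_haar_powr_lessThan_le) auto
    also have "\<dots> = ennreal_pow K1 (q - m) * (ennreal_pow B (q - m) * ennreal_pow B m) *
        (ennreal (v powr - (m / p)) * ennreal (\<tau> powr (\<gamma> * m) / (\<gamma> * m)))"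
      by (simp only: A_def ennreal_pow_mult mult_ac)
    also have "ennreal_pow B (q - m) * ennreal_pow B m = ennreal_pow B q"
      by (simp flip: ennreal_pow_add)
    also have "ennreal (v powr - (m / p)) * ennreal (\<tau> powr (\<gamma> * m) / (\<gamma> * m))
      = ennreal (v powr - (m / p) * (\<tau> powr (\<gamma> * m) / (\<gamma> * m)))"
      using \<gamma>m by (intro ennreal_mult[symmetric]) auto
    also have "v powr - (m / p) * (\<tau> powr (\<gamma> * m) / (\<gamma> * m)) = V powr - (m / p) / (\<gamma> * m)"
    proof -
      have "v powr - (m / p) = V powr - (m / p) * \<tau> powr (D * - (m / p))"
        using V \<tau> by (simp add: v_def powr_mult powr_powr)
      moreover have "\<tau> powr (D * - (m / p)) * \<tau> powr (\<gamma> * m) = 1"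
        using \<tau> by (simp add: \<gamma>_def flip: powr_add)
      ultimately show ?thesis by (simp add: mult.assoc)
    qed
    finally show ?thesis by (simp add: K_def mult_ac)
  qed
  then show ?thesis using K unfolding \<gamma>_def D_def by blast
qed

section \<open>Whitney boxes\<close>

definition whitney_box :: "real \<Rightarrow> 'a::euclidean_space \<Rightarrow> (real \<times> 'a) set" where
  "whitney_box t x = {t / 2<..t} \<times> ball x t"

text \<open>The constant in front of the integral is the reciprocal of the volume of the box (for \<open>t > 0\<close>).\<close>

definition box_norm :: "ennreal \<Rightarrow> (real \<times> 'a::euclidean_space \<Rightarrow> ennreal) \<Rightarrow> real \<times> 'a \<Rightarrow> ennreal" where
  "box_norm r F = (\<lambda>(t, x). if r = \<infinity> then esssup lborel (\<lambda>p. F p * indicator (whitney_box t x) p)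
    else ennreal_pow (ennreal (2 / unit_ball_vol (real DIM('a)) * t powr - (real DIM('a) + 1)) *
      (\<integral>\<^sup>+p. ennreal_pow (F p) (enn2real r) * indicator (whitney_box t x) p \<partial>lborel)) (1 / enn2real r))"

lemma box_norm_finite:
  "r \<noteq> \<infinity> \<Longrightarrow> box_norm r F (t, x::'a::euclidean_space) =
    ennreal_pow (ennreal (2 / unit_ball_vol (real DIM('a)) * t powr - (real DIM('a) + 1)) *
      (\<integral>\<^sup>+p. ennreal_pow (F p) (enn2real r) * indicator (whitney_box t x) p \<partial>lborel)) (1 / enn2real r)"
  by (simp only: box_norm_def case_prod_conv if_False)

lemma sets_whitney_box [measurable, simp]: "whitney_box t (x::'a::euclidean_space) \<in> sets borel"
  unfolding whitney_box_def by (subst borel_prod[symmetric]) (intro pair_measureI; simp)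

lemma emeasure_whitney_box:
  "0 < t \<Longrightarrow> emeasure lborel (whitney_box t (x::'a::euclidean_space))
    = ennreal (unit_ball_vol (real DIM('a)) / 2 * t powr (real DIM('a) + 1))"
proof -
  assume t: "0 < t"
  have "emeasure lborel (whitney_box t x)
      = emeasure (lborel \<Otimes>\<^sub>M lborel) ({t / 2<..t} \<times> ball x t)"
    by (simp add: whitney_box_def lborel_prod)
  also have "\<dots> = emeasure lborel {t / 2<..t} * emeasure lborel (ball x t)"
    by (rule lborel.emeasure_pair_measure_Times) auto
  also have "\<dots> = ennreal (t / 2) * ennreal (unit_ball_vol (real DIM('a)) * t powr real DIM('a))"
    using t by (simp add: emeasure_ball powr_realpow)
  also have "\<dots> = ennreal (unit_ball_vol (real DIM('a)) / 2 * t powr (real DIM('a) + 1))"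
    using t by (simp add: powr_add mult_ac flip: ennreal_mult)
  finally show ?thesis .
qed

lemma measurable_indicator_whitney_box:
  fixes g :: "'b \<Rightarrow> 'a::euclidean_space"
  assumes [measurable]: "f \<in> borel_measurable M" "g \<in> borel_measurable M"
    "h \<in> M \<rightarrow>\<^sub>M borel"
  shows "(\<lambda>p. indicator (whitney_box (f p) (g p)) (h p) :: ennreal) \<in> borel_measurable M"
proof -
  have h[measurable]: "h \<in> M \<rightarrow>\<^sub>M borel \<Otimes>\<^sub>M borel" by (simp add: borel_prod)
  have "(\<lambda>p. if f p / 2 < fst (h p) \<and> fst (h p) \<le> f p \<and> dist (g p) (snd (h p)) < f p then 1 else 0 :: ennreal)
      \<in> borel_measurable M" by measurable
  also have "(\<lambda>p. if f p / 2 < fst (h p) \<and> fst (h p) \<le> f p \<and> dist (g p) (snd (h p)) < f p then 1 else 0 :: ennreal)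
    = (\<lambda>p. indicator (whitney_box (f p) (g p)) (h p))"
    by (auto simp: fun_eq_iff whitney_box_def indicator_def mem_Times_iff)
  finally show ?thesis .
qed

lemma measurable_box_norm:
  fixes F :: "real \<times> 'a::euclidean_space \<Rightarrow> ennreal"
  assumes [measurable]: "F \<in> borel_measurable borel"
  shows "box_norm r F \<in> borel_measurable borel"
proof -
  have [measurable]: "(\<lambda>p. indicator (whitney_box (fst (fst p)) (snd (fst p))) (snd p) :: ennreal)
      \<in> borel_measurable ((borel \<Otimes>\<^sub>M borel) \<Otimes>\<^sub>M (borel :: (real \<times> 'a) measure))"
    by (rule measurable_indicator_whitney_box) measurable
  have "box_norm r F \<in> borel_measurable (borel \<Otimes>\<^sub>M borel)"
    unfolding box_norm_def case_prod_beta' by measurable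
  then show ?thesis by (simp add: borel_prod)
qed

lemma box_norm_mono_cmult:
  fixes F G :: "real \<times> 'a::euclidean_space \<Rightarrow> ennreal"
  assumes [measurable]: "F \<in> borel_measurable borel" "G \<in> borel_measurable borel"
    and r: "0 < r" and le: "\<And>p. p \<in> whitney_box t x \<Longrightarrow> F p \<le> c * G p"
  shows "box_norm r F (t, x) \<le> c * box_norm r G (t, x)"
proof (cases "r = \<infinity>")
  case True
  have "esssup lborel (\<lambda>p. F p * indicator (whitney_box t x) p) \<le> c * esssup lborel (\<lambda>p. G p * indicator (whitney_box t x) p)"
  proof (rule esssup_I)
    show "AE p in lborel. F p * indicator (whitney_box t x) p \<le> c * esssup lborel (\<lambda>p. G p * indicator (whitney_box t x) p)"
      using esssup_AE[of "\<lambda>p. G p * indicator (whitney_box t x) p" lborel]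
    proof eventually_elim
      case (elim p)
      then show ?case
        by (cases "p \<in> whitney_box t x") (auto intro: order_trans[OF le mult_left_mono])
    qed
  qed measurable
  then show ?thesis using True by (simp add: box_norm_def)
next
  case False
  define \<rho> where "\<rho> = enn2real r"
  have \<rho>: "0 < \<rho>" using r False by (simp add: \<rho>_def enn2real_positive_iff less_top)
  define k where "k = ennreal (2 / unit_ball_vol (real DIM('a)) * t powr - (real DIM('a) + 1))"
  have "k * (\<integral>\<^sup>+p. ennreal_pow (F p) \<rho> * indicator (whitney_box t x) p \<partial>lborel)
    \<le> k * (\<integral>\<^sup>+p. ennreal_pow c \<rho> * (ennreal_pow (G p) \<rho> * indicator (whitney_box t x) p) \<partial>lborel)"
  proof (intro mult_left_mono nn_integral_mono)
    fix p
    show "ennreal_pow (F p) \<rho> * indicator (whitney_box t x) p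
      \<le> ennreal_pow c \<rho> * (ennreal_pow (G p) \<rho> * indicator (whitney_box t x) p)"
      using ennreal_pow_mono[of \<rho>, OF _ le[of p]] \<rho>
      by (cases "p \<in> whitney_box t x") (auto simp: ennreal_pow_mult)
  qed simp
  also have "\<dots> = ennreal_pow c \<rho> * (k * (\<integral>\<^sup>+p. ennreal_pow (G p) \<rho> * indicator (whitney_box t x) p \<partial>lborel))"
    by (subst nn_integral_cmult) (auto simp: mult_ac)
  finally have "ennreal_pow (k * (\<integral>\<^sup>+p. ennreal_pow (F p) \<rho> * indicator (whitney_box t x) p \<partial>lborel)) (1 / \<rho>)
    \<le> ennreal_pow \<dots> (1 / \<rho>)" using \<rho> by (intro ennreal_pow_mono) auto
  then show ?thesis
    unfolding box_norm_finite[OF False] \<rho>_def[symmetric] k_def[symmetric]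
    using \<rho> by (simp add: ennreal_pow_pow ennreal_pow_mult)
qed

text \<open>Power means with respect to normalised measure on the box: the constant in
  \<open>box_norm\<close> is 1/v with v the volume, so the powers of v left by Hoelder's inequality
  cancel.\<close>

lemma box_norm_mono_exponent:
  fixes F :: "real \<times> 'a::euclidean_space \<Rightarrow> ennreal"
  assumes [measurable]: "F \<in> borel_measurable borel"
    and r: "0 < r\<^sub>1" "r\<^sub>1 \<le> r\<^sub>0" and t: "0 < t"
  shows "box_norm r\<^sub>1 F (t, x) \<le> box_norm r\<^sub>0 F (t, x)"
proof (cases "r\<^sub>1 = r\<^sub>0")
  case False
  define \<rho>\<^sub>1 where "\<rho>\<^sub>1 = enn2real r\<^sub>1"
  have "r\<^sub>1 < r\<^sub>0" using r False by simp
  then have "r\<^sub>1 < top" by (rule less_le_trans) simp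
  then have r1: "r\<^sub>1 \<noteq> \<infinity>" "r\<^sub>1 < top" by auto
  then have \<rho>1: "0 < \<rho>\<^sub>1" using r by (simp add: \<rho>\<^sub>1_def enn2real_positive_iff)
  define v where "v = unit_ball_vol (real DIM('a)) / 2 * t powr (real DIM('a) + 1)"
  have v: "0 < v" using t by (simp add: v_def)
  have vol: "emeasure lborel (whitney_box t x) = ennreal v"
    using emeasure_whitney_box[OF t, of x] by (simp add: v_def)
  have k: "2 / unit_ball_vol (real DIM('a)) * t powr - (real DIM('a) + 1) = 1 / v"
    using t by (simp add: v_def powr_minus field_simps del: minus_add_distrib)
  define I where "I \<rho> = (\<integral>\<^sup>+p. ennreal_pow (F p) \<rho> * indicator (whitney_box t x) p \<partial>lborel)" for \<rho>
  have N1: "box_norm r\<^sub>1 F (t, x) = ennreal_pow (ennreal (1 / v) * I \<rho>\<^sub>1) (1 / \<rho>\<^sub>1)"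
    by (simp only: box_norm_finite[OF r1(1)] k I_def \<rho>\<^sub>1_def)
  show ?thesis
  proof (cases "r\<^sub>0 = \<infinity>")
    case True
    define S where "S = box_norm r\<^sub>0 F (t, x)"
    have S: "S = esssup lborel (\<lambda>p. F p * indicator (whitney_box t x) p)"
      using True by (simp add: S_def box_norm_def)
    have "I \<rho>\<^sub>1 \<le> (\<integral>\<^sup>+p. ennreal_pow S \<rho>\<^sub>1 * indicator (whitney_box t x) p \<partial>lborel)"
      unfolding I_def
    proof (rule nn_integral_mono_AE)
      show "AE p in lborel. ennreal_pow (F p) \<rho>\<^sub>1 * indicator (whitney_box t x) p
          \<le> ennreal_pow S \<rho>\<^sub>1 * indicator (whitney_box t x) p"
        using esssup_AE[of "\<lambda>p. F p * indicator (whitney_box t x) p" lborel]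
      proof eventually_elim
        case (elim p)
        then show ?case unfolding S using \<rho>1
          by (cases "p \<in> whitney_box t x") (auto intro: ennreal_pow_mono)
      qed
    qed
    also have "\<dots> = ennreal_pow S \<rho>\<^sub>1 * ennreal v"
      by (simp add: nn_integral_cmult_indicator vol)
    finally have "ennreal (1 / v) * I \<rho>\<^sub>1 \<le> ennreal (1 / v) * \<dots>" by (rule mult_left_mono) simp
    also have "\<dots> = ennreal (1 / v * v) * ennreal_pow S \<rho>\<^sub>1"
      using v by (subst ennreal_mult) (auto simp: mult_ac)
    also have "\<dots> = ennreal_pow S \<rho>\<^sub>1" using v by simp
    finally show ?thesis using \<rho>1 by (simp add: N1 S_def le_ennreal_pow_swap)
  next
    case fin: False
    define \<rho>\<^sub>0 where "\<rho>\<^sub>0 = enn2real r\<^sub>0"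
    have \<rho>: "\<rho>\<^sub>1 < \<rho>\<^sub>0" using r False fin r1
      by (cases r\<^sub>0; cases r\<^sub>1) (auto simp: \<rho>\<^sub>1_def \<rho>\<^sub>0_def)
    have N0: "box_norm r\<^sub>0 F (t, x) = ennreal_pow (ennreal (1 / v) * I \<rho>\<^sub>0) (1 / \<rho>\<^sub>0)"
      by (simp only: box_norm_finite[OF fin] k I_def \<rho>\<^sub>0_def)
    have "I \<rho>\<^sub>1 \<le> ennreal_pow (I \<rho>\<^sub>0) (\<rho>\<^sub>1 / \<rho>\<^sub>0) * ennreal_pow (ennreal v) (1 - \<rho>\<^sub>1 / \<rho>\<^sub>0)"
      unfolding I_def vol[symmetric] by (rule power_mean_nn_integral) (use \<rho> \<rho>1 in auto)
    then have "ennreal (1 / v) * I \<rho>\<^sub>1 \<le> ennreal (1 / v) * \<dots>" by (rule mult_left_mono) simp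
    also have "\<dots> = ennreal_pow (I \<rho>\<^sub>0) (\<rho>\<^sub>1 / \<rho>\<^sub>0) * ennreal (1 / v * v powr (1 - \<rho>\<^sub>1 / \<rho>\<^sub>0))"
      using v by (subst ennreal_mult) (auto simp: ennreal_pow_ennreal mult_ac)
    also have "1 / v * v powr (1 - \<rho>\<^sub>1 / \<rho>\<^sub>0) = (1 / v) powr (\<rho>\<^sub>1 / \<rho>\<^sub>0)"
      using v by (simp add: powr_diff powr_divide)
    also have "ennreal_pow (I \<rho>\<^sub>0) (\<rho>\<^sub>1 / \<rho>\<^sub>0) * ennreal ((1 / v) powr (\<rho>\<^sub>1 / \<rho>\<^sub>0))
      = ennreal_pow (ennreal (1 / v) * I \<rho>\<^sub>0) (\<rho>\<^sub>1 / \<rho>\<^sub>0)"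
      using v by (simp add: ennreal_pow_mult ennreal_pow_ennreal mult.commute)
    also have "\<dots> = ennreal_pow (box_norm r\<^sub>0 F (t, x)) \<rho>\<^sub>1"
      by (simp add: N0 ennreal_pow_pow)
    finally show ?thesis using \<rho>1 by (simp add: N1 le_ennreal_pow_swap)
  qed
qed simp

text \<open>The index (j, v) involves neither t nor x, so one finite family serves all boxes: j =
  3/4 and j = 1 select the lower and upper half of the interval (t/2, t], and v runs through a
  1/4-net of the unit ball.\<close>

definition box_piece :: "real \<Rightarrow> 'a::euclidean_space \<Rightarrow> real \<times> 'a \<Rightarrow> (real \<times> 'a) set" where
  "box_piece t x = (\<lambda>(j, v). {max (t / 2) ((j - 1 / 4) * t)<..j * t} \<times> ball (x + t *\<^sub>R v) (t / 4))"

lemma sets_box_piece [measurable, simp]: "box_piece t (x::'a::euclidean_space) i \<in> sets borel"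
  unfolding box_piece_def case_prod_beta by (subst borel_prod[symmetric]) (intro pair_measureI; simp)

lemma ex_finite_ball_cover:
  obtains V :: "'a::euclidean_space set" where "finite V" "V \<subseteq> cball 0 1" "cball 0 1 \<subseteq> (\<Union>v\<in>V. ball v (1 / 4))"
proof -
  have "\<forall>e>0. \<exists>V. finite V \<and> V \<subseteq> cball (0::'a) 1 \<and> cball 0 1 \<subseteq> (\<Union>v\<in>V. ball v e)"
    by (intro seq_compact_imp_totally_bounded compact_imp_seq_compact compact_cball)
  from this[rule_format, of "1 / 4"] show thesis using that by auto
qed

lemma whitney_box_subset_pieces:
  assumes t: "0 < t" and V: "cball 0 1 \<subseteq> (\<Union>v\<in>V. ball v (1 / 4))"
  shows "whitney_box t x \<subseteq> (\<Union>i\<in>{3 / 4, 1} \<times> V. box_piece t x i)"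
proof
  fix p assume p: "p \<in> whitney_box t x"
  obtain s y where p_eq: "p = (s, y)" by (cases p)
  have s: "t / 2 < s" "s \<le> t" and y: "dist x y < t" using p by (auto simp: whitney_box_def p_eq)
  define z where "z = (1 / t) *\<^sub>R (y - x)"
  have "norm z \<le> 1" using y t by (simp add: z_def dist_norm norm_minus_commute)
  then obtain v where v: "v \<in> V" "dist v z < 1 / 4" using V by (auto simp: subset_iff)
  have "y = x + t *\<^sub>R z" using t by (simp add: z_def)
  then have "dist (x + t *\<^sub>R v) y = t * dist v z"
    using t by (simp add: dist_norm flip: scaleR_diff_right)
  then have y': "y \<in> ball (x + t *\<^sub>R v) (t / 4)" using v t by simp
  show "p \<in> (\<Union>i\<in>{3 / 4, 1} \<times> V. box_piece t x i)"
  proof (cases "s \<le> 3 / 4 * t")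
    case True
    then have "p \<in> box_piece t x (3 / 4, v)" using s y' by (simp add: box_piece_def p_eq)
    then show ?thesis using v by blast
  next
    case False
    then have "p \<in> box_piece t x (1, v)" using s y' by (simp add: box_piece_def p_eq)
    then show ?thesis using v by blast
  qed
qed

text \<open>The sizes are matched to this inclusion. For j = 3/4 the times of the piece exceed t/2
  while s \<le> t; for j = 1 they exceed 3t/4 while s/2 \<le> 5t/8. They are at most j * t \<le> s,
  and the two radii t/4 add up to t/2 \<le> s.\<close>

lemma box_piece_subset_whitney_box:
  assumes t: "0 < t" and j: "j \<in> {3 / 4, 1}" and s: "s \<in> {j * t..j * t + t / 4}"
    and y: "y \<in> ball (x + t *\<^sub>R v) (t / 4)"
  shows "box_piece t x (j, v) \<subseteq> whitney_box s y"
proof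
  fix p assume "p \<in> box_piece t x (j, v)"
  then obtain s' y' where p: "p = (s', y')" "max (t / 2) ((j - 1 / 4) * t) < s'" "s' \<le> j * t"
    "dist (x + t *\<^sub>R v) y' < t / 4"
    by (auto simp: box_piece_def)
  have "dist y y' < t / 4 + t / 4"
    using dist_triangle_less_add[of y "x + t *\<^sub>R v" "t / 4" y' "t / 4"] y p by (simp add: dist_commute)
  moreover have "j = 3 / 4 \<or> j = 1" using j by simp
  then have "t / 2 \<le> s" "s / 2 < s'" using s t p by (elim disjE; simp)+
  moreover have "s' \<le> s" using s p by auto
  ultimately show "p \<in> whitney_box s y" by (simp add: whitney_box_def p)
qed

text \<open>
  Of the finitely many pieces covering the box at \<open>(t, x)\<close>, the one on which \<open>F\<close> is largest carries a
  fixed portion of the norm, and it lies in the box at every \<open>(s, y)\<close> of the region in question.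
\<close>

proposition locally_dominated_box_norm:
  assumes r: "0 < r"
  shows "\<exists>C<top. \<forall>F \<in> borel_measurable (borel :: (real \<times> 'a::euclidean_space) measure).
    locally_dominated C (box_norm r F)"
proof -
  obtain V :: "'a set" where V: "finite V" "V \<subseteq> cball 0 1" "cball 0 1 \<subseteq> (\<Union>v\<in>V. ball v (1 / 4))"
    using ex_finite_ball_cover .
  define I where "I = {3 / 4, 1::real} \<times> V"
  have "V \<noteq> {}" using V(3) by auto
  then have I: "finite I" "I \<noteq> {}" using V by (auto simp: I_def)
  define D where "D = real DIM('a)"
  define \<rho> where "\<rho> = enn2real r"
  \<comment> \<open>The cardinality is the loss in keeping only the largest piece, and 2^(d+1)
    compares the normalising factors at t and s for s \<le> 2t. For essential suprema neither loss
    occurs.\<close>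
  define C where "C = (if r = \<infinity> then 1 else ennreal_pow (of_nat (card I) * ennreal (2 powr (D + 1))) (1 / \<rho>))"
  have C: "C < top" by (simp add: C_def ennreal_mult_less_top of_nat_less_top)
  \<comment> \<open>The piece is chosen before (s, y): it depends on F, t and x alone, so a single
    region can be read off from it.\<close>
  have "\<exists>i\<in>I. \<forall>s y. whitney_box s y \<supseteq> box_piece t x i \<longrightarrow> s \<le> 2 * t \<longrightarrow> 0 < s \<longrightarrow>
      box_norm r F (t, x) \<le> C * box_norm r F (s, y)"
    if [measurable]: "F \<in> borel_measurable (borel :: (real \<times> 'a) measure)" and t: "0 < t" for F t x
  proof -
    have cover: "whitney_box t x \<subseteq> (\<Union>i\<in>I. box_piece t x i)"
      unfolding I_def by (rule whitney_box_subset_pieces[OF t V(3)])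
    show ?thesis
    proof (cases "r = \<infinity>")
      case True
      define Q where "Q i = esssup lborel (\<lambda>p. F p * indicator (box_piece t x i) p)" for i
      obtain i where i: "i \<in> I" "\<And>k. k \<in> I \<Longrightarrow> Q k \<le> Q i"
        using Max_in[of "Q ` I"] Max_ge[of "Q ` I"] I by fastforce
      have "box_norm r F (t, x) \<le> Q i"
      proof -
        have "AE p in lborel. \<forall>k\<in>I. F p * indicator (box_piece t x k) p \<le> Q k"
          using esssup_AE I(1) by (intro AE_finite_allI) (auto simp: Q_def)
        then have "AE p in lborel. F p * indicator (whitney_box t x) p \<le> Q i"
        proof eventually_elim
          case (elim p)
          show ?case
          proof (cases "p \<in> whitney_box t x")
            case True
            then obtain k where k: "k \<in> I" "p \<in> box_piece t x k" using cover by blast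
            then have "F p \<le> Q k" using elim by fastforce
            also have "\<dots> \<le> Q i" using i k by simp
            finally show ?thesis using True by simp
          qed simp
        qed
        then show ?thesis using True by (auto simp: box_norm_def intro!: esssup_I)
      qed
      moreover have "Q i \<le> box_norm r F (s, y)" if "box_piece t x i \<subseteq> whitney_box s y" for s y
      proof -
        have "Q i \<le> esssup lborel (\<lambda>p. F p * indicator (whitney_box s y) p)"
          unfolding Q_def using that by (intro esssup_mono mult_left_mono) (auto split: split_indicator)
        then show ?thesis using True by (simp add: box_norm_def)
      qed
      ultimately show ?thesis using i True by (intro bexI[of _ i]) (auto simp: C_def intro: order_trans)
    next
      case False
      have \<rho>: "0 < \<rho>" using r False by (simp add: \<rho>_def enn2real_positive_iff less_top)
      define k where "k u = ennreal (2 / unit_ball_vol D * u powr - (D + 1))" for u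
      define J where "J u z = (\<integral>\<^sup>+p. ennreal_pow (F p) \<rho> * indicator (whitney_box u z) p \<partial>lborel)" for u z
      have N: "box_norm r F (u, z) = ennreal_pow (k u * J u z) (1 / \<rho>)" for u z
        by (simp only: box_norm_finite[OF False] k_def J_def D_def \<rho>_def)
      define Q where "Q i = (\<integral>\<^sup>+p. ennreal_pow (F p) \<rho> * indicator (box_piece t x i) p \<partial>lborel)" for i
      obtain i where i: "i \<in> I" "\<And>k. k \<in> I \<Longrightarrow> Q k \<le> Q i"
        using Max_in[of "Q ` I"] Max_ge[of "Q ` I"] I by fastforce
      have "J t x \<le> (\<integral>\<^sup>+p. (\<Sum>i\<in>I. ennreal_pow (F p) \<rho> * indicator (box_piece t x i) p) \<partial>lborel)"
        unfolding J_def
      proof (rule nn_integral_mono)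
        fix p
        show "ennreal_pow (F p) \<rho> * indicator (whitney_box t x) p
          \<le> (\<Sum>i\<in>I. ennreal_pow (F p) \<rho> * indicator (box_piece t x i) p)"
        proof (cases "p \<in> whitney_box t x")
          case True
          then obtain k where k: "k \<in> I" "p \<in> box_piece t x k" using cover by blast
          then show ?thesis
            using member_le_sum[of k I "\<lambda>i. ennreal_pow (F p) \<rho> * indicator (box_piece t x i) p"] I True by simp
        qed simp
      qed
      also have "\<dots> = (\<Sum>i\<in>I. Q i)"
        unfolding Q_def by (rule nn_integral_sum) measurable
      also have "\<dots> \<le> of_nat (card I) * Q i"
        using sum_bounded_above[of I Q "Q i"] i by simp
      finally have J: "J t x \<le> of_nat (card I) * Q i" .
      have "box_norm r F (t, x) \<le> C * box_norm r F (s, y)"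
        if sub: "box_piece t x i \<subseteq> whitney_box s y" and s: "s \<le> 2 * t" "0 < s" for s y
      proof -
        have "Q i \<le> J s y" unfolding Q_def J_def
          using sub by (intro nn_integral_mono mult_left_mono) (auto split: split_indicator)
        with J have J': "J t x \<le> of_nat (card I) * J s y"
          by (meson mult_left_mono order_trans zero_le)
        have "(2 * t) powr - (D + 1) \<le> s powr - (D + 1)"
          using s by (intro powr_mono2') (auto simp: D_def)
        then have "t powr - (D + 1) \<le> 2 powr (D + 1) * s powr - (D + 1)"
          using t by (simp add: powr_mult powr_minus field_simps del: minus_add_distrib)
        then have "2 / unit_ball_vol D * t powr - (D + 1)
            \<le> 2 / unit_ball_vol D * (2 powr (D + 1) * s powr - (D + 1))"
          by (intro mult_left_mono) (auto simp: D_def)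
        then have "k t \<le> ennreal (2 powr (D + 1)) * k s"
          unfolding k_def by (subst ennreal_mult[symmetric]) (auto simp: D_def mult_ac intro!: ennreal_leI)
        then have "k t * J t x \<le> (ennreal (2 powr (D + 1)) * k s) * (of_nat (card I) * J s y)"
          by (intro mult_mono J') auto
        also have "\<dots> = (of_nat (card I) * ennreal (2 powr (D + 1))) * (k s * J s y)"
          by (simp only: mult_ac)
        finally have "ennreal_pow (k t * J t x) (1 / \<rho>) \<le> ennreal_pow \<dots> (1 / \<rho>)"
          using \<rho> by (intro ennreal_pow_mono) auto
        then show ?thesis using False by (simp add: N C_def ennreal_pow_mult)
      qed
      then show ?thesis using i by (intro bexI[of _ i]) auto
    qed
  qed
  note dom = this
  have "locally_dominated C (box_norm r F)"
    if F: "F \<in> borel_measurable (borel :: (real \<times> 'a) measure)" for F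
    unfolding locally_dominated_def
  proof (intro allI impI)
    fix t :: real and x :: 'a assume t: "0 < t"
    obtain i where i: "i \<in> I" and le: "\<And>s y. box_piece t x i \<subseteq> whitney_box s y \<Longrightarrow> s \<le> 2 * t \<Longrightarrow> 0 < s \<Longrightarrow>
      box_norm r F (t, x) \<le> C * box_norm r F (s, y)"
      using dom[OF F t, of x] by blast
    obtain j v where jv: "i = (j, v)" "j \<in> {3 / 4, 1}" "v \<in> V" using i unfolding I_def by blast
    have "norm v \<le> 1" using V(2) jv by auto
    then have "x + t *\<^sub>R v \<in> cball x t" using t by (simp add: dist_norm mult_left_le)
    moreover have "j * t \<in> {3 * t / 4, t}" using jv by auto
    moreover have "box_norm r F (t, x) \<le> C * box_norm r F (s, y)"
      if s: "s \<in> {j * t..j * t + t / 4}" and y: "y \<in> ball (x + t *\<^sub>R v) (t / 4)" for s y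
    proof (rule le)
      show "box_piece t x i \<subseteq> whitney_box s y"
        unfolding jv(1) by (rule box_piece_subset_whitney_box[OF t jv(2) s y])
      have "j = 3 / 4 \<or> j = 1" using jv(2) by simp
      then show "s \<le> 2 * t" "0 < s" using s t by (elim disjE; simp)+
    qed
    ultimately show "\<exists>a\<in>{3 * t / 4, t}. \<exists>z\<in>cball x t. \<forall>s\<in>{a..a + t / 4}. \<forall>y\<in>ball z (t / 4).
      box_norm r F (t, x) \<le> C * box_norm r F (s, y)" by blast
  qed
  then show ?thesis using C by blast
qed

section \<open>Reduction to Borel functions\<close>

lemma upper_half_sets [simp]: "upper_half_space \<in> sets (borel :: (real \<times> 'a::euclidean_space) measure)"
  unfolding upper_half_space_def by (subst borel_prod[symmetric]) (intro pair_measureI; simp)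

text \<open>The norms depend only on the modulus of f, and a Lebesgue measurable function agrees
  with a Borel function off a null set. After this replacement all product measurability takes place
  in Borel spaces.\<close>

lemma ex_borel_modulus:
  fixes f :: "real \<times> 'a::euclidean_space \<Rightarrow> complex"
  assumes f: "f \<in> borel_measurable (lebesgue_on upper_half_space)"
  obtains F :: "real \<times> 'a \<Rightarrow> ennreal" where "F \<in> borel_measurable borel"
    "AE p in lborel. 0 < fst p \<longrightarrow> ennreal (norm (f p)) = F p"
proof -
  note U = upper_half_sets[where 'a = 'a]
  have "(\<lambda>p. ennreal (norm (f p))) \<in> borel_measurable (lebesgue_on upper_half_space)"
    using f by measurable
  then have "(\<lambda>p. if p \<in> upper_half_space then ennreal (norm (f p)) else 0) \<in> borel_measurable lebesgue"
    using U by (subst (asm) measurable_restrict_space_iff[where c = 0]) auto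
  then obtain F :: "real \<times> 'a \<Rightarrow> ennreal" where F: "F \<in> borel_measurable lborel"
    "AE p in lborel. (if p \<in> upper_half_space then ennreal (norm (f p)) else 0) = F p"
    using completion_ex_borel_measurable by blast
  show thesis
  proof (rule that)
    show "F \<in> borel_measurable borel" using F by simp
    show "AE p in lborel. 0 < fst p \<longrightarrow> ennreal (norm (f p)) = F p"
      using F(2) by eventually_elim (auto simp: upper_half_space_def mem_Times_iff)
  qed
qed

definition weighted :: "real \<Rightarrow> (real \<times> 'a \<Rightarrow> ennreal) \<Rightarrow> real \<times> 'a \<Rightarrow> ennreal" where
  "weighted \<beta> F p = ennreal (fst p powr - \<beta>) * F p"

lemma measurable_weighted [measurable]:
  fixes F :: "real \<times> 'a::euclidean_space \<Rightarrow> ennreal"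
  assumes [measurable]: "F \<in> borel_measurable borel"
  shows "weighted \<beta> F \<in> borel_measurable borel"
proof -
  have [measurable]: "F \<in> borel_measurable (borel \<Otimes>\<^sub>M borel)" using assms by (simp add: borel_prod)
  have "weighted \<beta> F \<in> borel_measurable (borel \<Otimes>\<^sub>M borel)"
    unfolding weighted_def by measurable
  then show ?thesis by (simp add: borel_prod)
qed

text \<open>Changing f on a null set does not affect an essential supremum or an iterated integral,
  as almost every section changes on a null set only. The equality therefore holds at every x and
  every t > 0, and the iterated mean over the Borel representative becomes one integral by Tonelli's
  theorem.\<close>

lemma whitney_avg_eq_box_norm:
  fixes f :: "real \<times> 'a::euclidean_space \<Rightarrow> complex"
  assumes f: "f \<in> borel_measurable (lebesgue_on upper_half_space)"
    and F[measurable]: "F \<in> borel_measurable borel"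
    and eq: "AE p in lborel. 0 < fst p \<longrightarrow> ennreal (norm (f p)) = F p"
    and t: "0 < t"
  shows "whitney_avg r \<beta> f t x = box_norm r (weighted \<beta> F) (t, x)"
proof -
  define g where "g p = ennreal (norm (fst p powr - \<beta> *\<^sub>R f p))" for p
  have g: "AE p in lborel. 0 < fst p \<longrightarrow> g p = weighted \<beta> F p"
    using eq by eventually_elim (simp add: g_def weighted_def ennreal_mult)
  have gm: "g \<in> borel_measurable (lebesgue_on upper_half_space)"
  proof -
    have "(\<lambda>p::real \<times> 'a. fst p powr - \<beta>) \<in> borel_measurable (borel \<Otimes>\<^sub>M borel)" by measurable
    then have "(\<lambda>p::real \<times> 'a. fst p powr - \<beta>) \<in> borel_measurable lborel" by (simp add: borel_prod)
    then have [measurable]: "(\<lambda>p::real \<times> 'a. fst p powr - \<beta>) \<in> borel_measurable (lebesgue_on upper_half_space)"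
      by (intro measurable_restrict_space1 measurable_completion)
    show ?thesis unfolding g_def using f by measurable
  qed
  have box_pos: "p \<in> whitney_box t x \<Longrightarrow> 0 < fst p" for p
    using t by (auto simp: whitney_box_def)
  show ?thesis
  proof (cases "r = \<infinity>")
    case True
    have sub: "whitney_box t x \<subseteq> upper_half_space"
      using box_pos by (auto simp: upper_half_space_def mem_Times_iff)
    have "restrict_space (lebesgue_on upper_half_space) (whitney_box t x) = lebesgue_on (whitney_box t x)"
      using sub by (subst restrict_restrict_space) (auto simp: Int_absorb1 upper_half_sets)
    then have gm': "g \<in> borel_measurable (lebesgue_on (whitney_box t x))"
      using measurable_restrict_space1[OF gm, of "whitney_box t x"] by simp
    \<comment> \<open>Inside the box time is positive, so g and the weighted F agree almost
      everywhere there; outside the product is 0, which is below every c in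
      \<open>ennreal\<close>.\<close>
    have AE_iff: "(AE p in lborel. p \<in> whitney_box t x \<longrightarrow> g p \<le> c)
      \<longleftrightarrow> (AE p in lborel. weighted \<beta> F p * indicator (whitney_box t x) p \<le> c)" (is "?L \<longleftrightarrow> ?R") for c
    proof
      assume ?L
      then show ?R using g
        by eventually_elim (use box_pos in \<open>auto split: split_indicator\<close>)
    next
      assume ?R
      then show ?L using g
        by eventually_elim (use box_pos in \<open>auto split: split_indicator\<close>)
    qed
    have "esssup (lebesgue_on (whitney_box t x)) g \<le> c \<longleftrightarrow>
      esssup lborel (\<lambda>p. weighted \<beta> F p * indicator (whitney_box t x) p) \<le> c" for c
    proof -
      have "esssup (lebesgue_on (whitney_box t x)) g \<le> c \<longleftrightarrow> (AE p in lebesgue_on (whitney_box t x). g p \<le> c)"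
        by (rule esssup_le_iff[OF gm'])
      also have "\<dots> \<longleftrightarrow> (AE p in lborel. p \<in> whitney_box t x \<longrightarrow> g p \<le> c)"
        by (subst AE_restrict_space_iff) (auto simp: AE_completion_iff)
      also have "\<dots> \<longleftrightarrow> (AE p in lborel. weighted \<beta> F p * indicator (whitney_box t x) p \<le> c)"
        by (rule AE_iff)
      also have "\<dots> \<longleftrightarrow> esssup lborel (\<lambda>p. weighted \<beta> F p * indicator (whitney_box t x) p) \<le> c"
        by (rule esssup_le_iff[symmetric]) measurable
      finally show ?thesis .
    qed
    then have "esssup (lebesgue_on (whitney_box t x)) g
        = esssup lborel (\<lambda>p. weighted \<beta> F p * indicator (whitney_box t x) p)"
      by (meson antisym order_refl)
    show ?thesis
    proof -
      have "(\<lambda>(s, y). ennreal (norm (s powr - \<beta> *\<^sub>R f (s, y)))) = g"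
        by (auto simp: g_def fun_eq_iff)
      then show ?thesis
        using \<open>esssup (lebesgue_on (whitney_box t x)) g = _\<close> True
        by (simp only: whitney_avg_def box_norm_def whitney_box_def if_True case_prod_conv simp_thms)
    qed
  next
    case False
    define \<rho> where "\<rho> = enn2real r"
    define G where "G p = ennreal_pow (weighted \<beta> F p) \<rho>" for p
    have G[measurable]: "G \<in> borel_measurable borel" unfolding G_def by measurable
    have G'[measurable]: "G \<in> borel_measurable (borel \<Otimes>\<^sub>M borel)" using G by (simp add: borel_prod)
    have "AE p in lborel \<Otimes>\<^sub>M lborel. 0 < fst p \<longrightarrow> ennreal_pow (g p) \<rho> = G p"
      unfolding lborel_prod using g by eventually_elim (simp add: G_def)
    \<comment> \<open>Sections of f itself need not be measurable for every s, so the replacement by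
      G is made on almost every section.\<close>
    then have sections: "AE s in lborel. AE y in lborel. 0 < s \<longrightarrow> ennreal_pow (g (s, y)) \<rho> = G (s, y)"
      using lborel_pair.AE_pair by fastforce
    define b where "b = unit_ball_vol (real DIM('a)) * t powr real DIM('a)"
    have b: "0 < b" using t by (simp add: b_def)
    have vol: "emeasure lborel (ball x t) = ennreal b"
      using t by (simp add: emeasure_ball b_def powr_realpow)
    have GI: "(\<lambda>p. G p * indicator (whitney_box t x) p) \<in> borel_measurable (lborel \<Otimes>\<^sub>M lborel)"
      by (simp add: lborel_prod)
    define J where "J = (\<integral>\<^sup>+p. G p * indicator (whitney_box t x) p \<partial>lborel)"
    have "mean_value {t / 2<..t} (\<lambda>s. mean_value (ball x t) (\<lambda>y. ennreal_pow (g (s, y)) \<rho>))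
      = (\<integral>\<^sup>+s. (\<integral>\<^sup>+y. ennreal_pow (g (s, y)) \<rho> * indicator (ball x t) y \<partial>lborel) / ennreal b
          * indicator {t / 2<..t} s \<partial>lborel) / ennreal (t / 2)"
      using t by (simp add: mean_value_def nn_integral_completion vol)
    also have "(\<integral>\<^sup>+s. (\<integral>\<^sup>+y. ennreal_pow (g (s, y)) \<rho> * indicator (ball x t) y \<partial>lborel) / ennreal b
          * indicator {t / 2<..t} s \<partial>lborel)
      = (\<integral>\<^sup>+s. (\<integral>\<^sup>+y. G (s, y) * indicator (whitney_box t x) (s, y) \<partial>lborel) / ennreal b \<partial>lborel)"
    proof (rule nn_integral_cong_AE, use sections in eventually_elim)
      fix s assume AE: "AE y in lborel. 0 < s \<longrightarrow> ennreal_pow (g (s, y)) \<rho> = G (s, y)"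
      show "(\<integral>\<^sup>+y. ennreal_pow (g (s, y)) \<rho> * indicator (ball x t) y \<partial>lborel) / ennreal b
          * indicator {t / 2<..t} s
        = (\<integral>\<^sup>+y. G (s, y) * indicator (whitney_box t x) (s, y) \<partial>lborel) / ennreal b"
      proof (cases "s \<in> {t / 2<..t}")
        case True
        then have "0 < s" using t by auto
        have "(\<integral>\<^sup>+y. ennreal_pow (g (s, y)) \<rho> * indicator (ball x t) y \<partial>lborel)
          = (\<integral>\<^sup>+y. G (s, y) * indicator (whitney_box t x) (s, y) \<partial>lborel)"
        proof (rule nn_integral_cong_AE, use AE in eventually_elim)
          fix y assume "0 < s \<longrightarrow> ennreal_pow (g (s, y)) \<rho> = G (s, y)"
          then show "ennreal_pow (g (s, y)) \<rho> * indicator (ball x t) y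
            = G (s, y) * indicator (whitney_box t x) (s, y)"
            using True \<open>0 < s\<close> by (auto simp: whitney_box_def split: split_indicator)
        qed
        then show ?thesis using True by simp
      next
        case False
        then have "G (s, y) * indicator (whitney_box t x) (s, y) = 0" for y
          by (auto simp: whitney_box_def split: split_indicator)
        then have "(\<integral>\<^sup>+y. G (s, y) * indicator (whitney_box t x) (s, y) \<partial>lborel) = 0"
          by (simp only: nn_integral_0_iff_AE nn_integral_const) simp
        then show ?thesis using False by (simp only:) simp
      qed
    qed
    also have "\<dots> = (\<integral>\<^sup>+s. \<integral>\<^sup>+y. G (s, y) * indicator (whitney_box t x) (s, y) \<partial>lborel \<partial>lborel) / ennreal b"
      by (rule nn_integral_divide) (rule lborel.borel_measurable_nn_integral_fst[OF GI])
    also have "(\<integral>\<^sup>+s. \<integral>\<^sup>+y. G (s, y) * indicator (whitney_box t x) (s, y) \<partial>lborel \<partial>lborel) = J"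
      using lborel.nn_integral_fst[OF GI] by (simp add: J_def lborel_prod)
    also have "J / ennreal b / ennreal (t / 2) = ennreal (2 / unit_ball_vol (real DIM('a)) * t powr - (real DIM('a) + 1)) * J"
    proof -
      have "J / ennreal b / ennreal (t / 2) = J * ennreal (1 / b * (1 / (t / 2)))"
        using b t by (subst ennreal_mult) (simp_all add: divide_ennreal_def inverse_ennreal mult.assoc inverse_eq_divide)
      also have "1 / b * (1 / (t / 2)) = 2 / unit_ball_vol (real DIM('a)) * t powr - (real DIM('a) + 1)"
      proof -
        have "t powr - (real DIM('a) + 1) = 1 / (t powr real DIM('a) * t)"
          using t by (simp only: powr_minus powr_add powr_one inverse_eq_divide)
        then show ?thesis using t by (simp add: b_def del: minus_add_distrib)
      qed
      finally show ?thesis by (simp only: mult.commute)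
    qed
    finally show ?thesis
      using False
      by (simp only: whitney_avg_def box_norm_finite[OF False] if_False J_def G_def \<rho>_def g_def fst_conv)
  qed
qed

section \<open>Passage between Lebesgue and Borel versions of the measures dx and dt/t\<close>

lemma measurable_lebesgue_on:
  "g \<in> borel_measurable borel \<Longrightarrow> g \<in> borel_measurable (lebesgue_on A)"
  by (intro measurable_restrict_space1 measurable_completion) simp

lemma Lp_norm_lebesgue:
  "g \<in> borel_measurable borel \<Longrightarrow> Lp_norm lebesgue p g = Lp_norm lborel p g"
proof -
  assume g[measurable]: "g \<in> borel_measurable borel"
  have "esssup lebesgue g \<le> c \<longleftrightarrow> esssup lborel g \<le> c" for c
    by (subst (1 2) esssup_le_iff) (auto simp: AE_completion_iff intro!: measurable_completion)
  then have "esssup lebesgue g = esssup lborel g" by (meson antisym order_refl)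
  then show ?thesis by (simp add: Lp_norm_def nn_integral_completion)
qed

lemma AE_dt_over_t_iff: "(AE t in dt_over_t. P t) \<longleftrightarrow> (AE t in lborel. 0 < t \<longrightarrow> P t)"
proof -
  have "(AE t in dt_over_t. P t) \<longleftrightarrow> (AE t in lebesgue_on {0<..}. P t)"
  proof -
    have "(AE t in dt_over_t. P t) \<longleftrightarrow> (AE t in lebesgue_on {0<..}. 0 < ennreal (1 / t) \<longrightarrow> P t)"
      unfolding dt_over_t_def by (rule AE_density) (intro measurable_lebesgue_on; measurable)
    also have "\<dots> \<longleftrightarrow> (AE t in lebesgue_on {0<..}. P t)"
      by (rule AE_cong) simp
    finally show ?thesis .
  qed
  also have "\<dots> \<longleftrightarrow> (AE t in lborel. 0 < t \<longrightarrow> P t)"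
    by (subst AE_restrict_space_iff) (auto simp: AE_completion_iff)
  finally show ?thesis .
qed

lemma AE_haar_iff: "(AE t in haar. P t) \<longleftrightarrow> (AE t in lborel. 0 < t \<longrightarrow> P t)"
  unfolding haar_def by (subst AE_density) (auto intro!: AE_cong)

lemma measurable_dt_over_t: "g \<in> borel_measurable borel \<Longrightarrow> g \<in> borel_measurable dt_over_t"
  unfolding dt_over_t_def by (simp add: measurable_lebesgue_on)

lemma nn_integral_dt_over_t:
  assumes [measurable]: "g \<in> borel_measurable borel"
  shows "(\<integral>\<^sup>+t. g t \<partial>dt_over_t) = (\<integral>\<^sup>+t. g t \<partial>haar)"
proof -
  have "g \<in> borel_measurable (lebesgue_on {0<..})"
    by (rule measurable_lebesgue_on) measurable
  then have "(\<integral>\<^sup>+t. g t \<partial>dt_over_t) = (\<integral>\<^sup>+t. ennreal (1 / t) * g t \<partial>lebesgue_on {0<..})"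
    unfolding dt_over_t_def by (intro nn_integral_density) (auto intro!: measurable_lebesgue_on)
  also have "\<dots> = (\<integral>\<^sup>+t. ennreal (1 / t) * g t * indicator {0<..} t \<partial>lborel)"
    by (subst nn_integral_restrict_space) (auto simp: nn_integral_completion)
  also have "\<dots> = (\<integral>\<^sup>+t. g t \<partial>haar)"
    by (auto simp: nn_integral_haar intro!: nn_integral_cong split: split_indicator)
  finally show ?thesis .
qed

lemma nn_integral_dt_over_t_mono:
  "(\<And>t. 0 < t \<Longrightarrow> f t \<le> g t) \<Longrightarrow> (\<integral>\<^sup>+t. f t \<partial>dt_over_t) \<le> (\<integral>\<^sup>+t. g t \<partial>dt_over_t)"
  by (rule nn_integral_mono_AE) (auto simp: AE_dt_over_t_iff)

lemma Lp_norm_dt_over_t: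
  assumes g[measurable]: "g \<in> borel_measurable borel" and eq: "\<And>t. 0 < t \<Longrightarrow> f t = g t"
  shows "Lp_norm dt_over_t q f = Lp_norm haar q g"
proof (cases "q = \<infinity>")
  case True
  \<comment> \<open>The essential supremum of a nonmeasurable function is top by convention, so
    measurability has to be transferred from g, with which f agrees on positive times.\<close>
  have "f \<in> borel_measurable dt_over_t \<longleftrightarrow> g \<in> borel_measurable dt_over_t"
    by (rule measurable_cong) (simp add: dt_over_t_def eq)
  then have f: "f \<in> borel_measurable dt_over_t" using measurable_dt_over_t[OF g] by simp
  have "esssup dt_over_t f \<le> c \<longleftrightarrow> esssup haar g \<le> c" for c
    using eq by (subst (1 2) esssup_le_iff) (auto simp: f AE_dt_over_t_iff AE_haar_iff intro!: AE_cong)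
  then have "esssup dt_over_t f = esssup haar g" by (meson antisym order_refl)
  then show ?thesis using True by (simp add: Lp_norm_def)
next
  case False
  have "(\<integral>\<^sup>+t. ennreal_pow (f t) (enn2real q) \<partial>dt_over_t) = (\<integral>\<^sup>+t. ennreal_pow (g t) (enn2real q) \<partial>dt_over_t)"
    using eq by (intro nn_integral_cong_AE) (auto simp: AE_dt_over_t_iff)
  also have "\<dots> = (\<integral>\<^sup>+t. ennreal_pow (g t) (enn2real q) \<partial>haar)"
    by (rule nn_integral_dt_over_t) measurable
  finally show ?thesis using False by (simp add: Lp_norm_def)
qed

lemma Lp_norm_haar_mono:
  assumes "f \<in> borel_measurable borel" "\<And>t. 0 < t \<Longrightarrow> f t \<le> g t"
  shows "Lp_norm haar q f \<le> Lp_norm haar q g"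
proof (cases "q = \<infinity>")
  case True
  have "esssup haar f \<le> esssup haar g"
    using assms AE_haar_pos by (intro esssup_AE_mono) (auto elim: eventually_mono)
  then show ?thesis using True by (simp add: Lp_norm_def)
next
  case False
  then show ?thesis using assms
    by (auto simp: Lp_norm_def intro!: ennreal_pow_mono nn_integral_haar_mono)
qed

lemma box_norm_weighted_le:
  fixes F :: "real \<times> 'a::euclidean_space \<Rightarrow> ennreal"
  assumes F[measurable]: "F \<in> borel_measurable borel"
    and r: "0 < r\<^sub>1" "r\<^sub>1 \<le> r\<^sub>0" and \<gamma>: "0 \<le> \<beta>\<^sub>0 - \<beta>\<^sub>1" and t: "0 < t"
  shows "box_norm r\<^sub>1 (weighted \<beta>\<^sub>1 F) (t, x)
    \<le> ennreal (t powr (\<beta>\<^sub>0 - \<beta>\<^sub>1)) * box_norm r\<^sub>0 (weighted \<beta>\<^sub>0 F) (t, x)"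
proof -
  have "box_norm r\<^sub>1 (weighted \<beta>\<^sub>1 F) (t, x)
    \<le> ennreal (t powr (\<beta>\<^sub>0 - \<beta>\<^sub>1)) * box_norm r\<^sub>1 (weighted \<beta>\<^sub>0 F) (t, x)"
  proof (rule box_norm_mono_cmult[OF _ _ r(1)])
    fix p assume "p \<in> whitney_box t x"
    then have s: "0 < fst p" "fst p \<le> t" using t by (auto simp: whitney_box_def)
    have "fst p powr - \<beta>\<^sub>1 = fst p powr (\<beta>\<^sub>0 - \<beta>\<^sub>1) * fst p powr - \<beta>\<^sub>0"
      by (simp flip: powr_add)
    also have "\<dots> \<le> t powr (\<beta>\<^sub>0 - \<beta>\<^sub>1) * fst p powr - \<beta>\<^sub>0"
      using s \<gamma> by (intro mult_right_mono powr_mono2) auto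
    finally have "ennreal (fst p powr - \<beta>\<^sub>1) \<le> ennreal (t powr (\<beta>\<^sub>0 - \<beta>\<^sub>1)) * ennreal (fst p powr - \<beta>\<^sub>0)"
      by (simp flip: ennreal_mult)
    from mult_right_mono[OF this, of "F p"]
    show "weighted \<beta>\<^sub>1 F p \<le> ennreal (t powr (\<beta>\<^sub>0 - \<beta>\<^sub>1)) * weighted \<beta>\<^sub>0 F p"
      by (simp add: weighted_def mult.assoc)
  qed measurable
  also have "\<dots> \<le> ennreal (t powr (\<beta>\<^sub>0 - \<beta>\<^sub>1)) * box_norm r\<^sub>0 (weighted \<beta>\<^sub>0 F) (t, x)"
    by (intro mult_left_mono box_norm_mono_exponent r t) measurable
  finally show ?thesis .
qed

section \<open>The embeddings\<close>

text \<open>Link between \<open>Lp_norm\<close> and the encoding by \<theta>. For an infinite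
  exponent it passes from the essential to the true supremum, which is the quantity that the
  estimates above control.\<close>

lemma Lp_norm_pow_le_scaled:
  fixes h w :: "'a::euclidean_space \<Rightarrow> ennreal"
  assumes [measurable]: "h \<in> borel_measurable borel" "w \<in> borel_measurable borel"
    and P: "0 < P" "0 < p" and le: "\<And>x. h x \<le> c * w x"
    and \<theta>: "\<theta> = (if p = \<infinity> then 0 else P / enn2real p)"
  shows "ennreal_pow (Lp_norm lborel p h) P \<le> ennreal_pow c P *
    Lp_pow \<theta> P (\<lambda>x. w x)"
proof (cases "p = \<infinity>")
  case True
  have "esssup lborel h \<le> c * (SUP x. w x)"
    by (rule esssup_I) (auto intro!: AE_I2 order_trans[OF le] mult_left_mono SUP_upper)
  then have "ennreal_pow (esssup lborel h) P \<le> ennreal_pow (c * (SUP x. w x)) P"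
    using P by (intro ennreal_pow_mono) auto
  then show ?thesis using True \<theta> by (simp add: Lp_norm_def ennreal_pow_mult)
next
  case False
  define \<pi> where "\<pi> = enn2real p"
  have \<pi>: "0 < \<pi>" using False P by (simp add: \<pi>_def enn2real_positive_iff less_top)
  have \<theta>': "\<theta> = P / \<pi>" "\<theta> \<noteq> 0" "P / \<theta> = \<pi>" using \<theta> False P \<pi> by (auto simp: \<pi>_def)
  have "(\<integral>\<^sup>+x. ennreal_pow (h x) \<pi> \<partial>lborel) \<le> (\<integral>\<^sup>+x. ennreal_pow c \<pi> * ennreal_pow (w x) \<pi> \<partial>lborel)"
    using \<pi> by (intro nn_integral_mono) (auto simp: ennreal_pow_mult[symmetric] intro!: ennreal_pow_mono le)
  also have "\<dots> = ennreal_pow c \<pi> * (\<integral>\<^sup>+x. ennreal_pow (w x) \<pi> \<partial>lborel)"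
    by (rule nn_integral_cmult) measurable
  finally have "ennreal_pow (\<integral>\<^sup>+x. ennreal_pow (h x) \<pi> \<partial>lborel) \<theta> \<le> ennreal_pow \<dots> \<theta>"
    using P \<pi> \<theta>' by (intro ennreal_pow_mono) auto
  then show ?thesis
    using False \<pi> \<theta>' by (simp add: Lp_norm_def \<pi>_def[symmetric] ennreal_pow_mult ennreal_pow_pow)
qed

lemma continuously_embeddedI:
  assumes Y: "\<And>f. f \<in> X \<Longrightarrow> normY f < \<infinity> \<Longrightarrow> f \<in> Y"
    and K: "K < top" and le: "\<And>f. f \<in> X \<Longrightarrow> normY f \<le> K * normX f"
    and fin: "\<And>f. f \<in> X \<Longrightarrow> normX f < \<infinity>"
  shows "continuously_embedded X normX Y normY"
proof -
  have "normY f < \<infinity>" if "f \<in> X" for f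
    using le_less_trans[OF le[OF that]] fin[OF that] K by (simp add: ennreal_mult_less_top)
  moreover have "\<exists>C::real. \<forall>f\<in>X. normY f \<le> ennreal C * normX f"
    using K le by (intro exI[of _ "enn2real K"]) simp
  ultimately show ?thesis using Y by (auto simp: continuously_embedded_def)
qed

lemma tent_norm_finite_eq:
  fixes f :: "real \<times> 'a::euclidean_space \<Rightarrow> complex"
  assumes w: "w \<in> borel_measurable borel" and eq: "\<And>t x. 0 < t \<Longrightarrow> whitney_avg r \<beta> f t x = w (t, x)"
    and p: "p < \<infinity>"
  shows "tent_norm p q r \<beta> f = Lp_norm lborel p (\<lambda>x. Lp_norm haar q (\<lambda>t. w (t, x)))"
proof -
  have [measurable]: "w \<in> borel_measurable (borel \<Otimes>\<^sub>M borel)" using w by (simp add: borel_prod)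
  have "Lp_norm dt_over_t q (\<lambda>t. whitney_avg r \<beta> f t x) = Lp_norm haar q (\<lambda>t. w (t, x))" for x
    by (rule Lp_norm_dt_over_t) (auto simp: eq)
  then show ?thesis
    using p by (simp add: tent_norm_def Lp_norm_lebesgue)
qed

lemma Z_norm_eq:
  fixes f :: "real \<times> 'a::euclidean_space \<Rightarrow> complex"
  assumes w: "w \<in> borel_measurable borel" and eq: "\<And>t x. 0 < t \<Longrightarrow> whitney_avg r \<beta> f t x = w (t, x)"
  shows "Z_norm p q r \<beta> f = Lp_norm haar q (\<lambda>t. Lp_norm lborel p (\<lambda>x. w (t, x)))"
proof -
  have [measurable]: "w \<in> borel_measurable (borel \<Otimes>\<^sub>M borel)" using w by (simp add: borel_prod)
  have "whitney_avg r \<beta> f t = (\<lambda>x. w (t, x))" if "0 < t" for t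
    using eq[OF that] by auto
  then show ?thesis unfolding Z_norm_def
    by (intro Lp_norm_dt_over_t) (auto simp: Lp_norm_lebesgue)
qed

text \<open>From here on f matters only through two Borel functions, the larger of them locally
  dominated, which reduces both embeddings to the estimates for general w.\<close>

lemma ex_box_norm_representation:
  fixes f :: "real \<times> 'a::euclidean_space \<Rightarrow> complex"
  assumes f: "f \<in> borel_measurable (lebesgue_on upper_half_space)"
    and r: "0 < r\<^sub>1" "r\<^sub>1 \<le> r\<^sub>0" and \<gamma>: "0 \<le> \<beta>\<^sub>0 - \<beta>\<^sub>1"
    and dom: "\<And>F. F \<in> borel_measurable (borel :: (real \<times> 'a) measure) \<Longrightarrow> locally_dominated C (box_norm r\<^sub>0 F)"
  obtains w\<^sub>0 w\<^sub>1 :: "real \<times> 'a \<Rightarrow> ennreal" where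
    "w\<^sub>0 \<in> borel_measurable borel" "w\<^sub>1 \<in> borel_measurable borel" "locally_dominated C w\<^sub>0"
    "\<And>t x. 0 < t \<Longrightarrow> whitney_avg r\<^sub>0 \<beta>\<^sub>0 f t x = w\<^sub>0 (t, x)"
    "\<And>t x. 0 < t \<Longrightarrow> whitney_avg r\<^sub>1 \<beta>\<^sub>1 f t x = w\<^sub>1 (t, x)"
    "\<And>t x. 0 < t \<Longrightarrow> w\<^sub>1 (t, x) \<le> ennreal (t powr (\<beta>\<^sub>0 - \<beta>\<^sub>1)) * w\<^sub>0 (t, x)"
proof -
  obtain F :: "real \<times> 'a \<Rightarrow> ennreal" where F[measurable]: "F \<in> borel_measurable borel"
    and eq: "AE p in lborel. 0 < fst p \<longrightarrow> ennreal (norm (f p)) = F p"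
    using ex_borel_modulus[OF f] .
  show thesis
  proof (rule that)
    show "box_norm r\<^sub>0 (weighted \<beta>\<^sub>0 F) \<in> borel_measurable borel" "box_norm r\<^sub>1 (weighted \<beta>\<^sub>1 F) \<in> borel_measurable borel"
      by (intro measurable_box_norm measurable_weighted F)+
    show "locally_dominated C (box_norm r\<^sub>0 (weighted \<beta>\<^sub>0 F))"
      by (intro dom measurable_weighted F)
  qed (auto intro!: whitney_avg_eq_box_norm[OF f F eq] box_norm_weighted_le[OF F r \<gamma>])
qed

theorem theorem3p23:
  fixes p\<^sub>0 p\<^sub>1 q r\<^sub>0 r\<^sub>1 :: ennreal and \<beta>\<^sub>0 \<beta>\<^sub>1 :: real
  assumes "0 < p\<^sub>0" "p\<^sub>0 < p\<^sub>1" "p\<^sub>1 \<le> \<infinity>"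
    and "0 < q" "q \<le> \<infinity>"
    and "0 < r\<^sub>1" "r\<^sub>1 \<le> r\<^sub>0" "r\<^sub>0 \<le> \<infinity>"
    and "\<beta>\<^sub>0 - \<beta>\<^sub>1 =
      real DIM('a::euclidean_space) * enn2real (inverse p\<^sub>0) - real DIM('a) * enn2real (inverse p\<^sub>1)"
  shows "continuously_embedded
      (tent_space p\<^sub>0 q r\<^sub>0 \<beta>\<^sub>0 :: (real \<times> 'a \<Rightarrow> complex) set) (tent_norm p\<^sub>0 q r\<^sub>0 \<beta>\<^sub>0)
      (Z_space p\<^sub>1 p\<^sub>0 r\<^sub>1 \<beta>\<^sub>1) (Z_norm p\<^sub>1 p\<^sub>0 r\<^sub>1 \<beta>\<^sub>1)
    \<and> continuously_embedded
      (Z_space p\<^sub>0 p\<^sub>1 r\<^sub>0 \<beta>\<^sub>0 :: (real \<times> 'a \<Rightarrow> complex) set) (Z_norm p\<^sub>0 p\<^sub>1 r\<^sub>0 \<beta>\<^sub>0)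
      (tent_space p\<^sub>1 q r\<^sub>1 \<beta>\<^sub>1) (tent_norm p\<^sub>1 q r\<^sub>1 \<beta>\<^sub>1)"
proof -
  define D where "D = real DIM('a)"
  define P where "P = enn2real p\<^sub>0"
  have p0: "p\<^sub>0 \<noteq> \<infinity>" "p\<^sub>0 < \<infinity>" using less_le_trans[OF assms(2,3)] by auto
  have P: "0 < P" "p\<^sub>0 = ennreal P" using assms(1) p0 by (auto simp: P_def enn2real_positive_iff)
  have p1: "0 < p\<^sub>1" using assms(1,2) by (rule less_trans)
  \<comment> \<open>The ratio of the two integrability exponents. With the value 0 at infinity the
    relation \<gamma> = D * (1 - \<theta>) / P below covers the endpoint as well, in agreement with
    \<open>inverse \<infinity> = 0\<close>.\<close>
  define \<theta> where "\<theta> = (if p\<^sub>1 = \<infinity> then 0 else P / enn2real p\<^sub>1)"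
  have P1: "P < enn2real p\<^sub>1" if "p\<^sub>1 \<noteq> \<infinity>"
    using assms(2) that P by (cases p\<^sub>1) (auto simp: ennreal_less_iff)
  have \<theta>: "0 \<le> \<theta>" "\<theta> < 1" using P P1 by (auto simp: \<theta>_def)
  define \<gamma> where "\<gamma> = \<beta>\<^sub>0 - \<beta>\<^sub>1"
  have inv0: "enn2real (inverse p\<^sub>0) = 1 / P"
    using P by (simp add: inverse_ennreal inverse_eq_divide)
  have inv1: "enn2real (inverse p\<^sub>1) = \<theta> / P"
  proof (cases p\<^sub>1)
    case (real u)
    then show ?thesis using p1 P by (simp add: \<theta>_def inverse_ennreal inverse_eq_divide)
  qed (simp add: \<theta>_def)
  have \<gamma>: "\<gamma> = D * (1 - \<theta>) / P"
    using assms(9) by (simp add: \<gamma>_def D_def inv0 inv1 algebra_simps diff_divide_distrib)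
  then have \<gamma>0: "0 \<le> \<beta>\<^sub>0 - \<beta>\<^sub>1" using \<theta> P by (simp add: \<gamma>_def[symmetric] D_def)
  have "0 < r\<^sub>0" using assms(6,7) by (rule less_le_trans)
  then obtain C where C: "C < top"
    and dom: "\<And>F. F \<in> borel_measurable (borel :: (real \<times> 'a) measure) \<Longrightarrow> locally_dominated C (box_norm r\<^sub>0 F)"
    using locally_dominated_box_norm by blast
  have rep: thesis if f: "f \<in> borel_measurable (lebesgue_on upper_half_space)"
    and obt: "\<And>w\<^sub>0 w\<^sub>1 :: real \<times> 'a \<Rightarrow> ennreal.
      w\<^sub>0 \<in> borel_measurable borel \<Longrightarrow> w\<^sub>1 \<in> borel_measurable borel \<Longrightarrow> locally_dominated C w\<^sub>0 \<Longrightarrow>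
      (\<And>t x. 0 < t \<Longrightarrow> whitney_avg r\<^sub>0 \<beta>\<^sub>0 f t x = w\<^sub>0 (t, x)) \<Longrightarrow>
      (\<And>t x. 0 < t \<Longrightarrow> whitney_avg r\<^sub>1 \<beta>\<^sub>1 f t x = w\<^sub>1 (t, x)) \<Longrightarrow>
      (\<And>t x. 0 < t \<Longrightarrow> w\<^sub>1 (t, x) \<le> ennreal (t powr \<gamma>) * w\<^sub>0 (t, x)) \<Longrightarrow> thesis"
    for f :: "real \<times> 'a \<Rightarrow> complex" and thesis
    using ex_box_norm_representation[OF f assms(6,7) \<gamma>0 dom] obt unfolding \<gamma>_def by metis

  have "continuously_embedded
      (tent_space p\<^sub>0 q r\<^sub>0 \<beta>\<^sub>0 :: (real \<times> 'a \<Rightarrow> complex) set) (tent_norm p\<^sub>0 q r\<^sub>0 \<beta>\<^sub>0)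
      (Z_space p\<^sub>1 p\<^sub>0 r\<^sub>1 \<beta>\<^sub>1) (Z_norm p\<^sub>1 p\<^sub>0 r\<^sub>1 \<beta>\<^sub>1)"
  proof -
    obtain K where K: "K < top" and embed: "\<And>w. w \<in> borel_measurable (borel :: (real \<times> 'a) measure) \<Longrightarrow>
      locally_dominated C w \<Longrightarrow>
      (\<exists>H \<in> borel_measurable borel.
        (\<integral>\<^sup>+t. H t \<partial>haar) \<le> K * (\<integral>\<^sup>+x. ennreal_pow (Lp_norm haar q (\<lambda>t. w (t, x))) P \<partial>lborel) \<and>
        (\<forall>t>0. ennreal (t powr (real DIM('a) * (1 - \<theta>))) *
          Lp_pow \<theta> P (\<lambda>x. w (t, x)) \<le> H t))"
      using mixed_norm_le_vertical_norm[OF P(1) \<theta> assms(4) C, where 'a = 'a] by blast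
    have "Z_norm p\<^sub>1 p\<^sub>0 r\<^sub>1 \<beta>\<^sub>1 f \<le> ennreal_pow K (1 / P) * tent_norm p\<^sub>0 q r\<^sub>0 \<beta>\<^sub>0 f"
      if f: "f \<in> borel_measurable (lebesgue_on upper_half_space)" for f :: "real \<times> 'a \<Rightarrow> complex"
    proof (rule rep[OF f])
      fix w\<^sub>0 w\<^sub>1 :: "real \<times> 'a \<Rightarrow> ennreal"
      assume w: "w\<^sub>0 \<in> borel_measurable borel" "w\<^sub>1 \<in> borel_measurable borel" "locally_dominated C w\<^sub>0"
        and eq: "\<And>t x. 0 < t \<Longrightarrow> whitney_avg r\<^sub>0 \<beta>\<^sub>0 f t x = w\<^sub>0 (t, x)"
          "\<And>t x. 0 < t \<Longrightarrow> whitney_avg r\<^sub>1 \<beta>\<^sub>1 f t x = w\<^sub>1 (t, x)"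
        and le: "\<And>t x. 0 < t \<Longrightarrow> w\<^sub>1 (t, x) \<le> ennreal (t powr \<gamma>) * w\<^sub>0 (t, x)"
      have [measurable]: "w\<^sub>0 \<in> borel_measurable (borel \<Otimes>\<^sub>M borel)" "w\<^sub>1 \<in> borel_measurable (borel \<Otimes>\<^sub>M borel)"
        using w by (simp_all add: borel_prod)
      obtain H where H: "(\<integral>\<^sup>+t. H t \<partial>haar) \<le> K * (\<integral>\<^sup>+x. ennreal_pow (Lp_norm haar q (\<lambda>t. w\<^sub>0 (t, x))) P \<partial>lborel)"
        and le_H: "\<And>t. 0 < t \<Longrightarrow> ennreal (t powr (real DIM('a) * (1 - \<theta>))) *
          Lp_pow \<theta> P (\<lambda>x. w\<^sub>0 (t, x)) \<le> H t"
        using embed[OF w(1,3)] by blast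
      have "(\<integral>\<^sup>+t. ennreal_pow (Lp_norm lborel p\<^sub>1 (\<lambda>x. w\<^sub>1 (t, x))) P \<partial>haar) \<le> (\<integral>\<^sup>+t. H t \<partial>haar)"
      proof (rule nn_integral_haar_mono)
        fix t :: real assume t: "0 < t"
        have "ennreal_pow (Lp_norm lborel p\<^sub>1 (\<lambda>x. w\<^sub>1 (t, x))) P \<le> ennreal_pow (ennreal (t powr \<gamma>)) P *
          Lp_pow \<theta> P (\<lambda>x. w\<^sub>0 (t, x))"
          by (rule Lp_norm_pow_le_scaled[OF _ _ P(1) p1 le[OF t] \<theta>_def]) measurable
        \<comment> \<open>The hypothesis on the weights enters here: \<gamma> * P is precisely the
          exponent D * (1 - \<theta>) of the scale-invariant estimate.\<close>
        also have "ennreal_pow (ennreal (t powr \<gamma>)) P = ennreal (t powr (real DIM('a) * (1 - \<theta>)))"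
          using P by (simp add: ennreal_pow_ennreal powr_powr \<gamma> D_def)
        also note le_H[OF t]
        finally show "ennreal_pow (Lp_norm lborel p\<^sub>1 (\<lambda>x. w\<^sub>1 (t, x))) P \<le> H t" .
      qed
      also note H
      finally have "ennreal_pow (\<integral>\<^sup>+t. ennreal_pow (Lp_norm lborel p\<^sub>1 (\<lambda>x. w\<^sub>1 (t, x))) P \<partial>haar) (1 / P)
        \<le> ennreal_pow (K * (\<integral>\<^sup>+x. ennreal_pow (Lp_norm haar q (\<lambda>t. w\<^sub>0 (t, x))) P \<partial>lborel)) (1 / P)"
        using P by (intro ennreal_pow_mono) auto
      moreover have "Z_norm p\<^sub>1 p\<^sub>0 r\<^sub>1 \<beta>\<^sub>1 f = Lp_norm haar p\<^sub>0 (\<lambda>t. Lp_norm lborel p\<^sub>1 (\<lambda>x. w\<^sub>1 (t, x)))"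
        by (intro Z_norm_eq w eq)
      moreover have "tent_norm p\<^sub>0 q r\<^sub>0 \<beta>\<^sub>0 f = Lp_norm lborel p\<^sub>0 (\<lambda>x. Lp_norm haar q (\<lambda>t. w\<^sub>0 (t, x)))"
        by (intro tent_norm_finite_eq w eq p0)
      ultimately show "Z_norm p\<^sub>1 p\<^sub>0 r\<^sub>1 \<beta>\<^sub>1 f \<le> ennreal_pow K (1 / P) * tent_norm p\<^sub>0 q r\<^sub>0 \<beta>\<^sub>0 f"
        using p0 by (simp add: Lp_norm_def[of _ p\<^sub>0] P_def[symmetric] ennreal_pow_mult)
    qed
    then show ?thesis
      using K by (intro continuously_embeddedI[where K = "ennreal_pow K (1 / P)"])
        (auto simp: tent_space_def Z_space_def)
  qed
  moreover have "continuously_embedded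
      (Z_space p\<^sub>0 p\<^sub>1 r\<^sub>0 \<beta>\<^sub>0 :: (real \<times> 'a \<Rightarrow> complex) set) (Z_norm p\<^sub>0 p\<^sub>1 r\<^sub>0 \<beta>\<^sub>0)
      (tent_space p\<^sub>1 q r\<^sub>1 \<beta>\<^sub>1) (tent_norm p\<^sub>1 q r\<^sub>1 \<beta>\<^sub>1)"
  proof -
    have "\<exists>K<top. \<forall>f \<in> borel_measurable (lebesgue_on upper_half_space) :: (real \<times> 'a \<Rightarrow> complex) set.
      tent_norm p\<^sub>1 q r\<^sub>1 \<beta>\<^sub>1 f \<le> K * Z_norm p\<^sub>0 p\<^sub>1 r\<^sub>0 \<beta>\<^sub>0 f"
    \<comment> \<open>Duality is available for a finite target exponent only. At the endpoint the
      tent norm has a different shape as well, a supremum over Carleson boxes or of all Whitney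
      averages.\<close>
    proof (cases "p\<^sub>1 = \<infinity>")
      case False
      define P\<^sub>1 where "P\<^sub>1 = enn2real p\<^sub>1"
      have PP: "P < P\<^sub>1" using P1[OF False] by (simp add: P\<^sub>1_def)
      have \<theta>': "\<theta> = P / P\<^sub>1" using False by (simp add: \<theta>_def P\<^sub>1_def)
      have \<gamma>': "\<gamma> = real DIM('a) * (1 / P - 1 / P\<^sub>1)"
        using P PP by (simp add: \<gamma> \<theta>' D_def field_simps)
      obtain K where K: "K < top" and embed: "\<And>w. w \<in> borel_measurable (borel :: (real \<times> 'a) measure) \<Longrightarrow>
        locally_dominated C w \<Longrightarrow>
        (\<integral>\<^sup>+x. ennreal_pow (Lp_norm haar q (\<lambda>t. ennreal (t powr \<gamma>) * w (t, x))) P\<^sub>1 \<partial>lborel)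
        \<le> K * (\<integral>\<^sup>+t. ennreal_pow (\<integral>\<^sup>+x. ennreal_pow (w (t, x)) P \<partial>lborel) (P\<^sub>1 / P) \<partial>haar)"
        using vertical_norm_le_mixed_norm[OF P(1) PP assms(4) C \<gamma>'] by blast
      have "tent_norm p\<^sub>1 q r\<^sub>1 \<beta>\<^sub>1 f \<le> ennreal_pow K (1 / P\<^sub>1) * Z_norm p\<^sub>0 p\<^sub>1 r\<^sub>0 \<beta>\<^sub>0 f"
        if f: "f \<in> borel_measurable (lebesgue_on upper_half_space)" for f :: "real \<times> 'a \<Rightarrow> complex"
      proof (rule rep[OF f])
        fix w\<^sub>0 w\<^sub>1 :: "real \<times> 'a \<Rightarrow> ennreal"
        assume w: "w\<^sub>0 \<in> borel_measurable borel" "w\<^sub>1 \<in> borel_measurable borel" "locally_dominated C w\<^sub>0"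
          and eq: "\<And>t x. 0 < t \<Longrightarrow> whitney_avg r\<^sub>0 \<beta>\<^sub>0 f t x = w\<^sub>0 (t, x)"
            "\<And>t x. 0 < t \<Longrightarrow> whitney_avg r\<^sub>1 \<beta>\<^sub>1 f t x = w\<^sub>1 (t, x)"
          and le: "\<And>t x. 0 < t \<Longrightarrow> w\<^sub>1 (t, x) \<le> ennreal (t powr \<gamma>) * w\<^sub>0 (t, x)"
        have [measurable]: "w\<^sub>0 \<in> borel_measurable (borel \<Otimes>\<^sub>M borel)" "w\<^sub>1 \<in> borel_measurable (borel \<Otimes>\<^sub>M borel)"
          using w by (simp_all add: borel_prod)
        have "(\<integral>\<^sup>+x. ennreal_pow (Lp_norm haar q (\<lambda>t. w\<^sub>1 (t, x))) P\<^sub>1 \<partial>lborel)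
          \<le> (\<integral>\<^sup>+x. ennreal_pow (Lp_norm haar q (\<lambda>t. ennreal (t powr \<gamma>) * w\<^sub>0 (t, x))) P\<^sub>1 \<partial>lborel)"
          using P PP by (intro nn_integral_mono ennreal_pow_mono Lp_norm_haar_mono le) auto
        also note embed[OF w(1,3)]
        finally have "ennreal_pow (\<integral>\<^sup>+x. ennreal_pow (Lp_norm haar q (\<lambda>t. w\<^sub>1 (t, x))) P\<^sub>1 \<partial>lborel) (1 / P\<^sub>1)
          \<le> ennreal_pow (K * (\<integral>\<^sup>+t. ennreal_pow (\<integral>\<^sup>+x. ennreal_pow (w\<^sub>0 (t, x)) P \<partial>lborel) (P\<^sub>1 / P) \<partial>haar)) (1 / P\<^sub>1)"
          using P PP by (intro ennreal_pow_mono) auto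
        moreover have "Z_norm p\<^sub>0 p\<^sub>1 r\<^sub>0 \<beta>\<^sub>0 f = Lp_norm haar p\<^sub>1 (\<lambda>t. Lp_norm lborel p\<^sub>0 (\<lambda>x. w\<^sub>0 (t, x)))"
          by (intro Z_norm_eq w eq)
        moreover have "tent_norm p\<^sub>1 q r\<^sub>1 \<beta>\<^sub>1 f = Lp_norm lborel p\<^sub>1 (\<lambda>x. Lp_norm haar q (\<lambda>t. w\<^sub>1 (t, x)))"
          using False by (intro tent_norm_finite_eq w eq) (simp_all add: less_top)
        ultimately show "tent_norm p\<^sub>1 q r\<^sub>1 \<beta>\<^sub>1 f \<le> ennreal_pow K (1 / P\<^sub>1) * Z_norm p\<^sub>0 p\<^sub>1 r\<^sub>0 \<beta>\<^sub>0 f"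
          using p0 False
          by (simp add: Lp_norm_def[of _ p\<^sub>0] Lp_norm_def[of _ p\<^sub>1] P_def[symmetric] P\<^sub>1_def[symmetric]
              ennreal_pow_mult ennreal_pow_pow)
      qed
      then show ?thesis using K by (intro exI[of _ "ennreal_pow K (1 / P\<^sub>1)"]) simp
    next
      case True
      have \<gamma>': "\<gamma> = real DIM('a) / P" using True by (simp add: \<gamma> \<theta>_def D_def)
      \<comment> \<open>With infinite time exponent the Z norm is an essential supremum, so it
        bounds the norm in space for almost every t. This is the form of hypothesis shared by the
        supremum and the Carleson bound, with B the Z norm itself.\<close>
      have Z_AE: "AE t in haar. (\<integral>\<^sup>+x. ennreal_pow (w (t, x)) P \<partial>lborel) \<le> ennreal_pow (Z_norm p\<^sub>0 p\<^sub>1 r\<^sub>0 \<beta>\<^sub>0 f) P"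
        if "w \<in> borel_measurable borel" "\<And>t x. 0 < t \<Longrightarrow> whitney_avg r\<^sub>0 \<beta>\<^sub>0 f t x = w (t, x)"
        for f :: "real \<times> 'a \<Rightarrow> complex" and w
      proof -
        have "Z_norm p\<^sub>0 p\<^sub>1 r\<^sub>0 \<beta>\<^sub>0 f = esssup haar (\<lambda>t. Lp_norm lborel p\<^sub>0 (\<lambda>x. w (t, x)))"
          using True by (subst Z_norm_eq[where w = w]) (auto simp: that Lp_norm_def[of haar])
        then have "AE t in haar. Lp_norm lborel p\<^sub>0 (\<lambda>x. w (t, x)) \<le> Z_norm p\<^sub>0 p\<^sub>1 r\<^sub>0 \<beta>\<^sub>0 f"
          using esssup_AE by metis
        then show ?thesis
        proof eventually_elim
          case (elim t)
          then show ?case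
            using p0 P by (simp add: Lp_norm_def P_def[symmetric] ennreal_pow_le_swap[of "1 / P"])
        qed
      qed
      show ?thesis
      proof (cases "q = \<infinity>")
        case q: True
        obtain K where K: "K < top" and sup: "\<And>w B t x. w \<in> borel_measurable (borel :: (real \<times> 'a) measure) \<Longrightarrow>
          locally_dominated C w \<Longrightarrow>
          (AE t in haar. (\<integral>\<^sup>+x. ennreal_pow (w (t, x)) P \<partial>lborel) \<le> ennreal_pow B P) \<Longrightarrow> 0 < t \<Longrightarrow>
          ennreal (t powr \<gamma>) * w (t, x) \<le> K * B"
          using weighted_sup_le[OF P(1) C, where 'a = 'a] unfolding \<gamma>' by blast
        have "tent_norm p\<^sub>1 q r\<^sub>1 \<beta>\<^sub>1 f \<le> K * Z_norm p\<^sub>0 p\<^sub>1 r\<^sub>0 \<beta>\<^sub>0 f"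
          if f: "f \<in> borel_measurable (lebesgue_on upper_half_space)" for f :: "real \<times> 'a \<Rightarrow> complex"
        proof (rule rep[OF f])
          fix w\<^sub>0 w\<^sub>1 :: "real \<times> 'a \<Rightarrow> ennreal"
          assume w: "w\<^sub>0 \<in> borel_measurable borel" "locally_dominated C w\<^sub>0"
            and eq: "\<And>t x. 0 < t \<Longrightarrow> whitney_avg r\<^sub>0 \<beta>\<^sub>0 f t x = w\<^sub>0 (t, x)"
              "\<And>t x. 0 < t \<Longrightarrow> whitney_avg r\<^sub>1 \<beta>\<^sub>1 f t x = w\<^sub>1 (t, x)"
            and le: "\<And>t x. 0 < t \<Longrightarrow> w\<^sub>1 (t, x) \<le> ennreal (t powr \<gamma>) * w\<^sub>0 (t, x)"
          have "whitney_avg r\<^sub>1 \<beta>\<^sub>1 f t x \<le> K * Z_norm p\<^sub>0 p\<^sub>1 r\<^sub>0 \<beta>\<^sub>0 f" if "0 < t" for t x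
            using order_trans[OF le[OF that] sup[OF w Z_AE[OF w(1) eq(1)] that]] eq(2)[OF that] by simp
          then show "tent_norm p\<^sub>1 q r\<^sub>1 \<beta>\<^sub>1 f \<le> K * Z_norm p\<^sub>0 p\<^sub>1 r\<^sub>0 \<beta>\<^sub>0 f"
            using True q by (auto simp: tent_norm_def intro!: SUP_least)
        qed
        then show ?thesis using K by blast
      next
        case q: False
        define Q where "Q = enn2real q"
        have Q: "0 < Q" using assms(4) q by (simp add: Q_def enn2real_positive_iff less_top)
        obtain K where K: "K < top" and carleson: "\<And>w B \<tau> y. w \<in> borel_measurable (borel :: (real \<times> 'a) measure) \<Longrightarrow>
          locally_dominated C w \<Longrightarrow>
          (AE t in haar. (\<integral>\<^sup>+x. ennreal_pow (w (t, x)) P \<partial>lborel) \<le> ennreal_pow B P) \<Longrightarrow> 0 < \<tau> \<Longrightarrow>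
          (\<integral>\<^sup>+t\<in>{0<..<\<tau>}. mean_value (ball y \<tau>)
            (\<lambda>x. ennreal_pow (ennreal (t powr \<gamma>) * w (t, x)) Q) \<partial>haar) \<le> K * ennreal_pow B Q"
          using carleson_norm_le[OF P(1) Q C, where 'a = 'a] unfolding \<gamma>' by blast
        have "tent_norm p\<^sub>1 q r\<^sub>1 \<beta>\<^sub>1 f \<le> ennreal_pow K (1 / Q) * Z_norm p\<^sub>0 p\<^sub>1 r\<^sub>0 \<beta>\<^sub>0 f"
          if f: "f \<in> borel_measurable (lebesgue_on upper_half_space)" for f :: "real \<times> 'a \<Rightarrow> complex"
        proof (rule rep[OF f])
          fix w\<^sub>0 w\<^sub>1 :: "real \<times> 'a \<Rightarrow> ennreal"
          assume w: "w\<^sub>0 \<in> borel_measurable borel" "locally_dominated C w\<^sub>0"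
            and eq: "\<And>t x. 0 < t \<Longrightarrow> whitney_avg r\<^sub>0 \<beta>\<^sub>0 f t x = w\<^sub>0 (t, x)"
              "\<And>t x. 0 < t \<Longrightarrow> whitney_avg r\<^sub>1 \<beta>\<^sub>1 f t x = w\<^sub>1 (t, x)"
            and le: "\<And>t x. 0 < t \<Longrightarrow> w\<^sub>1 (t, x) \<le> ennreal (t powr \<gamma>) * w\<^sub>0 (t, x)"
          have [measurable]: "w\<^sub>0 \<in> borel_measurable (borel \<Otimes>\<^sub>M borel)" using w by (simp add: borel_prod)
          have "ennreal_pow (\<integral>\<^sup>+t\<in>{0<..<\<tau>}. mean_value (ball y \<tau>)
              (\<lambda>x. ennreal_pow (whitney_avg r\<^sub>1 \<beta>\<^sub>1 f t x) Q) \<partial>dt_over_t) (1 / Q)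
            \<le> ennreal_pow K (1 / Q) * Z_norm p\<^sub>0 p\<^sub>1 r\<^sub>0 \<beta>\<^sub>0 f" if \<tau>: "0 < \<tau>" for \<tau> y
          proof -
            have "(\<integral>\<^sup>+t\<in>{0<..<\<tau>}. mean_value (ball y \<tau>) (\<lambda>x. ennreal_pow (whitney_avg r\<^sub>1 \<beta>\<^sub>1 f t x) Q) \<partial>dt_over_t)
              \<le> (\<integral>\<^sup>+t\<in>{0<..<\<tau>}. mean_value (ball y \<tau>) (\<lambda>x. ennreal_pow (ennreal (t powr \<gamma>) * w\<^sub>0 (t, x)) Q) \<partial>dt_over_t)"
              unfolding mean_value_def using Q
              by (intro nn_integral_dt_over_t_mono mult_right_mono divide_right_mono_ennreal
                  nn_integral_mono ennreal_pow_mono) (auto simp: eq(2) le)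
            also have "\<dots> = (\<integral>\<^sup>+t\<in>{0<..<\<tau>}. mean_value (ball y \<tau>) (\<lambda>x. ennreal_pow (ennreal (t powr \<gamma>) * w\<^sub>0 (t, x)) Q) \<partial>haar)"
              unfolding mean_value_def nn_integral_completion by (rule nn_integral_dt_over_t) measurable
            also have "\<dots> \<le> K * ennreal_pow (Z_norm p\<^sub>0 p\<^sub>1 r\<^sub>0 \<beta>\<^sub>0 f) Q"
              by (rule carleson[OF w Z_AE[OF w(1) eq(1)] \<tau>])
            finally show ?thesis
              using Q by (subst ennreal_pow_le_swap) (auto simp: ennreal_pow_mult ennreal_pow_pow)
          qed
          then show "tent_norm p\<^sub>1 q r\<^sub>1 \<beta>\<^sub>1 f \<le> ennreal_pow K (1 / Q) * Z_norm p\<^sub>0 p\<^sub>1 r\<^sub>0 \<beta>\<^sub>0 f"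
            using True q by (auto simp: tent_norm_def less_top Q_def[symmetric] intro!: SUP_least)
        qed
        then show ?thesis using K by (intro exI[of _ "ennreal_pow K (1 / Q)"]) simp
      qed
    qed
    then obtain K where K: "K < top" "\<And>f :: real \<times> 'a \<Rightarrow> complex.
      f \<in> borel_measurable (lebesgue_on upper_half_space) \<Longrightarrow>
      tent_norm p\<^sub>1 q r\<^sub>1 \<beta>\<^sub>1 f \<le> K * Z_norm p\<^sub>0 p\<^sub>1 r\<^sub>0 \<beta>\<^sub>0 f" by blast
    then show ?thesis
      by (intro continuously_embeddedI[where K = K]) (auto simp: tent_space_def Z_space_def)
  qed
  ultimately show ?thesis by blast
qed

end
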